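(* Let $K$ be a field, $A=K[X_1,\ldots,X_n]$, and let $I\subsetneq A$ be an almost universal squarefree lexsegment ideal (AUSLI) generated in degree $d$. Then the symmetric algebra $\mathrm{Sym}_A(I)$ of $I$ satisfies: (1) $\dim(\mathrm{Sym}_A(I))=n+1$; (2) $\mathrm{e}(\mathrm{Sym}_A(I))=2|G(I)|-2$.
   Context: $A=K[X_1,\dots,X_n]$ is standard graded. For a monomial ideal $I$, $G(I)$ is its unique minimal set of monomial generators; $I$ is generated in degree $d$ ($d\ge1$) if $G(I)$ is nonempty and all its elements have degree $d$. For squarefree monomials of the same degree $u=X_{i_1}\cdots X_{i_d}$, $v=X_{j_1}\cdots X_{j_d}$ with $i_1<\cdots<i_d$ and $j_1<\cdots<j_d$, write $u>_{\mathrm{slex}}v$ if for some $1\le s\le d$ one has $i_1=j_1,\ldots,i_{s-1}=j_{s-1}$ and $i_s<j_s$. A monomial ideal $I\subsetneq A$ is a squarefree lexsegment ideal if it is generated by squarefree monomials and for all squarefree monomials $u\in I$ and all squarefree monomials $v\in A$ with $\deg u=\deg v$ and $v>_{\mathrm{slex}}u$ one has $v\in I$. For $m\ge1$ put $A_{[m]}=K[X_1,\ldots,X_n,X_{n+1},\ldots,X_{n+m}]$. A squarefree lexsegment ideal $I$ of $A$ is a universal squarefree lexsegment ideal (USLI) if for every integer $m\ge 1$ the ideal $IA_{[m]}$ is a squarefree lexsegment ideal of $A_{[m]}$. A squarefree lexsegment ideal $I$ generated in degree $d$ with $G(I)=\{u_1,\dots,u_\ell,u_{\ell+1}\}$, $u_1>_{\mathrm{slex}}\cdots>_{\mathrm{slex}}u_{\ell+1}$,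 is an almost universal squarefree lexsegment ideal (AUSLI) if $I$ is not an USLI of $A$ but $(u_1,\dots,u_\ell)$ is an USLI of $A$. If $G(I)=\{f_1,\dots,f_q\}$, then $\mathrm{Sym}_A(I)=S/J$ with $S=K[X_1,\dots,X_n,T_1,\dots,T_q]$ and $J$ generated by the forms $\sum_i a_iT_i$ with $a_i\in A$, $\sum_i a_if_i=0$. Since the $f_i$ have the same degree, $J$ is homogeneous for the standard grading of $S$ (all $X_i$ and $T_j$ of degree $1$); $\dim$ is Krull dimension and $\mathrm{e}$ is the multiplicity of the standard graded $K$-algebra $S/J$. *)

theory Defs
  imports
    "HOL-Library.Poly_Mapping"
    "HOL-Library.Extended_Nat"
    "HOL-Computational_Algebra.Polynomial"
    "HOL-Algebra.QuotRing"
    "HOL-Algebra.Embedded_Algebras"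
begin

section \<open>Polynomial rings\<close>

text \<open>
  All polynomial rings over the field \<open>'k\<close> live in one type of polynomials, whose indeterminates
  are \<open>X\<^sub>i\<close> and \<open>T\<^sub>j\<close>. Thus \<open>K[X\<^sub>1,\<dots>,X\<^sub>n]\<close> is literally a subset of \<open>K[X\<^sub>1,\<dots>,X\<^bsub>n+m\<^esub>]\<close> and of
  \<open>K[X\<^sub>1,\<dots>,X\<^sub>n,T\<^sub>1,\<dots>,T\<^sub>q]\<close>. Numbering starts at \<open>1\<close>.
\<close>

datatype indet = Xvar nat | Tvar nat

type_synonym monomial = "indet \<Rightarrow>\<^sub>0 nat"
type_synonym 'k polynomial = "monomial \<Rightarrow>\<^sub>0 'k"

definition Xvars :: "nat \<Rightarrow> indet set" where
  "Xvars n = Xvar ` {1..n}"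

definition XTvars :: "nat \<Rightarrow> nat \<Rightarrow> indet set" where
  "XTvars n q = Xvar ` {1..n} \<union> Tvar ` {1..q}"

definition monomials :: "indet set \<Rightarrow> monomial set" where
  "monomials V = {u. Poly_Mapping.keys u \<subseteq> V}"

definition mdeg :: "monomial \<Rightarrow> nat" where
  "mdeg u = (\<Sum>v\<in>Poly_Mapping.keys u. Poly_Mapping.lookup u v)"

definition mono_poly :: "monomial \<Rightarrow> 'k::field polynomial" where
  "mono_poly u = Poly_Mapping.single u 1"

definition indet_poly :: "indet \<Rightarrow> 'k::field polynomial" where
  "indet_poly v = mono_poly (Poly_Mapping.single v 1)"

definition poly_ring :: "indet set \<Rightarrow> 'k::field polynomial ring" where
  "poly_ring V = \<lparr>carrier = {p. Poly_Mapping.keys p \<subseteq> monomials V}, mult = (*), one = 1, zero = 0, add = (+)\<rparr>"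

section \<open>Monomial ideals and squarefree lexsegment ideals\<close>

definition mono_ideal :: "nat \<Rightarrow> monomial set \<Rightarrow> 'k::field polynomial set" where
  "mono_ideal n M = Idl\<^bsub>poly_ring (Xvars n)\<^esub> (mono_poly ` M)"

definition min_gens :: "nat \<Rightarrow> 'k::field polynomial set \<Rightarrow> monomial set" where
  "min_gens n I = (THE G. G \<subseteq> monomials (Xvars n) \<and> mono_ideal n G = I \<and>
                          (\<forall>H. H \<subset> G \<longrightarrow> mono_ideal n H \<noteq> I))"

definition generated_in_degree :: "nat \<Rightarrow> nat \<Rightarrow> 'k::field polynomial set \<Rightarrow> bool" where
  "generated_in_degree n d I \<longleftrightarrow>
     d \<ge> 1 \<and> min_gens n I \<noteq> {} \<and> (\<forall>u\<in>min_gens n I. mdeg u = d)"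

definition sqfree_monomials :: "nat \<Rightarrow> monomial set" where
  "sqfree_monomials n = {u \<in> monomials (Xvars n). \<forall>v. Poly_Mapping.lookup u v \<le> 1}"

definition index_list :: "monomial \<Rightarrow> nat list" where
  "index_list u = sorted_list_of_set {i. Xvar i \<in> Poly_Mapping.keys u}"

text \<open>\<open>slex_gt u v\<close> is \<open>u >\<^bsub>slex\<^esub> v\<close>; it is only used for squarefree monomials in the \<open>X\<^sub>i\<close>.
  List positions start at \<open>0\<close>.\<close>

definition slex_gt :: "monomial \<Rightarrow> monomial \<Rightarrow> bool" where
  "slex_gt u v \<longleftrightarrow> mdeg u = mdeg v \<and>
     (\<exists>s < mdeg u. (\<forall>r < s. index_list u ! r = index_list v ! r) \<and>
                   index_list u ! s < index_list v ! s)"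

definition sqfree_lex_ideal :: "nat \<Rightarrow> 'k::field polynomial set \<Rightarrow> bool" where
  "sqfree_lex_ideal n I \<longleftrightarrow>
     I \<noteq> carrier (poly_ring (Xvars n)) \<and>
     (\<exists>M \<subseteq> sqfree_monomials n. I = mono_ideal n M) \<and>
     (\<forall>u \<in> sqfree_monomials n. \<forall>v \<in> sqfree_monomials n.
        mono_poly u \<in> I \<longrightarrow> mdeg u = mdeg v \<longrightarrow> slex_gt v u \<longrightarrow> mono_poly v \<in> I)"

definition usli :: "nat \<Rightarrow> 'k::field polynomial set \<Rightarrow> bool" where
  "usli n I \<longleftrightarrow> sqfree_lex_ideal n I \<and>
     (\<forall>m \<ge> 1. sqfree_lex_ideal (n + m) (Idl\<^bsub>poly_ring (Xvars (n + m))\<^esub> I))"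

definition ausli :: "nat \<Rightarrow> nat \<Rightarrow> 'k::field polynomial set \<Rightarrow> bool" where
  "ausli n d I \<longleftrightarrow> sqfree_lex_ideal n I \<and> generated_in_degree n d I \<and> \<not> usli n I \<and>
     (\<exists>us u. min_gens n I = set (us @ [u]) \<and> sorted_wrt slex_gt (us @ [u]) \<and>
             usli n (mono_ideal n (set us) :: 'k polynomial set))"

section \<open>The symmetric algebra\<close>

text \<open>The symmetric algebra of the ideal of \<open>A = K[X\<^sub>1,\<dots>,X\<^sub>n]\<close> generated by the monomials
  \<open>f\<^sub>1,\<dots>,f\<^sub>q\<close> is \<open>S/J\<close> with \<open>S = poly_ring (XTvars n q)\<close> and \<open>J = sym_ideal n q f\<close>.\<close>

definition sym_ideal :: "nat \<Rightarrow> nat \<Rightarrow> (nat \<Rightarrow> monomial) \<Rightarrow> 'k::field polynomial set" where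
  "sym_ideal n q f = Idl\<^bsub>poly_ring (XTvars n q)\<^esub>
     {\<Sum>i=1..q. a i * indet_poly (Tvar i) | a.
        (\<forall>i\<in>{1..q}. a i \<in> carrier (poly_ring (Xvars n))) \<and>
        (\<Sum>i=1..q. a i * mono_poly (f i)) = 0}"

section \<open>Dimension and multiplicity\<close>

text \<open>Since the supremum is taken in \<^typ>\<open>enat\<close>, the zero ring gets dimension \<open>0\<close>.\<close>

definition krull_dim :: "('a, 'b) ring_scheme \<Rightarrow> enat" where
  "krull_dim R = Sup {enat k | k. \<exists>P. (\<forall>i\<le>k. primeideal (P i) R) \<and> (\<forall>i<k. P i \<subset> P (Suc i))}"

text \<open>In the following, \<open>J\<close> is a proper homogeneous ideal of \<open>S = poly_ring V\<close>, with \<open>V\<close> finite,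
  and \<open>S/J\<close> carries the standard grading (every indeterminate in \<open>V\<close> has degree \<open>1\<close>).
  \<open>quot_image V J E\<close> is the image of \<open>E \<subseteq> S\<close> in \<open>S/J\<close>, and the image of the constant
  polynomials is the copy of \<open>K\<close> in \<open>S/J\<close> over which dimensions are taken.\<close>

definition quot_image ::
    "indet set \<Rightarrow> 'k::field polynomial set \<Rightarrow> 'k polynomial set \<Rightarrow> 'k polynomial set set" where
  "quot_image V J E = (\<lambda>p. J +>\<^bsub>poly_ring V\<^esub> p) ` E"

definition const_polys :: "'k::field polynomial set" where
  "const_polys = range (Poly_Mapping.single 0)"

definition homog_polys :: "indet set \<Rightarrow> nat \<Rightarrow> 'k::field polynomial set" where
  "homog_polys V t = {p. \<forall>u\<in>Poly_Mapping.keys p. u \<in> monomials V \<and> mdeg u = t}"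

definition quot_dim :: "indet set \<Rightarrow> 'k::field polynomial set \<Rightarrow> 'k polynomial set \<Rightarrow> nat" where
  "quot_dim V J E =
     ring.dim (poly_ring V Quot J) (quot_image V J const_polys) (quot_image V J E)"

definition hilbert_fun :: "indet set \<Rightarrow> 'k::field polynomial set \<Rightarrow> nat \<Rightarrow> nat" where
  "hilbert_fun V J t = quot_dim V J (homog_polys V t)"

definition hilbert_poly :: "indet set \<Rightarrow> 'k::field polynomial set \<Rightarrow> rat poly" where
  "hilbert_poly V J =
     (THE p. eventually (\<lambda>t. poly p (of_nat t) = of_nat (hilbert_fun V J t)) sequentially)"

text \<open>If \<open>D = dim S/J \<ge> 1\<close>, the Hilbert polynomial has degree \<open>D - 1\<close> and leading coefficient
  \<open>e / (D - 1)!\<close>; if \<open>D = 0\<close>, then \<open>e\<close> is the length of \<open>S/J\<close>, that is, its dimension over \<open>K\<close>.\<close>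

definition graded_multiplicity :: "indet set \<Rightarrow> 'k::field polynomial set \<Rightarrow> rat" where
  "graded_multiplicity V J =
     (let D = the_enat (krull_dim (poly_ring V Quot J))
      in if D = 0 then of_nat (quot_dim V J (carrier (poly_ring V)))
         else fact (D - 1) * poly.coeff (hilbert_poly V J) (D - 1))"

end

theory Submission
  imports Defs
begin

text \<open>
  An AUSLI generated in degree \<open>d\<close> can only be \<open>X\<^sub>1\<dots>X\<^bsub>d-2\<^esub>\<close> times the edge ideal of a triangle with whiskers, with
  generators \<open>X\<^bsub>d-1\<^esub>X\<^sub>j\<close> (\<open>d \<le> j \<le> n\<close>) and \<open>X\<^sub>dX\<^bsub>d+1\<^esub>\<close>. Such an ideal is of linear type: rewriting with the linear
  syzygies brings every monomial of \<open>S\<close> into a normal form, and distinct normal forms have distinct images in the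
  Rees algebra \<open>K[X,\<tau>]\<close>. Hence \<open>J\<close> is prime, and \<open>S/J\<close> embeds into a polynomial ring in \<open>n + 1\<close> variables, so that
  no chain of primes is longer than \<open>n + 1\<close>, while \<open>J \<subset> (T) \<subset> (T,X\<^sub>1) \<subset> \<dots> \<subset> (T,X\<^sub>1,\<dots>,X\<^sub>n)\<close> has this length. The
  normal forms are a disjoint union of \<open>2(|G(I)| - 1)\<close> translates of free monoids of rank \<open>n + 1\<close>, which gives the
  leading coefficient of the Hilbert polynomial.
\<close>

section \<open>Polynomial rings\<close>

text \<open>The shape of an AUSLI comes from the added variables: in the extended ring, a generator
  of degree d not divisible by X_1...X_{d-1} forces X_1...X_{d-1}X_{n+1} into a lexsegment ideal,
  although this monomial is not in the extension of an ideal of A generated in degree d. So all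
  generators of an USLI generated in degree d are divisible by X_1...X_{d-1}. The last generator of
  an AUSLI must break this rule, and then everything slex-above it is present. Among the syzygies,
  the rewriting uses only the two-term ones X_a f_i = X_b f_j. They can all be directed by one
  weight on the X-variables; the only one against the order of the indices is X_{d-1}T_{t0} = X_d
  T_{t(d+1)}, which is why X_{d-1} is made heaviest. The length of a chain of primes is bounded by
  comparing numbers of monomials, so that linear algebra suffices. In the multiplicity, the factor 2
  is the choice between X_{d-1} and T_{t0}, which never occur together in a normal form, and |G(I)|
  - 1 = n - d + 1 counts the positions at which the X-variables stop and the T-variables
  start.\<close>

lemma poly_ring_simps [simp]:
  "carrier (poly_ring V) = {p. Poly_Mapping.keys p \<subseteq> monomials V}"
  "mult (poly_ring V) = (*)" "one (poly_ring V) = 1"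
  "zero (poly_ring V) = 0" "add (poly_ring V) = (+)"
  by (simp_all add: poly_ring_def)

lemma keys_add_nat: "Poly_Mapping.keys (u + v :: 'a \<Rightarrow>\<^sub>0 nat) = Poly_Mapping.keys u \<union> Poly_Mapping.keys v"
  by (auto simp: in_keys_iff lookup_add)

lemma monomials_0 [simp]: "0 \<in> monomials V"
  by (simp add: monomials_def)

lemma monomials_add_iff [simp]: "u + v \<in> monomials V \<longleftrightarrow> u \<in> monomials V \<and> v \<in> monomials V"
  by (auto simp: monomials_def keys_add_nat)

lemma monomials_single [simp]: "v \<in> V \<Longrightarrow> Poly_Mapping.single v k \<in> monomials V"
  by (auto simp: monomials_def)

lemma keys_mult_monomials:
  assumes "Poly_Mapping.keys p \<subseteq> monomials V" "Poly_Mapping.keys q \<subseteq> monomials V"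
  shows "Poly_Mapping.keys (p * q) \<subseteq> monomials V"
  using keys_mult[of p q] assms by fastforce

lemma poly_ring_cring: "cring (poly_ring V :: 'k::field polynomial ring)"
proof (rule cringI)
  show "abelian_group (poly_ring V :: 'k polynomial ring)"
  proof (rule abelian_groupI)
    fix x :: "'k polynomial" assume x: "x \<in> carrier (poly_ring V)"
    then show "\<exists>y\<in>carrier (poly_ring V). y \<oplus>\<^bsub>poly_ring V\<^esub> x = \<zero>\<^bsub>poly_ring V\<^esub>"
      by (intro bexI[of _ "- x"]) auto
  next
    fix x y :: "'k polynomial" assume "x \<in> carrier (poly_ring V)" "y \<in> carrier (poly_ring V)"
    then show "x \<oplus>\<^bsub>poly_ring V\<^esub> y \<in> carrier (poly_ring V)"
      using keys_add[of x y] by auto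
  qed (auto simp: add_ac)
  show "Group.comm_monoid (poly_ring V :: 'k polynomial ring)"
    by unfold_locales (auto simp: mult_ac dest: subsetD[OF keys_mult_monomials, rotated -1])
qed (auto simp: algebra_simps)

lemma poly_ring_ring: "ring (poly_ring V)"
  using poly_ring_cring cring.axioms(1) by blast

lemma poly_ring_a_inv:
  assumes "p \<in> carrier (poly_ring V)"
  shows "\<ominus>\<^bsub>poly_ring V\<^esub> p = - p"
proof -
  interpret cring "poly_ring V" by (rule poly_ring_cring)
  show ?thesis
    by (rule minus_equality) (use assms in auto)
qed

lemma poly_ring_minus:
  assumes "q \<in> carrier (poly_ring V)"
  shows "p \<ominus>\<^bsub>poly_ring V\<^esub> q = p - q"
  using poly_ring_a_inv[OF assms] by (simp add: a_minus_def)

lemma mono_poly_in_poly_ring [simp]: "Poly_Mapping.keys (mono_poly u :: 'k::field polynomial) \<subseteq> monomials V \<longleftrightarrow> u \<in> monomials V"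
  by (simp add: mono_poly_def)

lemma mono_poly_add: "mono_poly (u + v) = mono_poly u * (mono_poly v :: 'k::field polynomial)"
  by (simp add: mono_poly_def mult_single)

lemma mono_poly_0 [simp]: "mono_poly 0 = 1"
  by (simp add: mono_poly_def)

lemma keys_mono_poly [simp]: "Poly_Mapping.keys (mono_poly u :: 'k::field polynomial) = {u}"
  by (simp add: mono_poly_def)

lemma poly_mapping_sum_single:
  assumes "finite U" "Poly_Mapping.keys p \<subseteq> U"
  shows "p = (\<Sum>u\<in>U. Poly_Mapping.single u (Poly_Mapping.lookup p u))"
proof (rule poly_mapping_eqI)
  fix k
  have "Poly_Mapping.lookup (\<Sum>u\<in>U. Poly_Mapping.single u (Poly_Mapping.lookup p u)) k
      = (\<Sum>u\<in>U. if u = k then Poly_Mapping.lookup p k else 0)"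
    by (simp add: lookup_sum lookup_single when_def) (rule sum.cong, auto)
  also have "\<dots> = Poly_Mapping.lookup p k"
    using assms by (auto simp: in_keys_iff)
  finally show "Poly_Mapping.lookup p k = Poly_Mapping.lookup (\<Sum>u\<in>U. Poly_Mapping.single u (Poly_Mapping.lookup p u)) k" ..
qed

context
  fixes J :: "'k::field polynomial set" and V :: "indet set"
  assumes J: "ideal J (poly_ring V)"
begin

lemma ideal_poly_subset: "p \<in> J \<Longrightarrow> Poly_Mapping.keys p \<subseteq> monomials V"
  using ideal.Icarr[OF J] by simp

lemma ideal_poly_zero: "0 \<in> J"
  using additive_subgroup.zero_closed[OF ideal.axioms(1)[OF J]] by simp

lemma ideal_poly_add: "p \<in> J \<Longrightarrow> q \<in> J \<Longrightarrow> p + q \<in> J"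
  using additive_subgroup.a_closed[OF ideal.axioms(1)[OF J]] by simp

lemma ideal_poly_mult: "p \<in> J \<Longrightarrow> Poly_Mapping.keys r \<subseteq> monomials V \<Longrightarrow> r * p \<in> J"
  using ideal.I_l_closed[OF J, of p r] by simp

lemma ideal_poly_uminus: "p \<in> J \<Longrightarrow> - p \<in> J"
  using ideal_poly_mult[of p "- 1"] by simp

lemma ideal_poly_diff: "p \<in> J \<Longrightarrow> q \<in> J \<Longrightarrow> p - q \<in> J"
  using ideal_poly_add[of p "- q"] ideal_poly_uminus by simp

lemma ideal_poly_sum: "(\<And>a. a \<in> A \<Longrightarrow> g a \<in> J) \<Longrightarrow> sum g A \<in> J"
  by (induction A rule: infinite_finite_induct) (auto simp: ideal_poly_zero ideal_poly_add)

lemma ideal_poly_coset_eq_iff: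
  assumes "Poly_Mapping.keys p \<subseteq> monomials V" "Poly_Mapping.keys q \<subseteq> monomials V"
  shows "J +>\<^bsub>poly_ring V\<^esub> p = J +>\<^bsub>poly_ring V\<^esub> q \<longleftrightarrow> p - q \<in> J"
  using ring.quotient_eq_iff_same_a_r_cos[OF poly_ring_ring J, of p q] assms
  by (simp add: poly_ring_minus)

end

section \<open>Linear extension of maps on monomials\<close>

text \<open>A coefficient enters as the constant polynomial \<open>single 0 c\<close>. The value of
  \<psi> at a monomial may be any polynomial, including 0: the Rees map sends monomials to
  monomials, while reduction modulo a set of variables kills some of them.\<close>

definition lin_ext :: "('a \<Rightarrow> ('m::comm_monoid_add \<Rightarrow>\<^sub>0 'k::field)) \<Rightarrow> ('a \<Rightarrow>\<^sub>0 'k) \<Rightarrow> ('m \<Rightarrow>\<^sub>0 'k)" where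
  "lin_ext \<psi> p = (\<Sum>u\<in>Poly_Mapping.keys p. Poly_Mapping.single 0 (Poly_Mapping.lookup p u) * \<psi> u)"

lemma lin_ext_superset:
  assumes "finite U" "Poly_Mapping.keys p \<subseteq> U"
  shows "lin_ext \<psi> p = (\<Sum>u\<in>U. Poly_Mapping.single 0 (Poly_Mapping.lookup p u) * \<psi> u)"
  unfolding lin_ext_def using assms by (intro sum.mono_neutral_left) (auto simp: in_keys_iff)

lemma lin_ext_0 [simp]: "lin_ext \<psi> 0 = 0"
  by (simp add: lin_ext_def)

lemma lin_ext_add: "lin_ext \<psi> (p + q) = lin_ext \<psi> p + lin_ext \<psi> q"
proof -
  let ?U = "Poly_Mapping.keys p \<union> Poly_Mapping.keys q"
  have "lin_ext \<psi> (p + q) = (\<Sum>u\<in>?U. Poly_Mapping.single 0 (Poly_Mapping.lookup (p + q) u) * \<psi> u)"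
    by (rule lin_ext_superset) (use keys_add[of p q] in auto)
  also have "\<dots> = lin_ext \<psi> p + lin_ext \<psi> q"
    by (simp add: lin_ext_superset[of ?U] lookup_add single_add distrib_right sum.distrib)
  finally show ?thesis .
qed

lemma lin_ext_sum: "lin_ext \<psi> (sum g A) = (\<Sum>a\<in>A. lin_ext \<psi> (g a))"
  by (induction A rule: infinite_finite_induct) (auto simp: lin_ext_add)

lemma lin_ext_diff: "lin_ext \<psi> (p - q) = lin_ext \<psi> p - lin_ext \<psi> q"
  using lin_ext_add[of \<psi> "p - q" q] by simp

lemma lin_ext_single: "lin_ext \<psi> (Poly_Mapping.single u c) = Poly_Mapping.single 0 c * \<psi> u"
  by (simp add: lin_ext_def)

lemma lin_ext_mult:
  fixes \<psi> :: "'a::comm_monoid_add \<Rightarrow> ('m::comm_monoid_add \<Rightarrow>\<^sub>0 'k::field)"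
  assumes "\<And>u v. \<psi> (u + v) = \<psi> u * \<psi> v"
  shows "lin_ext \<psi> (p * q) = lin_ext \<psi> p * lin_ext \<psi> q"
proof -
  have single: "lin_ext \<psi> (Poly_Mapping.single u c * Poly_Mapping.single v d)
      = lin_ext \<psi> (Poly_Mapping.single u c) * lin_ext \<psi> (Poly_Mapping.single v d)" for u v and c d :: 'k
  proof -
    have "Poly_Mapping.single 0 (c * d) = Poly_Mapping.single (0::'m) c * Poly_Mapping.single 0 d"
      by (simp add: mult_single)
    then show ?thesis by (simp add: mult_single lin_ext_single assms mult_ac)
  qed
  let ?p = "\<lambda>u. Poly_Mapping.single u (Poly_Mapping.lookup p u)"
  let ?q = "\<lambda>u. Poly_Mapping.single u (Poly_Mapping.lookup q u)"
  have p: "p = (\<Sum>u\<in>Poly_Mapping.keys p. ?p u)" and q: "q = (\<Sum>u\<in>Poly_Mapping.keys q. ?q u)"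
    by (rule poly_mapping_sum_single; simp)+
  have "lin_ext \<psi> (p * q) = lin_ext \<psi> ((\<Sum>u\<in>Poly_Mapping.keys p. ?p u) * (\<Sum>u\<in>Poly_Mapping.keys q. ?q u))"
    using p q by simp
  also have "\<dots> = lin_ext \<psi> (\<Sum>u\<in>Poly_Mapping.keys p. ?p u) * lin_ext \<psi> (\<Sum>u\<in>Poly_Mapping.keys q. ?q u)"
    by (simp only: sum_product lin_ext_sum single)
  finally show ?thesis using p q by simp
qed

lemma lin_ext_mono_poly: "lin_ext \<psi> (mono_poly u) = \<psi> u"
  by (simp add: mono_poly_def lin_ext_single)

text \<open>The terms of \<open>p\<close> over one fibre of \<Phi> collapse into one term. Vanishing
  of the image therefore means that the coefficients of \<open>p\<close> sum to zero over every
  fibre.\<close>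

lemma lookup_lin_ext_single:
  "Poly_Mapping.lookup (lin_ext (\<lambda>u. Poly_Mapping.single (\<Phi> u) 1) p) w
     = (\<Sum>u | u \<in> Poly_Mapping.keys p \<and> \<Phi> u = w. Poly_Mapping.lookup p u)"
proof -
  have "Poly_Mapping.lookup (lin_ext (\<lambda>u. Poly_Mapping.single (\<Phi> u) 1) p) w
      = (\<Sum>u\<in>Poly_Mapping.keys p. if \<Phi> u = w then Poly_Mapping.lookup p u else 0)"
    by (simp add: lin_ext_def lookup_sum mult_single lookup_single when_def)
  also have "\<dots> = (\<Sum>u | u \<in> Poly_Mapping.keys p \<and> \<Phi> u = w. Poly_Mapping.lookup p u)"
    by (rule sum.inter_filter[symmetric]) simp
  finally show ?thesis .
qed

text \<open>The target is a polynomial ring over a field, hence has no zero divisors, and \<psi>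
  induces a ring homomorphism into it. The kernel is proper because 1 is sent to 1. Every prime
  ideal exhibited below is such a kernel.\<close>

lemma primeideal_lin_ext_kernel:
  fixes \<psi> :: "monomial \<Rightarrow> ((nat \<Rightarrow>\<^sub>0 nat) \<Rightarrow>\<^sub>0 'k::field)"
  assumes mult: "\<And>u v. \<psi> (u + v) = \<psi> u * \<psi> v" and one: "\<psi> 0 = 1"
  shows "primeideal {p \<in> carrier (poly_ring V). lin_ext \<psi> p = 0} (poly_ring V)"
proof -
  interpret cring "poly_ring V :: 'k polynomial ring" by (rule poly_ring_cring)
  note lm = lin_ext_mult[of \<psi>, OF mult]
  have "ideal {p \<in> carrier (poly_ring V). lin_ext \<psi> p = 0} (poly_ring V)"
  proof (rule idealI)
    show "subgroup {p \<in> carrier (poly_ring V). lin_ext \<psi> p = 0} (add_monoid (poly_ring V))"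
    proof (rule add.subgroupI)
      fix a b assume "a \<in> {p \<in> carrier (poly_ring V). lin_ext \<psi> p = 0}" "b \<in> {p \<in> carrier (poly_ring V). lin_ext \<psi> p = 0}"
      then show "a \<oplus>\<^bsub>poly_ring V\<^esub> b \<in> {p \<in> carrier (poly_ring V). lin_ext \<psi> p = 0}"
        using a_closed[of a b] by (simp add: lin_ext_add)
    next
      fix a assume a: "a \<in> {p \<in> carrier (poly_ring V). lin_ext \<psi> p = 0}"
      then show "\<ominus>\<^bsub>poly_ring V\<^esub> a \<in> {p \<in> carrier (poly_ring V). lin_ext \<psi> p = 0}"
        using lin_ext_diff[of \<psi> 0 a] by (simp add: poly_ring_a_inv)
    qed (auto intro: exI[of _ 0])
  qed (auto simp: lm poly_ring_ring dest: subsetD[OF keys_mult_monomials, rotated -1])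
  moreover have "carrier (poly_ring V) \<noteq> {p \<in> carrier (poly_ring V). lin_ext \<psi> p = 0}"
  proof -
    have "lin_ext \<psi> 1 = 1"
      using lin_ext_mono_poly[of \<psi> 0] one by simp
    then have "1 \<in> carrier (poly_ring V) \<and> 1 \<notin> {p \<in> carrier (poly_ring V). lin_ext \<psi> p = 0}"
      by simp
    then show ?thesis by blast
  qed
  ultimately show ?thesis
    by (intro primeidealI) (auto simp: lm poly_ring_cring)
qed

section \<open>Krull dimension\<close>

text \<open>As \<open>Q\<close> contains \<open>J\<close>, it is a union of cosets of
  \<open>J\<close>, so that membership can be tested on any representative.\<close>

lemma coset_in_image_iff:
  assumes "ring R" "ideal J R" "ideal Q R" "J \<subseteq> Q" "r \<in> carrier R"
  shows "J +>\<^bsub>R\<^esub> r \<in> (+>\<^bsub>R\<^esub>) J ` Q \<longleftrightarrow> r \<in> Q"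
proof
  interpret ring R by fact
  interpret Q: ideal Q R by fact
  assume "J +>\<^bsub>R\<^esub> r \<in> (+>\<^bsub>R\<^esub>) J ` Q"
  then obtain z where z: "z \<in> Q" "J +>\<^bsub>R\<^esub> r = J +>\<^bsub>R\<^esub> z" by auto
  then have "z \<in> carrier R" by auto
  with z have "r \<ominus>\<^bsub>R\<^esub> z \<in> Q"
    using quotient_eq_iff_same_a_r_cos[of J r z] assms by auto
  then have "r \<ominus>\<^bsub>R\<^esub> z \<oplus>\<^bsub>R\<^esub> z \<in> Q" using z by (intro Q.a_closed)
  moreover have "r \<ominus>\<^bsub>R\<^esub> z \<oplus>\<^bsub>R\<^esub> z = r" using \<open>z \<in> carrier R\<close> assms(5) by algebra
  ultimately show "r \<in> Q" by simp
qed auto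

lemma primeideal_quot_image:
  assumes "cring R" "ideal J R" "primeideal Q R" "J \<subseteq> Q"
  shows "primeideal ((+>\<^bsub>R\<^esub>) J ` Q) (R Quot J)"
proof -
  interpret cring R by fact
  interpret J: ideal J R by fact
  interpret Q: primeideal Q R by fact
  have carr: "carrier (R Quot J) = (+>\<^bsub>R\<^esub>) J ` carrier R"
    by (auto simp: FactRing_def A_RCOSETS_def' image_def)
  note mem = coset_in_image_iff[OF ring_axioms assms(2) Q.is_ideal assms(4)]
  show ?thesis
  proof (rule primeidealI)
    show "ideal ((+>\<^bsub>R\<^esub>) J ` Q) (R Quot J)"
      using ring_ideal_imp_quot_ideal[OF assms(2) Q.is_ideal] .
    show "cring (R Quot J)" by (rule J.quotient_is_cring[OF assms(1)])
    have "J +>\<^bsub>R\<^esub> \<one>\<^bsub>R\<^esub> \<notin> (+>\<^bsub>R\<^esub>) J ` Q"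
      using mem[of "\<one>\<^bsub>R\<^esub>"] Q.I_notcarr Q.one_imp_carrier by auto
    then show "carrier (R Quot J) \<noteq> (+>\<^bsub>R\<^esub>) J ` Q" using carr by (metis imageI one_closed)
  next
    fix a b assume "a \<in> carrier (R Quot J)" "b \<in> carrier (R Quot J)"
      and ab: "a \<otimes>\<^bsub>R Quot J\<^esub> b \<in> (+>\<^bsub>R\<^esub>) J ` Q"
    then obtain x y where xy: "x \<in> carrier R" "y \<in> carrier R" "a = J +>\<^bsub>R\<^esub> x" "b = J +>\<^bsub>R\<^esub> y"
      unfolding carr by auto
    then have "x \<otimes>\<^bsub>R\<^esub> y \<in> Q"
      using ab mem[of "x \<otimes>\<^bsub>R\<^esub> y"] by (simp add: FactRing_def J.rcoset_mult_add)
    then show "a \<in> (+>\<^bsub>R\<^esub>) J ` Q \<or> b \<in> (+>\<^bsub>R\<^esub>) J ` Q"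
      using Q.I_prime xy by auto
  qed
qed

text \<open>Preimages and images under the projection carry chains of primes in either direction and
  preserve strict inclusions. From here on chains are studied in the polynomial ring, where elements
  are polynomials instead of cosets.\<close>

lemma krull_dim_quot:
  assumes "cring R" "ideal J R"
  shows "krull_dim (R Quot J) = Sup {enat k | k. \<exists>P. (\<forall>i\<le>k. primeideal (P i) R \<and> J \<subseteq> P i) \<and> (\<forall>i<k. P i \<subset> P (Suc i))}"
proof -
  interpret cring R by fact
  interpret J: ideal J R by fact
  have carr: "carrier (R Quot J) = (+>\<^bsub>R\<^esub>) J ` carrier R"
    by (auto simp: FactRing_def A_RCOSETS_def' image_def)
  have "(\<exists>P. (\<forall>i\<le>k. primeideal (P i) (R Quot J)) \<and> (\<forall>i<k. P i \<subset> P (Suc i)))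
    \<longleftrightarrow> (\<exists>P. (\<forall>i\<le>k. primeideal (P i) R \<and> J \<subseteq> P i) \<and> (\<forall>i<k. P i \<subset> P (Suc i)))" (is "?L \<longleftrightarrow> ?R") for k
  proof
    assume ?L
    then obtain P where P: "\<And>i. i \<le> k \<Longrightarrow> primeideal (P i) (R Quot J)" "\<And>i. i < k \<Longrightarrow> P i \<subset> P (Suc i)"
      by blast
    define Q where "Q i = {r \<in> carrier R. J +>\<^bsub>R\<^esub> r \<in> P i}" for i
    have "primeideal (Q i) R \<and> J \<subseteq> Q i" if "i \<le> k" for i
    proof
      show "primeideal (Q i) R"
        unfolding Q_def
        by (rule ring_hom_ring.primeideal_vimage[OF J.rcos_ring_hom_ring]) (use P that is_cring in auto)
      have "J \<in> P i"
        using additive_subgroup.zero_closed[OF ideal.axioms(1)[OF primeideal.axioms(1)[OF P(1)[OF that]]]]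
        by (simp add: FactRing_def)
      then show "J \<subseteq> Q i"
        using a_rcos_zero[OF assms(2)] by (auto simp: Q_def)
    qed
    moreover have "Q i \<subset> Q (Suc i)" if "i < k" for i
    proof -
      from P(2)[OF that] obtain X where X: "X \<in> P (Suc i)" "X \<notin> P i" by blast
      have "X \<in> carrier (R Quot J)"
        using ideal.Icarr[OF primeideal.axioms(1)[OF P(1)[of "Suc i"]]] X that by auto
      then obtain r where "r \<in> carrier R" "X = J +>\<^bsub>R\<^esub> r" using carr by auto
      then have "r \<in> Q (Suc i)" "r \<notin> Q i" using X by (auto simp: Q_def)
      then show ?thesis using P(2)[OF that] by (auto simp: Q_def)
    qed
    ultimately show ?R by blast
  next
    assume ?R
    then obtain Q where Q: "\<And>i. i \<le> k \<Longrightarrow> primeideal (Q i) R" "\<And>i. i \<le> k \<Longrightarrow> J \<subseteq> Q i" "\<And>i. i < k \<Longrightarrow> Q i \<subset> Q (Suc i)"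
      by blast
    have "(+>\<^bsub>R\<^esub>) J ` Q i \<subset> (+>\<^bsub>R\<^esub>) J ` Q (Suc i)" if "i < k" for i
    proof -
      from Q(3)[OF that] obtain r where r: "r \<in> Q (Suc i)" "r \<notin> Q i" by blast
      have "r \<in> carrier R"
        using ideal.Icarr[OF primeideal.axioms(1)[OF Q(1)[of "Suc i"]]] r that by auto
      then have "J +>\<^bsub>R\<^esub> r \<notin> (+>\<^bsub>R\<^esub>) J ` Q i"
        using coset_in_image_iff[OF ring_axioms assms(2) primeideal.axioms(1)[OF Q(1)[of i]] Q(2)[of i]] r that by auto
      then show ?thesis using r Q(3)[OF that] by blast
    qed
    moreover have "primeideal ((+>\<^bsub>R\<^esub>) J ` Q i) (R Quot J)" if "i \<le> k" for i
      using primeideal_quot_image[OF assms Q(1,2)] that by blast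
    ultimately show ?L by (intro exI[of _ "\<lambda>i. (+>\<^bsub>R\<^esub>) J ` Q i"]) auto
  qed
  then show ?thesis unfolding krull_dim_def by simp
qed

section \<open>Power products along a chain of prime ideals\<close>

text \<open>The list holds the exponents of x_0, x_1, and so on. The recursion shifts the sequence
  \<open>x\<close>, in step with the induction below, which drops the first prime of a
  chain.\<close>

fun power_prod :: "(nat \<Rightarrow> 'a::comm_ring_1) \<Rightarrow> nat list \<Rightarrow> 'a" where
  "power_prod x [] = 1"
| "power_prod x (j # l) = x 0 ^ j * power_prod (\<lambda>i. x (Suc i)) l"

lemma keys_power_monomials:
  assumes "Poly_Mapping.keys (p :: 'k::field polynomial) \<subseteq> monomials V"
  shows "Poly_Mapping.keys (p ^ j) \<subseteq> monomials V"
proof (induction j)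
  case (Suc j)
  then show ?case using keys_mult_monomials[OF assms Suc] by simp
qed simp

lemma keys_power_prod_monomials:
  fixes y :: "nat \<Rightarrow> 'k::field polynomial"
  assumes "\<And>i. i < length l \<Longrightarrow> Poly_Mapping.keys (y i) \<subseteq> monomials V"
  shows "Poly_Mapping.keys (power_prod y l) \<subseteq> monomials V"
  using assms
proof (induction l arbitrary: y)
  case (Cons j l)
  have "Poly_Mapping.keys (power_prod (\<lambda>i. y (Suc i)) l) \<subseteq> monomials V"
    by (rule Cons.IH) (use Cons.prems in auto)
  then show ?case
    unfolding power_prod.simps using Cons.prems[of 0] by (intro keys_mult_monomials keys_power_monomials) auto
qed simp

text \<open>Power products of elements taken from the gaps of a chain of primes are linearly
  independent over K modulo the bottom prime. In a relation, the least power of x_0 can be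
  cancelled, since P_0 is prime and does not contain x_0. Modulo P_1, which contains x_0, only the
  terms with the least exponent survive; they form a relation in x_1, x_2, ... for the shorter chain
  starting at P_1.\<close>

lemma prime_chain_power_prod:
  fixes P :: "nat \<Rightarrow> 'k::field polynomial set"
  assumes "\<And>i. i \<le> k \<Longrightarrow> primeideal (P i) (poly_ring V)"
    and "\<And>i. i < k \<Longrightarrow> P i \<subseteq> P (Suc i)"
    and "\<And>i. i < k \<Longrightarrow> x i \<in> P (Suc i) - P i"
    and "finite L" "\<And>l. l \<in> L \<Longrightarrow> length l = k"
    and "(\<Sum>l\<in>L. Poly_Mapping.single 0 (c l) * power_prod x l) \<in> P 0"
  shows "\<forall>l\<in>L. c l = 0"
  using assms
proof (induction k arbitrary: P x L c)
  case 0
  have prime: "primeideal (P 0) (poly_ring V)" using 0 by simp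
  interpret primeideal "P 0" "poly_ring V" by fact
  show ?case
  proof (rule ballI, rule ccontr)
    fix l assume l: "l \<in> L" "c l \<noteq> 0"
    \<comment> \<open>Only the empty product is left, so a nontrivial relation puts a nonzero
      constant, hence 1, into the prime.\<close>
    then have "L = {[]}" using 0 by force
    with 0(6) l have "Poly_Mapping.single 0 (c []) \<in> P 0" "c [] \<noteq> 0" by auto
    then have "Poly_Mapping.single 0 (inverse (c [])) * Poly_Mapping.single 0 (c []) \<in> P 0"
      by (intro ideal_poly_mult[OF is_ideal]) auto
    then have "1 \<in> P 0" using \<open>c [] \<noteq> 0\<close> by (simp add: mult_single)
    then show False using one_imp_carrier I_notcarr by simp
  qed
next
  case (Suc k)
  let ?mon = "\<lambda>p. Poly_Mapping.keys p \<subseteq> monomials V"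
  define x' where "x' = (\<lambda>i. x (Suc i))"
  have P0: "primeideal (P 0) (poly_ring V)" and P1: "primeideal (P 1) (poly_ring V)" using Suc.prems(1) by auto
  interpret P0: primeideal "P 0" "poly_ring V" by fact
  interpret P1: primeideal "P 1" "poly_ring V" by fact
  have x: "?mon (x i)" if "i < Suc k" for i
    using ideal_poly_subset[OF primeideal.axioms(1)[OF Suc.prems(1)[of "Suc i"]], of "x i"]
      Suc.prems(3)[OF that] that by auto
  note pow = keys_power_monomials and pp = keys_power_prod_monomials
  show ?case
  proof (rule ccontr)
    assume neg: "\<not> (\<forall>l\<in>L. c l = 0)"
    define L0 where "L0 = {l \<in> L. c l \<noteq> 0}"
    have L0: "finite L0" "L0 \<noteq> {}" using Suc.prems(4) neg by (auto simp: L0_def)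
    have len: "length l = Suc k" if "l \<in> L0" for l using that Suc.prems(5) by (auto simp: L0_def)
    \<comment> \<open>The least exponent of x_0 among the terms with nonzero coefficient.
      Restricting to \<open>L0\<close> ensures that some surviving term really has this
      exponent.\<close>
    define j where "j = Min (hd ` L0)"
    have j_le: "j \<le> hd l" if "l \<in> L0" for l using that L0 by (auto simp: j_def)
    have "j \<in> hd ` L0" unfolding j_def using L0 by (intro Min_in) auto
    then obtain l0 where l0: "l0 \<in> L0" "hd l0 = j" by auto
    have pp_split: "power_prod x l = x 0 ^ j * (x 0 ^ (hd l - j) * power_prod x' (tl l))" if "l \<in> L0" for l
    proof -
      have "length l = Suc k" using len[OF that] .
      then obtain a t where "l = a # t" by (cases l) auto
      then show ?thesis using j_le[OF that] by (simp add: x'_def mult.assoc[symmetric] power_add[symmetric])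
    qed
    define s where "s l = Poly_Mapping.single 0 (c l) * (x 0 ^ (hd l - j) * power_prod x' (tl l))" for l
    have mon_x': "?mon (power_prod x' (tl l))" if "l \<in> L0" for l
      by (rule pp) (use len[OF that] x in \<open>auto simp: x'_def\<close>)
    have s_mon: "?mon (s l)" if "l \<in> L0" for l
      unfolding s_def using mon_x'[OF that] x[of 0] by (intro keys_mult_monomials pow) (auto)
    have "(\<Sum>l\<in>L. Poly_Mapping.single 0 (c l) * power_prod x l) = (\<Sum>l\<in>L0. Poly_Mapping.single 0 (c l) * power_prod x l)"
      unfolding L0_def by (rule sum.mono_neutral_right) (use Suc.prems(4) in auto)
    also have "\<dots> = x 0 ^ j * (\<Sum>l\<in>L0. s l)"
      unfolding sum_distrib_left by (rule sum.cong) (auto simp: pp_split s_def mult_ac)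
    finally have mem: "x 0 ^ j * (\<Sum>l\<in>L0. s l) \<in> P 0" using Suc.prems(6) by simp
    have sum_mon: "?mon (\<Sum>l\<in>L0. s l)"
      using s_mon by (intro order.trans[OF keys_sum]) auto
    have cancel: "p \<in> P 0" if "x 0 ^ m * p \<in> P 0" "?mon p" for p m
      using that
    proof (induction m)
      case (Suc m)
      then show ?case
        using P0.I_prime[of "x 0" "x 0 ^ m * p"] Suc.prems x[of 0] pow[of "x 0"] keys_mult_monomials[of "x 0 ^ m" V p]
          Suc(2) \<open>\<And>i. i < Suc k \<Longrightarrow> x i \<in> P (Suc i) - P i\<close>[of 0]
        by (simp add: mult.assoc)
    qed simp
    have "(\<Sum>l\<in>L0. s l) \<in> P 1"
      using cancel[OF mem sum_mon] Suc.prems(2)[of 0] by auto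
    \<comment> \<open>After division by x_0^j these terms still contain a factor x_0, which lies in
      P_1.\<close>
    moreover have "(\<Sum>l\<in>{l\<in>L0. hd l \<noteq> j}. s l) \<in> P 1"
    proof (rule ideal_poly_sum[OF P1.is_ideal])
      fix l assume l: "l \<in> {l \<in> L0. hd l \<noteq> j}"
      then have "hd l - j = Suc (hd l - j - 1)" using j_le[of l] by auto
      then have "s l = (Poly_Mapping.single 0 (c l) * (x 0 ^ (hd l - j - 1) * power_prod x' (tl l))) * x 0"
        unfolding s_def by (metis (no_types, lifting) mult.assoc mult.commute power_Suc)
      moreover have "x 0 \<in> P 1" using Suc.prems(3)[of 0] by simp
      moreover have "?mon (Poly_Mapping.single 0 (c l) * (x 0 ^ (hd l - j - 1) * power_prod x' (tl l)))"
        using mon_x'[of l] l x[of 0] by (intro keys_mult_monomials pow) auto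
      ultimately show "s l \<in> P 1"
        by (simp only: ideal_poly_mult[OF P1.is_ideal])
    qed
    ultimately have "(\<Sum>l\<in>L0. s l) - (\<Sum>l\<in>{l\<in>L0. hd l \<noteq> j}. s l) \<in> P 1"
      by (rule ideal_poly_diff[OF P1.is_ideal])
    also have "(\<Sum>l\<in>L0. s l) - (\<Sum>l\<in>{l\<in>L0. hd l \<noteq> j}. s l) = (\<Sum>l\<in>{l\<in>L0. hd l = j}. s l)"
    proof -
      have "L0 = {l\<in>L0. hd l = j} \<union> {l\<in>L0. hd l \<noteq> j}" by auto
      then have "(\<Sum>l\<in>L0. s l) = (\<Sum>l\<in>{l\<in>L0. hd l = j}. s l) + (\<Sum>l\<in>{l\<in>L0. hd l \<noteq> j}. s l)"
        by (metis (no_types, lifting) L0(1) disjoint_iff finite_Un mem_Collect_eq sum.union_disjoint)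
      then show ?thesis by simp
    qed
    also have "(\<Sum>l\<in>{l\<in>L0. hd l = j}. s l) = (\<Sum>l\<in>tl ` {l\<in>L0. hd l = j}. Poly_Mapping.single 0 (c (j # l)) * power_prod x' l)"
    proof (subst sum.reindex)
      have cons: "l = hd l # tl l" if "l \<in> L0" for l using len[OF that] by (cases l) auto
      then show "inj_on tl {l \<in> L0. hd l = j}" by (metis (mono_tags, lifting) inj_onI mem_Collect_eq)
      show "sum s {l \<in> L0. hd l = j} = sum ((\<lambda>l. Poly_Mapping.single 0 (c (j # l)) * power_prod x' l) \<circ> tl) {l \<in> L0. hd l = j}"
        by (rule sum.cong) (use cons in \<open>auto simp: s_def\<close>)
    qed
    finally have sum1: "(\<Sum>l\<in>tl ` {l\<in>L0. hd l = j}. Poly_Mapping.single 0 (c (j # l)) * power_prod x' l) \<in> P (Suc 0)" by simp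
    have "\<forall>l\<in>tl ` {l\<in>L0. hd l = j}. c (j # l) = 0"
      by (rule Suc.IH[of "\<lambda>i. P (Suc i)" x' _ "\<lambda>l. c (j # l)"])
         (use Suc.prems(1-3) L0 sum1 len in \<open>auto simp: x'_def\<close>)
    moreover have "c l0 \<noteq> 0" using l0 by (auto simp: L0_def)
    moreover have "l0 = j # tl l0" using l0 len[of l0] by (cases l0) auto
    ultimately show False using l0 by (metis (mono_tags, lifting) image_eqI mem_Collect_eq)
  qed
qed

section \<open>Linear systems and the count of bounded monomials\<close>

text \<open>Gaussian elimination: each equation in which some unknown has a nonzero coefficient is
  used to eliminate that unknown, so every step removes one equation and at most one
  unknown.\<close>

lemma homogeneous_system_nontrivial_solution:
  fixes a :: "'l \<Rightarrow> 'w \<Rightarrow> 'k::field"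
  assumes "finite F" "finite L" "card F < card L"
  shows "\<exists>c. (\<exists>l\<in>L. c l \<noteq> 0) \<and> (\<forall>w\<in>F. (\<Sum>l\<in>L. c l * a l w) = 0)"
  using assms
proof (induction F arbitrary: L a rule: finite_induct)
  case empty
  then have "L \<noteq> {}" by auto
  then show ?case by (intro exI[of _ "\<lambda>_. 1"]) auto
next
  case (insert w F)
  show ?case
  proof (cases "\<forall>l\<in>L. a l w = 0")
    case True
    have "card F < card L" using insert by simp
    then obtain c where "\<exists>l\<in>L. c l \<noteq> 0" "\<forall>w\<in>F. (\<Sum>l\<in>L. c l * a l w) = 0"
      using insert.IH[OF insert.prems(1), of a] by blast
    then show ?thesis using True by (intro exI[of _ c]) auto
  next
    case False
    then obtain m where m: "m \<in> L" "a m w \<noteq> 0" by auto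
    \<comment> \<open>The coefficients after the unknown of index \<open>m\<close> has been
      eliminated by means of equation \<open>w\<close>.\<close>
    define a' where "a' l v = a l v - a l w / a m w * a m v" for l v
    have "card F < card (L - {m})" using insert.prems insert.hyps m by simp
    then obtain c where c: "\<exists>l\<in>L-{m}. c l \<noteq> 0" "\<And>v. v \<in> F \<Longrightarrow> (\<Sum>l\<in>L-{m}. c l * a' l v) = 0"
      using insert.IH[of "L - {m}" a'] insert.prems by auto
    \<comment> \<open>Back substitution: the value of the eliminated unknown that satisfies equation
      \<open>w\<close>.\<close>
    define b where "b = - (\<Sum>l\<in>L-{m}. c l * a l w) / a m w"
    have sum: "(\<Sum>l\<in>L. (c(m := b)) l * a l v) = (\<Sum>l\<in>L-{m}. c l * a l v) + b * a m v" for v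
      using insert.prems m by (simp add: sum.remove[of L m] add.commute)
    have "(\<Sum>l\<in>L. (c(m := b)) l * a l v) = (\<Sum>l\<in>L-{m}. c l * a' l v)" for v
    proof -
      have "(\<Sum>l\<in>L-{m}. c l * a' l v) = (\<Sum>l\<in>L-{m}. c l * a l v) - (\<Sum>l\<in>L-{m}. c l * a l w) / a m w * a m v"
        by (simp add: a'_def right_diff_distrib sum_subtractf sum_divide_distrib sum_distrib_right mult.assoc)
      then show ?thesis unfolding sum by (simp add: b_def)
    qed
    moreover have "a' l w = 0" for l using m by (simp add: a'_def)
    ultimately have "\<forall>v\<in>insert w F. (\<Sum>l\<in>L. (c(m := b)) l * a l v) = 0" using c(2) by auto
    moreover have "\<exists>l\<in>L. (c(m := b)) l \<noteq> 0" using c(1) by auto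
    ultimately show ?thesis by blast
  qed
qed

text \<open>A box of exponents, chosen over a bound on the total degree because products add the
  side lengths and the count is a plain power. Index 0 belongs to the box, which makes n + 1
  indeterminates.\<close>

definition bounded_monomials :: "nat \<Rightarrow> nat \<Rightarrow> (nat \<Rightarrow>\<^sub>0 nat) set" where
  "bounded_monomials n N = {w. Poly_Mapping.keys w \<subseteq> {..n} \<and> (\<forall>i. Poly_Mapping.lookup w i \<le> N)}"

lemma bounded_monomials_card:
  "finite (bounded_monomials n N)" "card (bounded_monomials n N) \<le> (N + 1) ^ (n + 1)"
proof -
  let ?f = "\<lambda>w. restrict (Poly_Mapping.lookup w) {..n}"
  have inj: "inj_on ?f (bounded_monomials n N)"
  proof (rule inj_onI, rule poly_mapping_eqI)
    fix w w' :: "nat \<Rightarrow>\<^sub>0 nat" and i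
    assume w: "w \<in> bounded_monomials n N" "w' \<in> bounded_monomials n N" and eq: "?f w = ?f w'"
    show "Poly_Mapping.lookup w i = Poly_Mapping.lookup w' i"
    proof (cases "i \<le> n")
      case True
      then show ?thesis using fun_cong[OF eq, of i] by simp
    next
      case False
      then have "i \<notin> Poly_Mapping.keys w" "i \<notin> Poly_Mapping.keys w'"
        using w by (auto simp: bounded_monomials_def)
      then show ?thesis by (simp add: in_keys_iff)
    qed
  qed
  have sub: "?f ` bounded_monomials n N \<subseteq> PiE {..n} (\<lambda>_. {..N})"
    by (auto simp: bounded_monomials_def split: if_splits)
  have fin: "finite (PiE {..n} (\<lambda>_. {..N}))" by (intro finite_PiE) auto
  show "finite (bounded_monomials n N)"
    using finite_subset[OF sub fin] inj finite_imageD by blast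
  show "card (bounded_monomials n N) \<le> (N + 1) ^ (n + 1)"
    using card_inj_on_le[OF inj sub fin] by (simp add: card_PiE)
qed

lemma bounded_monomials_add:
  "u \<in> bounded_monomials n N \<Longrightarrow> v \<in> bounded_monomials n M \<Longrightarrow> u + v \<in> bounded_monomials n (N + M)"
  by (auto simp: bounded_monomials_def keys_add_nat lookup_add add_mono)

lemma bounded_monomials_mult:
  assumes "Poly_Mapping.keys p \<subseteq> bounded_monomials n N" "Poly_Mapping.keys q \<subseteq> bounded_monomials n M"
  shows "Poly_Mapping.keys (p * q) \<subseteq> bounded_monomials n (N + M)"
  using keys_mult[of p q] assms bounded_monomials_add by fastforce

lemma bounded_monomials_power:
  assumes "Poly_Mapping.keys p \<subseteq> bounded_monomials n N"
  shows "Poly_Mapping.keys (p ^ j) \<subseteq> bounded_monomials n (j * N)"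
proof (induction j)
  case 0
  then show ?case by (simp add: bounded_monomials_def)
next
  case (Suc j)
  then show ?case using bounded_monomials_mult[OF assms Suc] by simp
qed

lemma bounded_monomials_power_prod:
  assumes "\<And>i. i < length l \<Longrightarrow> Poly_Mapping.keys (x i) \<subseteq> bounded_monomials n N"
  shows "Poly_Mapping.keys (power_prod x l) \<subseteq> bounded_monomials n (sum_list l * N)"
  using assms
proof (induction l arbitrary: x)
  case Nil
  then show ?case by (simp add: bounded_monomials_def)
next
  case (Cons j l)
  have "Poly_Mapping.keys (power_prod (\<lambda>i. x (Suc i)) l) \<subseteq> bounded_monomials n (sum_list l * N)"
    by (rule Cons.IH) (use Cons.prems in auto)
  moreover have "Poly_Mapping.keys (x 0) \<subseteq> bounded_monomials n N" using Cons.prems by auto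
  ultimately have "Poly_Mapping.keys (power_prod x (j # l)) \<subseteq> bounded_monomials n (j * N + sum_list l * N)"
    unfolding power_prod.simps by (intro bounded_monomials_mult bounded_monomials_power)
  then show ?case by (simp add: add_mult_distrib)
qed

lemma bounded_monomials_exhaust:
  fixes k :: nat
  assumes "\<And>i. i < k \<Longrightarrow> \<Union> (Poly_Mapping.keys ` Poly_Mapping.keys (x i)) \<subseteq> {..n}"
  shows "\<exists>N. \<forall>i<k. Poly_Mapping.keys (x i) \<subseteq> bounded_monomials n N"
proof
  let ?A = "\<Union>i<k. \<Union>w\<in>Poly_Mapping.keys (x i). Poly_Mapping.lookup w ` Poly_Mapping.keys w"
  have fin: "finite ?A" by (intro finite_UN_I finite_imageI finite_keys) simp
  show "\<forall>i<k. Poly_Mapping.keys (x i) \<subseteq> bounded_monomials n (Max (insert 0 ?A))"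
  proof (intro allI impI subsetI)
    fix i w assume i: "i < k" "w \<in> Poly_Mapping.keys (x i)"
    have "Poly_Mapping.lookup w j \<le> Max (insert 0 ?A)" for j
    proof (cases "j \<in> Poly_Mapping.keys w")
      case True
      then show ?thesis using i by (intro Max_ge) (use fin in auto)
    qed (simp add: in_keys_iff)
    then show "w \<in> bounded_monomials n (Max (insert 0 ?A))"
      using i assms[of i] by (auto simp: bounded_monomials_def)
  qed
qed

lemma lin_ext_power_prod:
  fixes \<psi> :: "monomial \<Rightarrow> ((nat \<Rightarrow>\<^sub>0 nat) \<Rightarrow>\<^sub>0 'k::field)"
  assumes "\<And>u v. \<psi> (u + v) = \<psi> u * \<psi> v" "\<psi> 0 = 1"
  shows "lin_ext \<psi> (power_prod x l) = power_prod (\<lambda>i. lin_ext \<psi> (x i)) l"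
proof (induction l arbitrary: x)
  case Nil
  show ?case using lin_ext_mono_poly[of \<psi> 0] assms(2) by simp
next
  case (Cons j l)
  have "lin_ext \<psi> (p ^ j) = lin_ext \<psi> p ^ j" for p
    using lin_ext_mono_poly[of \<psi> 0] assms by (induction j) (auto simp: lin_ext_mult)
  then show ?case using Cons assms(1) by (simp add: lin_ext_mult)
qed

text \<open>A chain of length \<open>k > n + 1\<close> would give about \<open>t\<^sup>k\<close> products of powers that are linearly
  independent modulo the kernel, but whose images lie in a space of dimension \<open>O(t\<^bsup>n+1\<^esup>)\<close>.\<close>

lemma prime_chain_length_bound:
  fixes P :: "nat \<Rightarrow> 'k::field polynomial set"
    and \<psi> :: "monomial \<Rightarrow> ((nat \<Rightarrow>\<^sub>0 nat) \<Rightarrow>\<^sub>0 'k)"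
  assumes \<psi>: "\<And>u v. \<psi> (u + v) = \<psi> u * \<psi> v" "\<psi> 0 = 1"
    and keys: "\<And>u. u \<in> monomials V \<Longrightarrow> \<Union> (Poly_Mapping.keys ` Poly_Mapping.keys (\<psi> u)) \<subseteq> {..n}"
    and prime: "\<And>i. i \<le> k \<Longrightarrow> primeideal (P i) (poly_ring V)"
    and strict: "\<And>i. i < k \<Longrightarrow> P i \<subset> P (Suc i)"
    and ker: "{p \<in> carrier (poly_ring V). lin_ext \<psi> p = 0} \<subseteq> P 0"
  shows "k \<le> n + 1"
proof (rule ccontr)
  assume "\<not> k \<le> n + 1"
  then have k: "n + 2 \<le> k" by simp
  have "\<exists>x. x \<in> P (Suc i) - P i" if "i < k" for i using strict[OF that] by blast
  then obtain x where x: "\<And>i. i < k \<Longrightarrow> x i \<in> P (Suc i) - P i" by metis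
  have x_mon: "Poly_Mapping.keys (x i) \<subseteq> monomials V" if "i < k" for i
    using ideal_poly_subset[OF primeideal.axioms(1)[OF prime[of "Suc i"]]] x[OF that] that by auto
  have "\<Union> (Poly_Mapping.keys ` Poly_Mapping.keys (lin_ext \<psi> (x i))) \<subseteq> {..n}" if "i < k" for i
  proof -
    have "Poly_Mapping.keys (lin_ext \<psi> (x i)) \<subseteq> (\<Union>u\<in>Poly_Mapping.keys (x i). Poly_Mapping.keys (\<psi> u))"
      unfolding lin_ext_def
    proof (rule order.trans[OF keys_sum], rule UN_mono)
      fix u
      have "Poly_Mapping.keys (Poly_Mapping.single 0 c * \<psi> u) \<subseteq> Poly_Mapping.keys (\<psi> u)" for c
        using keys_mult[of "Poly_Mapping.single 0 c" "\<psi> u"] by (auto split: if_splits)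
      then show "Poly_Mapping.keys (Poly_Mapping.single 0 (Poly_Mapping.lookup (x i) u) * \<psi> u) \<subseteq> Poly_Mapping.keys (\<psi> u)" .
    qed simp
    then show ?thesis using keys x_mon[OF that] by fastforce
  qed
  then obtain N where N: "\<And>i. i < k \<Longrightarrow> Poly_Mapping.keys (lin_ext \<psi> (x i)) \<subseteq> bounded_monomials n N"
    using bounded_monomials_exhaust[of k "\<lambda>i. lin_ext \<psi> (x i)" n] by auto
  \<comment> \<open>These constants make the counts cross: (k t N + 1)^(n+1) <= (E (t + 1))^(n+1) =
    t (t + 1)^(n+1) < (t + 1)^(n+2) <= (t + 1)^k. The left end bounds the number of monomials
    available to the images, the right end is the number of exponent vectors with entries at most
    \<open>t\<close>.\<close>
  define E where "E = k * N + 1"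
  define t where "t = E ^ (n + 1)"
  define L where "L = {l. set l \<subseteq> {..t} \<and> length l = k}"
  have L: "finite L" "card L = (t + 1) ^ k" 
    by (auto simp: L_def finite_lists_length_eq card_lists_length_eq)
  define F where "F = bounded_monomials n (k * t * N)"
  have "finite F" unfolding F_def by (rule bounded_monomials_card)
  have "card F \<le> (k * t * N + 1) ^ (n + 1)"
    unfolding F_def by (rule bounded_monomials_card)
  also have "(k * t * N + 1) ^ (n + 1) \<le> (E * (t + 1)) ^ (n + 1)"
    by (rule power_mono) (auto simp: E_def algebra_simps)
  also have "\<dots> = t * (t + 1) ^ (n + 1)" by (simp only: t_def power_mult_distrib)
  also have "\<dots> < (t + 1) * (t + 1) ^ (n + 1)" by (intro mult_strict_right_mono) auto
  also have "\<dots> = (t + 1) ^ (n + 2)" by simp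
  also have "\<dots> \<le> (t + 1) ^ k" by (rule power_increasing[OF k]) simp
  finally have "card F < card L" using L by simp
  define im where "im l = lin_ext \<psi> (power_prod x l)" for l
  have im_keys: "Poly_Mapping.keys (im l) \<subseteq> F" if "l \<in> L" for l
  proof -
    have "sum_list l \<le> k * t"
      using sum_list_mono[of l "\<lambda>x. x" "\<lambda>_. t"] that by (auto simp: L_def sum_list_triv mult.commute)
    then have "bounded_monomials n (sum_list l * N) \<subseteq> F"
      unfolding F_def bounded_monomials_def using mult_le_mono1[of "sum_list l" "k * t" N]
      by (auto intro: order.trans)
    moreover have "Poly_Mapping.keys (im l) \<subseteq> bounded_monomials n (sum_list l * N)"
      unfolding im_def lin_ext_power_prod[of \<psi>, OF \<psi>]
      by (rule bounded_monomials_power_prod) (use N that in \<open>auto simp: L_def\<close>)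
    ultimately show ?thesis by blast
  qed
  \<comment> \<open>There are more power products than monomials in their images, so some nontrivial
    combination of the products has image 0. It lies in the kernel, hence in P_0, against the
    independence of power products.\<close>
  obtain c where c: "\<exists>l\<in>L. c l \<noteq> 0" "\<forall>w\<in>F. (\<Sum>l\<in>L. c l * Poly_Mapping.lookup (im l) w) = 0"
    using homogeneous_system_nontrivial_solution[OF \<open>finite F\<close> L(1) \<open>card F < card L\<close>, of "\<lambda>l. Poly_Mapping.lookup (im l)"]
    by blast
  let ?s = "\<Sum>l\<in>L. Poly_Mapping.single 0 (c l) * power_prod x l"
  have single: "Poly_Mapping.lookup (Poly_Mapping.single 0 b * p) w = b * Poly_Mapping.lookup p w"
    for b :: 'k and p :: "(nat \<Rightarrow>\<^sub>0 nat) \<Rightarrow>\<^sub>0 'k" and w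
    by (simp add: mult_map_scale_conv_mult[symmetric] Poly_Mapping.map.rep_eq when_def)
  have "lin_ext \<psi> ?s = 0"
  proof (rule poly_mapping_eqI)
    fix w
    have "Poly_Mapping.lookup (lin_ext \<psi> ?s) w = (\<Sum>l\<in>L. c l * Poly_Mapping.lookup (im l) w)"
      by (simp add: lin_ext_sum lin_ext_mult[of \<psi>, OF \<psi>(1)] lin_ext_single \<psi>(2) lookup_sum single im_def)
    also have "\<dots> = 0"
    proof (cases "w \<in> F")
      case False
      then have "Poly_Mapping.lookup (im l) w = 0" if "l \<in> L" for l
        using im_keys[OF that] by (auto simp: in_keys_iff)
      then show ?thesis by simp
    qed (use c in auto)
    finally show "Poly_Mapping.lookup (lin_ext \<psi> ?s) w = Poly_Mapping.lookup 0 w" by simp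
  qed
  moreover have "Poly_Mapping.keys ?s \<subseteq> monomials V"
  proof -
    have "Poly_Mapping.keys (Poly_Mapping.single 0 (c l) * power_prod x l) \<subseteq> monomials V" if "l \<in> L" for l
      by (rule keys_mult_monomials) (use that x_mon in \<open>auto simp: L_def intro!: keys_power_prod_monomials\<close>)
    then show ?thesis by (intro order.trans[OF keys_sum]) auto
  qed
  ultimately have "?s \<in> P 0" using ker by auto
  then have "\<forall>l\<in>L. c l = 0"
    using prime_chain_power_prod[of k P V x L c] prime strict x L(1) by (fastforce simp: L_def)
  then show False using c(1) by auto
qed

section \<open>Hilbert functions\<close>

lemma mdeg_eq_sum:
  assumes "finite A" "Poly_Mapping.keys u \<subseteq> A"
  shows "mdeg u = (\<Sum>v\<in>A. Poly_Mapping.lookup u v)"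
  unfolding mdeg_def using assms by (intro sum.mono_neutral_left) (auto simp: in_keys_iff)

lemma mdeg_0 [simp]: "mdeg 0 = 0"
  by (simp add: mdeg_def)

lemma mdeg_add [simp]: "mdeg (u + v) = mdeg u + mdeg v"
proof -
  let ?A = "Poly_Mapping.keys u \<union> Poly_Mapping.keys v"
  show ?thesis
    by (simp add: mdeg_eq_sum[of ?A] keys_add_nat lookup_add sum.distrib)
qed

lemma mdeg_single [simp]: "mdeg (Poly_Mapping.single v k) = k"
  by (cases "k = 0") (simp_all add: mdeg_def)

text \<open>A monomial of degree t is a multiset of t indeterminates, with exponents as
  multiplicities.\<close>

lemma monomials_of_degree:
  assumes "finite V"
  shows "finite {u \<in> monomials V. mdeg u = t}"
    and "card {u \<in> monomials V. mdeg u = t} = (card V + t - 1) choose t"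
proof -
  define g :: "indet multiset \<Rightarrow> monomial" where "g X = Poly_Mapping.Abs_poly_mapping (count X)" for X
  have fin: "finite {v. count X v \<noteq> 0}" for X :: "indet multiset"
  proof -
    have "{v. count X v \<noteq> 0} = set_mset X" by (auto simp: count_eq_zero_iff)
    then show ?thesis by simp
  qed
  have lookup: "Poly_Mapping.lookup (g X) = count X" for X
    by (simp add: g_def Poly_Mapping.Abs_poly_mapping_inverse fin)
  have keys: "Poly_Mapping.keys (g X) = set_mset X" for X
    by (auto simp: in_keys_iff lookup)
  have mdeg: "mdeg (g X) = size X" for X
    by (simp add: mdeg_def keys lookup size_multiset_overloaded_eq)
  have img: "g ` multisets_of_size V t = {u \<in> monomials V. mdeg u = t}"
  proof (intro equalityI subsetI)
    fix u assume u: "u \<in> {u \<in> monomials V. mdeg u = t}"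
    have "finite {v. Poly_Mapping.lookup u v > 0}" using finite_lookup[of u] by simp
    then have "count (Abs_multiset (Poly_Mapping.lookup u)) = Poly_Mapping.lookup u"
      by (simp add: Abs_multiset_inverse)
    then have "u = g (Abs_multiset (Poly_Mapping.lookup u))"
      by (intro poly_mapping_eqI) (simp add: lookup)
    then show "u \<in> g ` multisets_of_size V t"
      using u keys mdeg by (metis (mono_tags, lifting) image_eqI mem_Collect_eq monomials_def multisets_of_size_def)
  qed (auto simp: multisets_of_size_def monomials_def keys mdeg)
  have "inj g"
    by (rule injI, rule multiset_eqI) (metis lookup)
  then have "card (g ` multisets_of_size V t) = (card V + t - 1) choose t"
    using card_image[OF inj_on_subset[OF _ subset_UNIV]] card_multisets_of_size[OF assms] by metis
  moreover have "finite (g ` multisets_of_size V t)"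
    using finite_multisets_of_size[OF assms] by blast
  ultimately show "finite {u \<in> monomials V. mdeg u = t}"
    and "card {u \<in> monomials V. mdeg u = t} = (card V + t - 1) choose t"
    unfolding img by auto
qed

section \<open>Dimensions in a quotient by the kernel of a monomial map\<close>

lemma subfield_const_polys: "subfield (const_polys :: 'k::field polynomial set) (poly_ring V)"
proof -
  interpret cring "poly_ring V :: 'k polynomial ring" by (rule poly_ring_cring)
  have sub: "subcring (const_polys :: 'k polynomial set) (poly_ring V)"
  proof (rule subcringI)
    show "subring (const_polys :: 'k polynomial set) (poly_ring V)"
    proof (rule subringI)
      show "\<one>\<^bsub>poly_ring V\<^esub> \<in> const_polys" by (auto simp: const_polys_def intro: image_eqI[of _ _ 1])
      show "const_polys \<subseteq> carrier (poly_ring V)" by (auto simp: const_polys_def split: if_splits)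
      fix p q :: "'k polynomial" assume "p \<in> const_polys" "q \<in> const_polys"
      then show "p \<otimes>\<^bsub>poly_ring V\<^esub> q \<in> const_polys" "p \<oplus>\<^bsub>poly_ring V\<^esub> q \<in> const_polys"
        by (auto simp: const_polys_def mult_single single_add[symmetric])
    next
      fix p :: "'k polynomial" assume "p \<in> const_polys"
      then show "\<ominus>\<^bsub>poly_ring V\<^esub> p \<in> const_polys"
        using poly_ring_a_inv[of p V] by (auto simp: const_polys_def single_uminus[symmetric] split: if_splits)
    qed
  qed (simp add: mult.commute)
  moreover have "Units (poly_ring V \<lparr> carrier := const_polys \<rparr>) = (const_polys :: 'k polynomial set) - {\<zero>\<^bsub>poly_ring V\<^esub>}"
  proof (intro equalityI subsetI)
    fix p :: "'k polynomial" assume "p \<in> const_polys - {\<zero>\<^bsub>poly_ring V\<^esub>}"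
    then obtain c where "p = Poly_Mapping.single 0 c" "p \<noteq> 0" by (auto simp: const_polys_def)
    then have c: "p = Poly_Mapping.single 0 c" "c \<noteq> 0" by auto
    then show "p \<in> Units (poly_ring V \<lparr> carrier := const_polys \<rparr>)"
      by (auto simp: Units_def const_polys_def mult_single intro!: exI[of _ "inverse c"])
  qed (auto simp: Units_def)
  ultimately show ?thesis by (rule subfieldI)
qed

context
  fixes \<Phi> :: "monomial \<Rightarrow> (nat \<Rightarrow>\<^sub>0 nat)" and V :: "indet set" and J :: "'k::field polynomial set"
  assumes J: "J = {p \<in> carrier (poly_ring V). lin_ext (\<lambda>u. Poly_Mapping.single (\<Phi> u) 1) p = 0}"
    and \<Phi>: "\<And>u v. \<Phi> (u + v) = \<Phi> u + \<Phi> v" "\<Phi> 0 = 0"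
begin

lemma primeideal_monomial_kernel: "primeideal J (poly_ring V)"
  unfolding J by (rule primeideal_lin_ext_kernel) (auto simp: \<Phi> mult_single)

text \<open>The classes of monomials with distinct values of \<Phi> are linearly independent. They
  are adjoined one at a time, each extending the span by a line.\<close>

lemma dimension_quot_image:
  assumes "finite U" "U \<subseteq> monomials V" "inj_on \<Phi> U"
  shows "ring.dimension (poly_ring V Quot J) (card U) (quot_image V J const_polys) (quot_image V J {p. Poly_Mapping.keys p \<subseteq> U})"
proof -
  interpret J: primeideal J "poly_ring V" by (rule primeideal_monomial_kernel)
  interpret Q: ring "poly_ring V Quot J" by (rule J.quotient_is_ring)
  let ?c = "\<lambda>p. J +>\<^bsub>poly_ring V\<^esub> p"
  note hom = J.rcos_ring_hom
  show ?thesis using assms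
  proof (induction U rule: finite_induct)
    case empty
    have "quot_image V J {p. Poly_Mapping.keys p \<subseteq> {}} = {\<zero>\<^bsub>poly_ring V Quot J\<^esub>}"
      using ring_hom_zero[OF J.rcos_ring_hom poly_ring_ring J.quotient_is_ring] by (simp add: quot_image_def)
    then show ?case by (simp add: Q.zero_dim)
  next
    case (insert u U)
    have carr: "?c p \<in> carrier (poly_ring V Quot J)" if "Poly_Mapping.keys p \<subseteq> monomials V" for p
      using ring_hom_closed[OF hom, of p] that by simp
    have comb: "?c (Poly_Mapping.single 0 c) \<otimes>\<^bsub>poly_ring V Quot J\<^esub> ?c (mono_poly u) \<oplus>\<^bsub>poly_ring V Quot J\<^esub> ?c p
        = ?c (Poly_Mapping.single u c + p)" if "Poly_Mapping.keys p \<subseteq> U" for p c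
    proof -
      have "Poly_Mapping.single u c = Poly_Mapping.single 0 c * mono_poly u"
        by (simp add: mono_poly_def mult_single)
      moreover have "Poly_Mapping.keys (Poly_Mapping.single u c) \<subseteq> monomials V" "Poly_Mapping.keys p \<subseteq> monomials V"
        using insert.prems that by auto
      ultimately show ?thesis
        using ring_hom_mult[OF hom, of "Poly_Mapping.single 0 c" "mono_poly u"] ring_hom_add[OF hom, of "Poly_Mapping.single u c" p]
          insert.prems by simp
    qed
    have eq: "quot_image V J {p. Poly_Mapping.keys p \<subseteq> insert u U}
      = Q.line_extension (quot_image V J const_polys) (?c (mono_poly u)) (quot_image V J {p. Poly_Mapping.keys p \<subseteq> U})"
    proof (intro equalityI subsetI)
      fix X assume "X \<in> quot_image V J {p. Poly_Mapping.keys p \<subseteq> insert u U}"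
      then obtain p where p: "X = ?c p" "Poly_Mapping.keys p \<subseteq> insert u U" by (auto simp: quot_image_def)
      define r where "r = p - Poly_Mapping.single u (Poly_Mapping.lookup p u)"
      have r: "Poly_Mapping.keys r \<subseteq> U"
        using p(2) by (auto simp: r_def in_keys_iff lookup_minus lookup_single when_def split: if_splits)
      have "X = ?c (Poly_Mapping.single 0 (Poly_Mapping.lookup p u)) \<otimes>\<^bsub>poly_ring V Quot J\<^esub> ?c (mono_poly u) \<oplus>\<^bsub>poly_ring V Quot J\<^esub> ?c r"
        unfolding comb[OF r] by (simp add: p(1) r_def)
      then show "X \<in> Q.line_extension (quot_image V J const_polys) (?c (mono_poly u)) (quot_image V J {p. Poly_Mapping.keys p \<subseteq> U})"
        unfolding Q.line_extension_mem_iff using r by (auto simp: quot_image_def const_polys_def)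
    next
      fix X assume "X \<in> Q.line_extension (quot_image V J const_polys) (?c (mono_poly u)) (quot_image V J {p. Poly_Mapping.keys p \<subseteq> U})"
      then obtain c p where X: "X = ?c (Poly_Mapping.single u c + p)" "Poly_Mapping.keys p \<subseteq> U"
        unfolding Q.line_extension_mem_iff using comb by (auto simp: quot_image_def const_polys_def)
      moreover have "Poly_Mapping.keys (Poly_Mapping.single u c + p) \<subseteq> insert u U"
        using keys_add[of "Poly_Mapping.single u c" p] X(2) by (auto split: if_splits)
      ultimately show "X \<in> quot_image V J {p. Poly_Mapping.keys p \<subseteq> insert u U}"
        by (auto simp: quot_image_def)
    qed
    have "?c (mono_poly u) \<notin> quot_image V J {p. Poly_Mapping.keys p \<subseteq> U}"
    proof
      \<comment> \<open>If the class of \<open>u\<close> were in the span of the others, comparing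
        the coefficients at \<Phi> u of the two images would give 1 = 0, because no monomial of
        \<open>U\<close> has this value.\<close>
      assume "?c (mono_poly u) \<in> quot_image V J {p. Poly_Mapping.keys p \<subseteq> U}"
      then obtain p where p: "?c (mono_poly u) = ?c p" "Poly_Mapping.keys p \<subseteq> U" by (auto simp: quot_image_def)
      then have "mono_poly u - p \<in> J"
        using ideal_poly_coset_eq_iff[OF J.is_ideal, of "mono_poly u" p] insert.prems by auto
      then have "lin_ext (\<lambda>u. Poly_Mapping.single (\<Phi> u) 1) p = Poly_Mapping.single (\<Phi> u) (1::'k)"
        by (simp add: J lin_ext_diff lin_ext_mono_poly)
      then have "Poly_Mapping.lookup (lin_ext (\<lambda>u. Poly_Mapping.single (\<Phi> u) 1) p) (\<Phi> u) = (1::'k)"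
        by simp
      moreover have "{x \<in> Poly_Mapping.keys p. \<Phi> x = \<Phi> u} = {}"
        using p(2) insert.prems insert.hyps by (auto simp: inj_on_def)
      ultimately show False by (simp add: lookup_lin_ext_single)
    qed
    then show ?case
      unfolding eq card_insert_disjoint[OF insert.hyps]
      using insert by (intro Q.Suc_dim carr) auto
  qed
qed

text \<open>Monomials with the same value of \<Phi> are congruent modulo the kernel, and one
  monomial per value gives independent classes. So one representative for each value forms a basis
  of the degree t part.\<close>

lemma hilbert_fun_monomial_kernel:
  assumes "finite V"
  shows "hilbert_fun V J t = card (\<Phi> ` {u \<in> monomials V. mdeg u = t})"
proof -
  interpret J: primeideal J "poly_ring V" by (rule primeideal_monomial_kernel)
  interpret Q: ring "poly_ring V Quot J" by (rule J.quotient_is_ring)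
  let ?M = "{u \<in> monomials V. mdeg u = t}"
  obtain U where U: "U \<subseteq> ?M" "inj_on \<Phi> U" "\<Phi> ` ?M = \<Phi> ` U"
    using subset_image_inj[of "\<Phi> ` ?M" \<Phi> ?M] by auto
  have "finite U" using U(1) monomials_of_degree(1)[OF assms] finite_subset by blast
  have "\<exists>r. r \<in> U \<and> \<Phi> r = \<Phi> u" if "u \<in> ?M" for u using U(3) that by (metis (no_types, lifting) imageE imageI)
  then obtain r where r: "\<And>u. u \<in> ?M \<Longrightarrow> r u \<in> U \<and> \<Phi> (r u) = \<Phi> u" by metis
  have "quot_image V J (homog_polys V t) = quot_image V J {p. Poly_Mapping.keys p \<subseteq> U}"
  proof (intro equalityI subsetI)
    fix X assume "X \<in> quot_image V J (homog_polys V t)"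
    then obtain p where p: "X = J +>\<^bsub>poly_ring V\<^esub> p" "\<And>u. u \<in> Poly_Mapping.keys p \<Longrightarrow> u \<in> ?M"
      by (auto simp: quot_image_def homog_polys_def)
    \<comment> \<open>Every monomial is replaced by the representative of its fibre, which changes
      \<open>p\<close> only by an element of the kernel.\<close>
    define p' where "p' = (\<Sum>u\<in>Poly_Mapping.keys p. Poly_Mapping.single (r u) (Poly_Mapping.lookup p u))"
    have keys: "Poly_Mapping.keys p' \<subseteq> U"
      unfolding p'_def by (rule order.trans[OF keys_sum]) (use p(2) r in \<open>auto split: if_splits\<close>)
    have "lin_ext (\<lambda>u. Poly_Mapping.single (\<Phi> u) 1) p' = lin_ext (\<lambda>u. Poly_Mapping.single (\<Phi> u) 1) p"
      unfolding p'_def lin_ext_sum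
      by (subst (2) lin_ext_def, rule sum.cong) (use p(2) r in \<open>auto simp: lin_ext_single\<close>)
    moreover have "Poly_Mapping.keys p \<subseteq> monomials V" "Poly_Mapping.keys p' \<subseteq> monomials V"
      using p(2) keys U(1) by auto
    moreover have "Poly_Mapping.keys (p - p') \<subseteq> monomials V"
      using calculation(2,3) by (auto simp: in_keys_iff lookup_minus) (metis diff_0 in_keys_iff neg_equal_0_iff_equal subsetD)
    ultimately have "J +>\<^bsub>poly_ring V\<^esub> p = J +>\<^bsub>poly_ring V\<^esub> p'"
      using ideal_poly_coset_eq_iff[OF J.is_ideal, of p p'] by (simp add: J lin_ext_diff)
    then show "X \<in> quot_image V J {p. Poly_Mapping.keys p \<subseteq> U}"
      using p(1) keys by (auto simp: quot_image_def)
  next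
    fix X assume "X \<in> quot_image V J {p. Poly_Mapping.keys p \<subseteq> U}"
    then show "X \<in> quot_image V J (homog_polys V t)"
      using U(1) by (auto simp: quot_image_def homog_polys_def)
  qed
  moreover have "ring.dim (poly_ring V Quot J) (quot_image V J const_polys) (quot_image V J {p. Poly_Mapping.keys p \<subseteq> U}) = card U"
  proof -
    have "\<one>\<^bsub>poly_ring V Quot J\<^esub> \<noteq> \<zero>\<^bsub>poly_ring V Quot J\<^esub>"
      using domain.one_not_zero[OF J.quotient_is_domain] .
    then have "subfield (quot_image V J const_polys) (poly_ring V Quot J)"
      unfolding quot_image_def
      by (intro ring_hom_ring.img_is_subfield(2)[OF J.rcos_ring_hom_ring subfield_const_polys])
    then show ?thesis
      using Q.dimI[OF _ dimension_quot_image[OF \<open>finite U\<close> _ U(2)]] U(1) by (auto simp: over_def)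
  qed
  ultimately show ?thesis
    by (simp add: hilbert_fun_def quot_dim_def U(3) card_image[OF U(2)])
qed

end

section \<open>Hilbert polynomials of sums of binomial coefficients\<close>

text \<open>The definite description is justified because two polynomials that agree at all large
  integers differ by a polynomial with infinitely many roots.\<close>

lemma hilbert_poly_eqI:
  assumes "eventually (\<lambda>t. poly p (of_nat t) = of_nat (hilbert_fun V J t)) sequentially"
  shows "hilbert_poly V J = p"
  unfolding hilbert_poly_def
proof (rule the_equality, rule assms)
  fix q :: "rat poly" assume "eventually (\<lambda>t. poly q (of_nat t) = of_nat (hilbert_fun V J t)) sequentially"
  with assms have "eventually (\<lambda>t. poly (q - p) (of_nat t) = 0) sequentially"
    by eventually_elim simp
  then obtain N where N: "\<And>t. t \<ge> N \<Longrightarrow> poly (q - p) (of_nat t) = 0"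
    by (auto simp: eventually_sequentially)
  have "infinite ((of_nat :: nat \<Rightarrow> rat) ` {N..})"
    by (subst finite_image_iff) (auto simp: inj_on_def infinite_Ici)
  moreover have "(of_nat :: nat \<Rightarrow> rat) ` {N..} \<subseteq> {x. poly (q - p) x = 0}" using N by auto
  ultimately have "infinite {x. poly (q - p) x = 0}" using finite_subset by blast
  then show "q = p" using poly_roots_finite[of "q - p"] by auto
qed

text \<open>Once t is at least \<open>s i\<close>, each binomial coefficient is a polynomial in t
  with leading term t^n / n!, whatever the shift \<open>s i\<close> is. Hence only the number of
  summands is visible in degree n.\<close>

lemma coeff_hilbert_poly:
  fixes s :: "'p \<Rightarrow> nat"
  assumes "finite S"
    and "\<And>t. t \<ge> N \<Longrightarrow> hilbert_fun V J t = (\<Sum>i\<in>S. (n + t - s i) choose n)"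
  shows "poly.coeff (hilbert_poly V J) n = of_nat (card S) / fact n"
proof -
  \<comment> \<open>For t >= \<open>s i\<close> this is n! times the binomial coefficient, written
    as a monic product of n linear factors in t.\<close>
  define b where "b i = (\<Prod>j=0..<n. [:of_nat n - of_nat (s i) - of_nat j, 1 :: rat:])" for i
  have deg: "Polynomial.degree (b i) = n" for i
    unfolding b_def by (subst degree_prod_eq_sum_degree) auto
  have coeff: "poly.coeff (b i) n = 1" for i
    using lead_coeff_prod[of "\<lambda>j. [:of_nat n - of_nat (s i) - of_nat j, 1 :: rat:]" "{0..<n}"] deg[of i]
    by (simp add: b_def)
  have poly: "poly (b i) (of_nat t) = fact n * of_nat ((n + t - s i) choose n)" if "s i \<le> t" for i t
  proof -
    have "of_nat ((n + t - s i) choose n) = (of_nat (n + t - s i) :: rat) gchoose n"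
      by (simp add: binomial_gbinomial)
    also have "\<dots> = (\<Prod>j=0..<n. of_nat (n + t - s i) - of_nat j) / fact n"
      by (simp add: gbinomial_prod_rev)
    finally show ?thesis using that by (simp add: b_def poly_prod algebra_simps of_nat_diff)
  qed
  define p where "p = Polynomial.smult (1 / fact n) (\<Sum>i\<in>S. b i)"
  have "hilbert_poly V J = p"
  proof (rule hilbert_poly_eqI, unfold eventually_sequentially, intro exI allI impI)
    fix t assume t: "Max (insert N (s ` S)) \<le> t"
    then have "s i \<le> t" if "i \<in> S" for i using that assms(1) by auto
    moreover have "N \<le> t" using t assms(1) by simp
    ultimately show "poly p (of_nat t) = of_nat (hilbert_fun V J t)"
      by (simp add: p_def assms(2) poly_sum poly sum_divide_distrib)
  qed
  then show ?thesis by (simp add: p_def coeff_sum coeff)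
qed

section \<open>Symmetric algebra and Rees algebra\<close>

text \<open>Substitution of a monomial \<open>g v\<close> for each indeterminate \<open>v\<close>,
  written additively on exponent vectors: powers become multiples and products become sums.\<close>

definition monomial_subst :: "(indet \<Rightarrow> (nat \<Rightarrow>\<^sub>0 nat)) \<Rightarrow> monomial \<Rightarrow> (nat \<Rightarrow>\<^sub>0 nat)" where
  "monomial_subst g u = (\<Sum>v\<in>Poly_Mapping.keys u. Poly_Mapping.map ((*) (Poly_Mapping.lookup u v)) (g v))"

lemma lookup_monomial_subst:
  assumes "finite A" "Poly_Mapping.keys u \<subseteq> A"
  shows "Poly_Mapping.lookup (monomial_subst g u) i = (\<Sum>v\<in>A. Poly_Mapping.lookup u v * Poly_Mapping.lookup (g v) i)"
proof -
  have "Poly_Mapping.lookup (monomial_subst g u) i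
      = (\<Sum>v\<in>Poly_Mapping.keys u. Poly_Mapping.lookup u v * Poly_Mapping.lookup (g v) i)"
    unfolding monomial_subst_def lookup_sum by (rule sum.cong) (auto simp: Poly_Mapping.map.rep_eq when_def)
  also have "\<dots> = (\<Sum>v\<in>A. Poly_Mapping.lookup u v * Poly_Mapping.lookup (g v) i)"
    using assms by (intro sum.mono_neutral_left) (auto simp: in_keys_iff)
  finally show ?thesis .
qed

lemma monomial_subst_add: "monomial_subst g (u + v) = monomial_subst g u + monomial_subst g v"
proof (rule poly_mapping_eqI)
  fix i
  let ?A = "Poly_Mapping.keys u \<union> Poly_Mapping.keys v"
  show "Poly_Mapping.lookup (monomial_subst g (u + v)) i = Poly_Mapping.lookup (monomial_subst g u + monomial_subst g v) i"
    by (simp add: lookup_monomial_subst[of ?A] keys_add_nat lookup_add distrib_right sum.distrib)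
qed

lemma monomial_subst_0: "monomial_subst g 0 = 0"
  by (simp add: monomial_subst_def)

lemma monomial_subst_single: "monomial_subst g (Poly_Mapping.single v 1) = g v"
  by (rule poly_mapping_eqI) (simp add: lookup_monomial_subst[of "{v}"])

lemma monomial_subst_cong:
  "(\<And>v. v \<in> Poly_Mapping.keys u \<Longrightarrow> g v = g' v) \<Longrightarrow> monomial_subst g u = monomial_subst g' u"
  by (simp add: monomial_subst_def)

lemma keys_monomial_subst:
  "Poly_Mapping.keys (monomial_subst g u) \<subseteq> (\<Union>v\<in>Poly_Mapping.keys u. Poly_Mapping.keys (g v))"
  unfolding monomial_subst_def
  by (rule order.trans[OF keys_sum], rule UN_mono) (auto simp: in_keys_iff Poly_Mapping.map.rep_eq when_def split: if_splits)

fun X_gen :: "indet \<Rightarrow> (nat \<Rightarrow>\<^sub>0 nat)" where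
  "X_gen (Xvar i) = Poly_Mapping.single i 1"
| "X_gen (Tvar j) = 0"

text \<open>The Rees algebra of \<open>(f\<^sub>1,\<dots>,f\<^sub>q)\<close> is the image of \<open>X\<^sub>i \<mapsto> X\<^sub>i\<close>, \<open>T\<^sub>j \<mapsto> f\<^sub>j\<tau>\<close>; index \<open>0\<close>, unused
  by the \<open>X\<^sub>i\<close>, stands for the extra indeterminate \<open>\<tau>\<close>.\<close>

fun rees_gen :: "(nat \<Rightarrow> monomial) \<Rightarrow> indet \<Rightarrow> (nat \<Rightarrow>\<^sub>0 nat)" where
  "rees_gen f (Xvar i) = Poly_Mapping.single i 1"
| "rees_gen f (Tvar j) = Poly_Mapping.single 0 1 + monomial_subst X_gen (f j)"

definition rees_ideal :: "nat \<Rightarrow> nat \<Rightarrow> (nat \<Rightarrow> monomial) \<Rightarrow> 'k::field polynomial set" where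
  "rees_ideal n q f = {p \<in> carrier (poly_ring (XTvars n q)).
     lin_ext (\<lambda>u. Poly_Mapping.single (monomial_subst (rees_gen f) u) 1) p = 0}"

lemma Xvars_subset_XTvars: "Xvars n \<subseteq> XTvars n q"
  by (auto simp: Xvars_def XTvars_def)

lemma finite_XTvars [simp]: "finite (XTvars n q)"
  by (simp add: XTvars_def)

lemma monomials_mono: "V \<subseteq> W \<Longrightarrow> monomials V \<subseteq> monomials W"
  by (auto simp: monomials_def)

lemma monomial_subst_rees_gen_Xvars:
  assumes "u \<in> monomials (Xvars n)"
  shows "monomial_subst (rees_gen f) u = monomial_subst X_gen u"
  by (rule monomial_subst_cong) (use assms in \<open>auto simp: monomials_def Xvars_def\<close>)

lemma lookup_monomial_subst_X_gen:
  assumes "u \<in> monomials (Xvars n)"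
  shows "Poly_Mapping.lookup (monomial_subst X_gen u) i = (if i \<in> {1..n} then Poly_Mapping.lookup u (Xvar i) else 0)"
proof -
  have "Poly_Mapping.lookup (monomial_subst X_gen u) i
      = (\<Sum>v\<in>Xvars n. Poly_Mapping.lookup u v * Poly_Mapping.lookup (X_gen v) i)"
    by (rule lookup_monomial_subst) (use assms in \<open>auto simp: Xvars_def monomials_def\<close>)
  also have "\<dots> = (\<Sum>j=1..n. Poly_Mapping.lookup u (Xvar j) * Poly_Mapping.lookup (X_gen (Xvar j)) i)"
    unfolding Xvars_def by (subst sum.reindex) (auto simp: inj_on_def)
  also have "\<dots> = (\<Sum>j=1..n. if j = i then Poly_Mapping.lookup u (Xvar i) else 0)"
    by (rule sum.cong) (auto simp: lookup_single when_def)
  finally show ?thesis by simp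
qed

lemma sym_gens_carrier:
  assumes "\<forall>i\<in>{1..q}. a i \<in> carrier (poly_ring (Xvars n) :: 'k::field polynomial ring)"
  shows "(\<Sum>i=1..q. a i * indet_poly (Tvar i)) \<in> carrier (poly_ring (XTvars n q))"
proof -
  have "Poly_Mapping.keys (a i * indet_poly (Tvar i)) \<subseteq> monomials (XTvars n q)" if "i \<in> {1..q}" for i
  proof (rule keys_mult_monomials)
    show "Poly_Mapping.keys (a i) \<subseteq> monomials (XTvars n q)"
      using assms that monomials_mono[OF Xvars_subset_XTvars, of n q] by fastforce
    show "Poly_Mapping.keys (indet_poly (Tvar i) :: 'k polynomial) \<subseteq> monomials (XTvars n q)"
      using that by (simp add: indet_poly_def XTvars_def)
  qed
  then show ?thesis
    by (simp only: poly_ring_simps mem_Collect_eq) (rule order.trans[OF keys_sum], rule UN_least)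
qed

lemma ideal_sym_ideal: "ideal (sym_ideal n q f :: 'k::field polynomial set) (poly_ring (XTvars n q))"
  unfolding sym_ideal_def
  by (rule ring.genideal_ideal[OF poly_ring_ring]) (use sym_gens_carrier in blast)

text \<open>The kernel of a map sending monomials to monomials is spanned by the differences of
  monomials with equal image, so only these binomials have to be found in an ideal.\<close>

lemma rees_ideal_subset:
  fixes I :: "'k::field polynomial set"
  assumes I: "ideal I (poly_ring (XTvars n q))"
    and bin: "\<And>u v. \<lbrakk>u \<in> monomials (XTvars n q); v \<in> monomials (XTvars n q);
        monomial_subst (rees_gen f) u = monomial_subst (rees_gen f) v\<rbrakk> \<Longrightarrow> mono_poly u - mono_poly v \<in> I"
  shows "rees_ideal n q f \<subseteq> I"
proof
  fix p :: "'k polynomial" assume p: "p \<in> rees_ideal n q f"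
  let ?\<Phi> = "monomial_subst (rees_gen f)"
  let ?K = "Poly_Mapping.keys p"
  \<comment> \<open>One monomial of \<open>p\<close> is fixed in every fibre. Moving all terms to
    these representatives gives 0, since the coefficients of \<open>p\<close> cancel over each
    fibre; subtracting this 0 exhibits \<open>p\<close> as a combination of binomials.\<close>
  define \<rho> where "\<rho> w = (SOME u. u \<in> ?K \<and> ?\<Phi> u = w)" for w
  have \<rho>: "\<rho> (?\<Phi> u) \<in> ?K \<and> ?\<Phi> (\<rho> (?\<Phi> u)) = ?\<Phi> u" if "u \<in> ?K" for u
    unfolding \<rho>_def by (rule someI[of _ u]) (use that in auto)
  have K: "?K \<subseteq> monomials (XTvars n q)" using p by (simp add: rees_ideal_def)
  let ?c = "Poly_Mapping.lookup p"
  have "(\<Sum>u\<in>?K. Poly_Mapping.single (\<rho> (?\<Phi> u)) (?c u))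
      = (\<Sum>w\<in>?\<Phi> ` ?K. \<Sum>u\<in>{u \<in> ?K. ?\<Phi> u = w}. Poly_Mapping.single (\<rho> (?\<Phi> u)) (?c u))"
    by (rule sum.image_gen) simp
  also have "\<dots> = (\<Sum>w\<in>?\<Phi> ` ?K. Poly_Mapping.single (\<rho> w) (\<Sum>u\<in>{u \<in> ?K. ?\<Phi> u = w}. ?c u))"
  proof (rule sum.cong[OF refl])
    fix w
    have "Poly_Mapping.single (\<rho> w) (sum ?c A) = (\<Sum>u\<in>A. Poly_Mapping.single (\<rho> w) (?c u))" for A
      by (induction A rule: infinite_finite_induct) (auto simp: single_add)
    then show "(\<Sum>u\<in>{u \<in> ?K. ?\<Phi> u = w}. Poly_Mapping.single (\<rho> (?\<Phi> u)) (?c u))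
        = Poly_Mapping.single (\<rho> w) (\<Sum>u\<in>{u \<in> ?K. ?\<Phi> u = w}. ?c u)" by simp
  qed
  also have "\<dots> = 0"
    using p by (simp add: rees_ideal_def lookup_lin_ext_single[symmetric])
  finally have zero: "(\<Sum>u\<in>?K. Poly_Mapping.single (\<rho> (?\<Phi> u)) (?c u)) = 0" .
  have "p = (\<Sum>u\<in>?K. Poly_Mapping.single u (?c u))"
    by (rule poly_mapping_sum_single) auto
  also have "\<dots> = (\<Sum>u\<in>?K. Poly_Mapping.single u (?c u)) - (\<Sum>u\<in>?K. Poly_Mapping.single (\<rho> (?\<Phi> u)) (?c u))"
    using zero by simp
  also have "\<dots> = (\<Sum>u\<in>?K. Poly_Mapping.single 0 (?c u) * (mono_poly u - mono_poly (\<rho> (?\<Phi> u))))"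
    by (simp add: sum_subtractf right_diff_distrib mono_poly_def mult_single)
  also have "\<dots> \<in> I"
    by (intro ideal_poly_sum[OF I] ideal_poly_mult[OF I] bin) (use \<rho> K in auto)
  finally show "p \<in> I" .
qed

lemma sym_ideal_subset:
  assumes "ideal I (poly_ring (XTvars n q))"
    and "\<And>a. \<lbrakk>\<forall>i\<in>{1..q}. a i \<in> carrier (poly_ring (Xvars n)); (\<Sum>i=1..q. a i * mono_poly (f i)) = 0\<rbrakk>
           \<Longrightarrow> (\<Sum>i=1..q. a i * indet_poly (Tvar i)) \<in> I"
  shows "(sym_ideal n q f :: 'k::field polynomial set) \<subseteq> I"
  unfolding sym_ideal_def
  by (rule ring.genideal_minimal[OF poly_ring_ring assms(1)]) (use assms(2) in auto)

lemma primeideal_rees_ideal: "primeideal (rees_ideal n q f :: 'k::field polynomial set) (poly_ring (XTvars n q))"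
  by (rule primeideal_monomial_kernel[OF rees_ideal_def monomial_subst_add monomial_subst_0])

section \<open>Primes generated by variables, and the Krull dimension\<close>

text \<open>\<open>P\<close> is the ideal generated by the variables of S lying in \<open>W\<close>,
  described through its monomials. It is the kernel of setting these variables to 0: as
  \<open>W\<close> contains all T-variables, the surviving monomials involve only the X-variables
  and \<open>X_gen\<close> keeps them apart. The defining forms of the symmetric algebra are linear
  in the T-variables, so they vanish too.\<close>

lemma primeideal_meeting_variables:
  fixes W :: "indet set" and n q :: nat
  assumes "Tvar ` {1..q} \<subseteq> W"
  defines "P \<equiv> {p \<in> carrier (poly_ring (XTvars n q) :: 'k::field polynomial ring). \<forall>u\<in>Poly_Mapping.keys p. Poly_Mapping.keys u \<inter> W \<noteq> {}}"
  shows "primeideal P (poly_ring (XTvars n q))" and "(sym_ideal n q f :: 'k polynomial set) \<subseteq> P"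
proof -
  let ?\<psi> = "\<lambda>u. if Poly_Mapping.keys u \<inter> W = {} then Poly_Mapping.single (monomial_subst X_gen u) (1::'k) else 0"
  have mult: "?\<psi> (u + v) = ?\<psi> u * ?\<psi> v" for u v :: monomial
    by (auto simp: keys_add_nat monomial_subst_add mult_single)
  have one: "?\<psi> 0 = 1" by (simp add: monomial_subst_0)
  have inj: "u = v" if "u \<in> monomials (XTvars n q)" "v \<in> monomials (XTvars n q)"
    "Poly_Mapping.keys u \<inter> W = {}" "Poly_Mapping.keys v \<inter> W = {}" "monomial_subst X_gen u = monomial_subst X_gen v" for u v
  proof -
    have X: "x \<in> monomials (Xvars n)" if "x \<in> monomials (XTvars n q)" "Poly_Mapping.keys x \<inter> W = {}" for x
      using that assms(1) unfolding monomials_def XTvars_def Xvars_def by blast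
    show ?thesis
    proof (rule poly_mapping_eqI)
      fix x
      show "Poly_Mapping.lookup u x = Poly_Mapping.lookup v x"
      proof (cases "x \<in> Xvars n")
        case True
        then obtain i where "i \<in> {1..n}" "x = Xvar i" by (auto simp: Xvars_def)
        then show ?thesis
          using lookup_monomial_subst_X_gen[OF X[OF that(1,3)], of i] lookup_monomial_subst_X_gen[OF X[OF that(2,4)], of i] that(5)
          by simp
      next
        case False
        then have "x \<notin> Poly_Mapping.keys u" "x \<notin> Poly_Mapping.keys v"
          using X[OF that(1,3)] X[OF that(2,4)] by (auto simp: monomials_def)
        then show ?thesis by (simp add: in_keys_iff)
      qed
    qed
  qed
  have ker: "P = {p \<in> carrier (poly_ring (XTvars n q)). lin_ext ?\<psi> p = 0}"
  proof (intro equalityI subsetI)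
    fix p assume "p \<in> {p \<in> carrier (poly_ring (XTvars n q)). lin_ext ?\<psi> p = 0}"
    then have p: "Poly_Mapping.keys p \<subseteq> monomials (XTvars n q)" "lin_ext ?\<psi> p = 0" by auto
    have "Poly_Mapping.keys u \<inter> W \<noteq> {}" if u: "u \<in> Poly_Mapping.keys p" for u
    proof
      assume W: "Poly_Mapping.keys u \<inter> W = {}"
      have "Poly_Mapping.lookup (Poly_Mapping.single 0 (Poly_Mapping.lookup p v) * ?\<psi> v) (monomial_subst X_gen u)
          = (if v = u then Poly_Mapping.lookup p u else 0)" if "v \<in> Poly_Mapping.keys p" for v
        using inj[of v u] u that p(1) W by (auto simp: mult_single lookup_single when_def)
      then have "Poly_Mapping.lookup (lin_ext ?\<psi> p) (monomial_subst X_gen u)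
          = (\<Sum>v\<in>Poly_Mapping.keys p. if v = u then Poly_Mapping.lookup p u else 0)"
        unfolding lin_ext_def lookup_sum by (intro sum.cong) auto
      then show False using u p(2) by (simp add: in_keys_iff)
    qed
    then show "p \<in> P" using p(1) by (simp add: P_def)
  qed (auto simp: P_def lin_ext_def intro!: sum.neutral)
  show prime: "primeideal P (poly_ring (XTvars n q))"
    unfolding ker by (rule primeideal_lin_ext_kernel[OF mult one])
  show "(sym_ideal n q f :: 'k polynomial set) \<subseteq> P"
  proof (rule sym_ideal_subset[OF primeideal.axioms(1)[OF prime]])
    fix a :: "nat \<Rightarrow> 'k polynomial"
    assume a: "\<forall>i\<in>{1..q}. a i \<in> carrier (poly_ring (Xvars n))"
    have "lin_ext ?\<psi> (indet_poly (Tvar i)) = 0" if "i \<in> {1..q}" for i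
    proof -
      have "Tvar i \<in> W" using that assms(1) by blast
      then show ?thesis unfolding indet_poly_def lin_ext_mono_poly by simp
    qed
    then have "lin_ext ?\<psi> (\<Sum>i=1..q. a i * indet_poly (Tvar i)) = 0"
      by (simp add: lin_ext_sum lin_ext_mult[of ?\<psi>, OF mult])
    then show "(\<Sum>i=1..q. a i * indet_poly (Tvar i)) \<in> P"
      using sym_gens_carrier[OF a] unfolding ker by simp
  qed
qed

context
  fixes n q :: nat and f :: "nat \<Rightarrow> monomial"
  assumes f: "\<And>i. i \<in> {1..q} \<Longrightarrow> f i \<in> monomials (Xvars n)"
begin

text \<open>Under T_i -> f_i \<tau> the form attached to a syzygy becomes \<tau> times the syzygy
  evaluated at the f_i, which is 0.\<close>

lemma sym_ideal_subset_rees_ideal: "(sym_ideal n q f :: 'k::field polynomial set) \<subseteq> rees_ideal n q f"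
proof (rule sym_ideal_subset)
  show "ideal (rees_ideal n q f :: 'k polynomial set) (poly_ring (XTvars n q))"
    by (rule primeideal.axioms(1)[OF primeideal_rees_ideal])
next
  fix a :: "nat \<Rightarrow> 'k polynomial"
  assume a: "\<forall>i\<in>{1..q}. a i \<in> carrier (poly_ring (Xvars n))" "(\<Sum>i=1..q. a i * mono_poly (f i)) = 0"
  let ?\<psi> = "\<lambda>u. Poly_Mapping.single (monomial_subst (rees_gen f) u) (1::'k)"
  let ?\<tau> = "Poly_Mapping.single (Poly_Mapping.single (0::nat) (1::nat)) (1::'k)"
  have mult: "lin_ext ?\<psi> (p * r) = lin_ext ?\<psi> p * lin_ext ?\<psi> r" for p r
    by (rule lin_ext_mult) (simp add: monomial_subst_add mult_single)
  have T: "lin_ext ?\<psi> (indet_poly (Tvar i)) = ?\<tau> * lin_ext ?\<psi> (mono_poly (f i))" if "i \<in> {1..q}" for i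
    using f[OF that] unfolding indet_poly_def lin_ext_mono_poly monomial_subst_single
    by (simp add: mult_single monomial_subst_rees_gen_Xvars)
  have "lin_ext ?\<psi> (\<Sum>i=1..q. a i * indet_poly (Tvar i)) = ?\<tau> * lin_ext ?\<psi> (\<Sum>i=1..q. a i * mono_poly (f i))"
    unfolding lin_ext_sum mult sum_distrib_left by (rule sum.cong) (auto simp: T mult_ac)
  also have "\<dots> = 0" using a(2) by simp
  finally show "(\<Sum>i=1..q. a i * indet_poly (Tvar i)) \<in> rees_ideal n q f"
    using sym_gens_carrier[OF a(1)] by (simp add: rees_ideal_def)
qed

lemma krull_dim_sym_algebra:
  assumes linear_type: "sym_ideal n q f = (rees_ideal n q f :: 'k::field polynomial set)" and "q \<ge> 1"
  shows "krull_dim (poly_ring (XTvars n q) Quot (sym_ideal n q f :: 'k polynomial set)) = enat (n + 1)"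
proof -
  let ?R = "poly_ring (XTvars n q) :: 'k polynomial ring"
  let ?J = "sym_ideal n q f :: 'k polynomial set"
  define W where "W i = Tvar ` {1..q} \<union> Xvar ` {1..i}" for i
  \<comment> \<open>The index is shifted by one to make room for J at the bottom: P_1 is generated
    by the T-variables alone, and P_{n+1} by all variables.\<close>
  define P where "P i = (if i = 0 then ?J else {p \<in> carrier ?R. \<forall>u\<in>Poly_Mapping.keys p. Poly_Mapping.keys u \<inter> W (i - 1) \<noteq> {}})" for i
  have T: "Tvar ` {1..q} \<subseteq> W i" for i by (auto simp: W_def)
  have P: "primeideal (P i) ?R \<and> ?J \<subseteq> P i" for i
  proof (cases "i = 0")
    case True
    then show ?thesis using primeideal_rees_ideal linear_type by (simp add: P_def)
  next
    case False
    then show ?thesis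
      unfolding P_def if_not_P[OF False] by (intro conjI primeideal_meeting_variables T)
  qed
  have strict: "P i \<subset> P (Suc i)" if "i < n + 1" for i
  proof (cases "i = 0")
    case True
    have "indet_poly (Tvar 1) \<in> P (Suc i)"
      using True assms(2) by (auto simp: P_def indet_poly_def W_def XTvars_def)
    \<comment> \<open>T_1 has a monomial as its image in the Rees algebra, and a monomial is not 0.
      This is where q >= 1 enters.\<close>
    moreover have "indet_poly (Tvar 1) \<notin> P i"
    proof -
      have "Poly_Mapping.single w (1::'k) \<noteq> 0" for w :: "nat \<Rightarrow>\<^sub>0 nat"
        by (metis lookup_single_eq lookup_zero zero_neq_one)
      then show ?thesis by (simp add: True P_def linear_type rees_ideal_def indet_poly_def lin_ext_mono_poly)
    qed
    ultimately show ?thesis using True P[of 1] by (auto simp: P_def)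
  next
    case False
    have "indet_poly (Xvar i) \<in> P (Suc i)"
      using False that by (auto simp: P_def indet_poly_def W_def XTvars_def)
    moreover have "indet_poly (Xvar i) \<notin> P i"
      using False by (auto simp: P_def indet_poly_def W_def)
    moreover have "P i \<subseteq> P (Suc i)"
      using False by (fastforce simp: P_def W_def)
    ultimately show ?thesis by blast
  qed
  \<comment> \<open>The Rees images use only the indices 0 to n, that is, \<tau> and X_1, ...,
    X_n.\<close>
  have upper: "k \<le> n + 1"
    if Q: "\<forall>i\<le>k. primeideal (Q i) ?R \<and> ?J \<subseteq> Q i" "\<forall>i<k. Q i \<subset> Q (Suc i)" for k Q
  proof (rule prime_chain_length_bound[of "\<lambda>u. Poly_Mapping.single (monomial_subst (rees_gen f) u) 1" "XTvars n q" n k Q])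
    fix u assume u: "u \<in> monomials (XTvars n q)"
    have "Poly_Mapping.keys (rees_gen f v) \<subseteq> {..n}" if v: "v \<in> XTvars n q" for v
    proof (cases v)
      case (Xvar i)
      then show ?thesis using v by (auto simp: XTvars_def)
    next
      case (Tvar i)
      have "Poly_Mapping.keys (monomial_subst X_gen (f i)) \<subseteq> {..n}"
        using keys_monomial_subst[of X_gen "f i"] f[of i] v Tvar
        by (fastforce simp: monomials_def Xvars_def XTvars_def)
      then show ?thesis using Tvar by (auto simp: keys_add_nat)
    qed
    then show "\<Union> (Poly_Mapping.keys ` Poly_Mapping.keys (Poly_Mapping.single (monomial_subst (rees_gen f) u) (1::'k))) \<subseteq> {..n}"
      using keys_monomial_subst[of "rees_gen f" u] u by (fastforce simp: monomials_def)
  qed (use Q linear_type in \<open>auto simp: monomial_subst_add monomial_subst_0 mult_single rees_ideal_def\<close>)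
  have "krull_dim (?R Quot ?J) = Sup {enat k | k. \<exists>P. (\<forall>i\<le>k. primeideal (P i) ?R \<and> ?J \<subseteq> P i) \<and> (\<forall>i<k. P i \<subset> P (Suc i))}"
    by (rule krull_dim_quot[OF poly_ring_cring ideal_sym_ideal])
  also have "\<dots> = enat (n + 1)"
  proof (rule antisym)
    show "Sup {enat k | k. \<exists>P. (\<forall>i\<le>k. primeideal (P i) ?R \<and> ?J \<subseteq> P i) \<and> (\<forall>i<k. P i \<subset> P (Suc i))} \<le> enat (n + 1)"
      by (rule Sup_least) (use upper in force)
    show "enat (n + 1) \<le> Sup {enat k | k. \<exists>P. (\<forall>i\<le>k. primeideal (P i) ?R \<and> ?J \<subseteq> P i) \<and> (\<forall>i<k. P i \<subset> P (Suc i))}"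
      by (rule Sup_upper) (use P strict in blast)
  qed
  finally show ?thesis .
qed

end

section \<open>The symmetric algebra of an AUSLI\<close>

text \<open>Squarefree monomials are handled through their index sets, so that divisibility becomes
  inclusion and the degree becomes the cardinality.\<close>

definition sqfree_monomial :: "nat set \<Rightarrow> monomial" where
  "sqfree_monomial A = (\<Sum>i\<in>A. Poly_Mapping.single (Xvar i) 1)"

lemma lookup_sqfree_monomial:
  assumes "finite A"
  shows "Poly_Mapping.lookup (sqfree_monomial A) (Xvar i) = (if i \<in> A then 1 else 0)"
    and "Poly_Mapping.lookup (sqfree_monomial A) (Tvar i) = 0"
  using assms by (simp_all add: sqfree_monomial_def lookup_sum lookup_single when_def)

lemma keys_sqfree_monomial:
  assumes "finite A"
  shows "Poly_Mapping.keys (sqfree_monomial A) = Xvar ` A"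
proof (rule Set.set_eqI)
  fix x show "x \<in> Poly_Mapping.keys (sqfree_monomial A) \<longleftrightarrow> x \<in> Xvar ` A"
    by (cases x) (auto simp: in_keys_iff lookup_sqfree_monomial[OF assms])
qed

lemma Xvar_add_sqfree_monomial:
  "finite A \<Longrightarrow> i \<notin> A \<Longrightarrow> Poly_Mapping.single (Xvar i) 1 + sqfree_monomial A = sqfree_monomial (insert i A)"
  by (simp add: sqfree_monomial_def)

lemma monomial_split_two:
  fixes u :: monomial
  assumes "Poly_Mapping.lookup u x > 0" "Poly_Mapping.lookup u y > 0" "x \<noteq> y"
  obtains r where "u = Poly_Mapping.single x 1 + Poly_Mapping.single y 1 + r"
proof
  show "u = Poly_Mapping.single x 1 + Poly_Mapping.single y 1 + (u - Poly_Mapping.single x 1 - Poly_Mapping.single y 1)"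
    by (rule poly_mapping_eqI) (use assms in \<open>auto simp: lookup_add lookup_minus lookup_single when_def\<close>)
qed

text \<open>The generators of an AUSLI are \<open>X\<^sub>1\<dots>X\<^bsub>d-1\<^esub>X\<^sub>j\<close> for \<open>d \<le> j \<le> n\<close>, whose symmetric algebra variable is \<open>T\<^bsub>t j\<^esub>\<close>,
  and \<open>X\<^sub>1\<dots>X\<^bsub>d-2\<^esub>X\<^sub>dX\<^bsub>d+1\<^esub>\<close>, with variable \<open>T\<^bsub>t0\<^esub>\<close>.\<close>

locale ausli_generators =
  fixes n d q :: nat and f :: "nat \<Rightarrow> monomial" and t :: "nat \<Rightarrow> nat" and t0 :: nat
  assumes d: "2 \<le> d" "d < n"
    and f_t: "\<And>j. j \<in> {d..n} \<Longrightarrow> f (t j) = sqfree_monomial (insert j {1..<d})"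
    and f_t0: "f t0 = sqfree_monomial ({1..d+1} - {d-1})"
    and t_inj: "inj_on t {d..n}" and t0: "t0 \<notin> t ` {d..n}"
    and indices: "{1..q} = insert t0 (t ` {d..n})"
begin

abbreviation "V \<equiv> XTvars n q"
abbreviation "\<Phi> \<equiv> monomial_subst (rees_gen f)"
abbreviation "L \<equiv> (Poly_Mapping.lookup :: monomial \<Rightarrow> indet \<Rightarrow> nat)"

lemma q_eq: "q = n - d + 2"
proof -
  have "q = card (insert t0 (t ` {d..n}))" by (simp flip: indices)
  also have "\<dots> = Suc (card (t ` {d..n}))" using t0 by simp
  also have "card (t ` {d..n}) = n - d + 1" using t_inj d by (simp add: card_image)
  finally show ?thesis by simp
qed

lemma t_in: "j \<in> {d..n} \<Longrightarrow> t j \<in> {1..q}" and t0_in: "t0 \<in> {1..q}"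
  using indices by auto

lemma t_eq_iff: "i \<in> {d..n} \<Longrightarrow> j \<in> {d..n} \<Longrightarrow> t i = t j \<longleftrightarrow> i = j"
  using t_inj by (auto simp: inj_on_def)

lemma t_neq_t0: "j \<in> {d..n} \<Longrightarrow> t j \<noteq> t0"
  using t0 by auto

lemma f_monomials:
  assumes "i \<in> {1..q}"
  shows "f i \<in> monomials (Xvars n)"
proof -
  from assms consider "i = t0" | j where "j \<in> {d..n}" "i = t j" unfolding indices by auto
  then show ?thesis
    by cases (use d in \<open>auto simp: f_t f_t0 monomials_def keys_sqfree_monomial Xvars_def\<close>)
qed

lemma sum_T: "(\<Sum>i=1..q. h i) = h t0 + (\<Sum>j=d..n. h (t j))" for h :: "nat \<Rightarrow> nat"
  unfolding indices using t0 t_inj by (simp add: sum.reindex)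

text \<open>The conditions record which generators X_i divides:
  \<open>i \<le> d + 1 \<and> i \<noteq> d - 1\<close> for the exceptional generator, and
  \<open>i < d \<or> i = j\<close> for the generator with variable \<open>Tvar (t j)\<close>. The
  exponent at index 0 is the degree in the T-variables.\<close>

lemma lookup_\<Phi>:
  assumes "u \<in> monomials V"
  shows "Poly_Mapping.lookup (\<Phi> u) 0 = L u (Tvar t0) + (\<Sum>j=d..n. L u (Tvar (t j)))"
    and "i \<in> {1..n} \<Longrightarrow> Poly_Mapping.lookup (\<Phi> u) i
        = L u (Xvar i) + (if i \<le> d + 1 \<and> i \<noteq> d - 1 then L u (Tvar t0) else 0)
          + (\<Sum>j=d..n. if i < d \<or> i = j then L u (Tvar (t j)) else 0)"
proof -
  have gen: "Poly_Mapping.lookup (\<Phi> u) i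
      = (\<Sum>k=1..n. L u (Xvar k) * Poly_Mapping.lookup (rees_gen f (Xvar k)) i)
        + (\<Sum>k=1..q. L u (Tvar k) * Poly_Mapping.lookup (rees_gen f (Tvar k)) i)" for i
  proof -
    have "Poly_Mapping.lookup (\<Phi> u) i = (\<Sum>v\<in>V. L u v * Poly_Mapping.lookup (rees_gen f v) i)"
      by (rule lookup_monomial_subst) (use assms in \<open>auto simp: monomials_def\<close>)
    also have "\<dots> = (\<Sum>v\<in>Xvar ` {1..n}. L u v * Poly_Mapping.lookup (rees_gen f v) i)
        + (\<Sum>v\<in>Tvar ` {1..q}. L u v * Poly_Mapping.lookup (rees_gen f v) i)"
      unfolding XTvars_def by (rule sum.union_disjoint) auto
    finally show ?thesis by (simp add: sum.reindex inj_on_def)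
  qed
  have T: "Poly_Mapping.lookup (rees_gen f (Tvar k)) i
      = (if i = 0 then 1 else 0) + (if i \<in> {1..n} then L (f k) (Xvar i) else 0)" if "k \<in> {1..q}" for k i
    by (simp add: lookup_add lookup_single when_def lookup_monomial_subst_X_gen[OF f_monomials[OF that]])
  show "Poly_Mapping.lookup (\<Phi> u) 0 = L u (Tvar t0) + (\<Sum>j=d..n. L u (Tvar (t j)))"
    unfolding gen sum_T using T t_in t0_in by (simp add: lookup_single when_def)
  assume i: "i \<in> {1..n}"
  have "(\<Sum>k=1..n. L u (Xvar k) * Poly_Mapping.lookup (rees_gen f (Xvar k)) i)
      = (\<Sum>k=1..n. if k = i then L u (Xvar i) else 0)"
    by (rule sum.cong) (auto simp: lookup_single when_def)
  also have "\<dots> = L u (Xvar i)" using i by simp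
  finally have X: "(\<Sum>k=1..n. L u (Xvar k) * Poly_Mapping.lookup (rees_gen f (Xvar k)) i) = L u (Xvar i)" .
  have "L u (Tvar t0) * Poly_Mapping.lookup (rees_gen f (Tvar t0)) i = (if i \<le> d + 1 \<and> i \<noteq> d - 1 then L u (Tvar t0) else 0)"
    using T[OF t0_in, of i] i by (auto simp: f_t0 lookup_sqfree_monomial)
  moreover have "(\<Sum>j=d..n. L u (Tvar (t j)) * Poly_Mapping.lookup (rees_gen f (Tvar (t j))) i)
      = (\<Sum>j=d..n. if i < d \<or> i = j then L u (Tvar (t j)) else 0)"
    using T[OF t_in, of _ i] i by (intro sum.cong) (auto simp: f_t lookup_sqfree_monomial)
  ultimately show "Poly_Mapping.lookup (\<Phi> u) i
        = L u (Xvar i) + (if i \<le> d + 1 \<and> i \<noteq> d - 1 then L u (Tvar t0) else 0)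
          + (\<Sum>j=d..n. if i < d \<or> i = j then L u (Tvar (t j)) else 0)"
    unfolding gen X sum_T by simp
qed

section \<open>Standard monomials and their images in the Rees algebra\<close>

text \<open>These are the monomials divisible neither by X_{d-1}T_{t0} nor by any X_i T_{t j} with i
  > j, the left sides of the rewriting rules.\<close>

definition standard :: "monomial \<Rightarrow> bool" where
  "standard u \<longleftrightarrow> u \<in> monomials V \<and> (L u (Xvar (d - 1)) = 0 \<or> L u (Tvar t0) = 0) \<and>
     (\<forall>i\<in>{d..n}. \<forall>j\<in>{d..n}. L u (Xvar i) > 0 \<longrightarrow> L u (Tvar (t j)) > 0 \<longrightarrow> i \<le> j)"

lemma standardD:
  assumes "standard u"
  shows "u \<in> monomials V" "L u (Xvar (d - 1)) = 0 \<or> L u (Tvar t0) = 0"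
    and "\<lbrakk>i \<in> {d..n}; j \<in> {d..n}; L u (Xvar i) > 0; L u (Tvar (t j)) > 0\<rbrakk> \<Longrightarrow> i \<le> j"
proof -
  note s = assms[unfolded standard_def]
  show "u \<in> monomials V" using s by (rule conjunct1)
  show "L u (Xvar (d - 1)) = 0 \<or> L u (Tvar t0) = 0" using s[THEN conjunct2] by (rule conjunct1)
  show "i \<le> j" if "i \<in> {d..n}" "j \<in> {d..n}" "L u (Xvar i) > 0" "L u (Tvar (t j)) > 0"
    using s[THEN conjunct2, THEN conjunct2] that by blast
qed

lemma monomials_lookup_pos: "u \<in> monomials W \<Longrightarrow> L u x > 0 \<Longrightarrow> x \<in> W"
  by (auto simp: monomials_def in_keys_iff)

text \<open>The exponents of a standard monomial can be read off its image. Those of \<tau> and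
  X_{d-1} differ by the exponent of T_{t0} minus that of X_{d-1}, and one of these two is 0, so both
  are known. For i >= d the image shows the sum of the exponents of X_i and T_{t i}; the total
  degree in the T_{t i} is known as well, and the order condition leaves only one way to distribute
  it.\<close>

lemma \<Phi>_inj_on_standard:
  assumes u: "standard u" and v: "standard v" and eq: "\<Phi> u = \<Phi> v"
  shows "u = v"
proof -
  have uV: "u \<in> monomials V" and vV: "v \<in> monomials V" using u v standardD(1) by blast+
  define S where "S w = (\<Sum>j=d..n. L w (Tvar (t j)))" for w
  have \<tau>: "L u (Tvar t0) + S u = L v (Tvar t0) + S v"
    using lookup_\<Phi>(1)[OF uV] lookup_\<Phi>(1)[OF vV] eq by (simp add: S_def)
  have d1: "d - 1 \<in> {1..n}" using d by auto
  \<comment> \<open>T_{t0} does not contribute here, because X_{d-1} is missing from its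
    generator.\<close>
  have "L u (Xvar (d - 1)) + S u = L v (Xvar (d - 1)) + S v"
    using lookup_\<Phi>(2)[OF uV d1] lookup_\<Phi>(2)[OF vV d1] eq d by (simp add: S_def)
  with \<tau> have 1: "L u (Tvar t0) = L v (Tvar t0)" "S u = S v" "L u (Xvar (d - 1)) = L v (Xvar (d - 1))"
    using standardD(2)[OF u] standardD(2)[OF v] by linarith+
  have 2: "L u (Xvar i) = L v (Xvar i)" if "i \<in> {1..<d}" for i
  proof (cases "i = d - 1")
    case False
    have "i \<in> {1..n}" using that d by auto
    from lookup_\<Phi>(2)[OF uV this] lookup_\<Phi>(2)[OF vV this] eq d 1 that False
    show ?thesis by (simp add: S_def)
  qed (use 1 in simp)
  have 3: "L u (Xvar i) + L u (Tvar (t i)) = L v (Xvar i) + L v (Tvar (t i))" if "i \<in> {d..n}" for i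
  proof -
    have "i \<in> {1..n}" "\<not> i < d" using that d by auto
    from lookup_\<Phi>(2)[OF uV this(1)] lookup_\<Phi>(2)[OF vV this(1)] this(2) eq 1 that
    show ?thesis by (auto split: if_splits)
  qed
  \<comment> \<open>If \<open>u\<close> has less of T_{t i} than \<open>v\<close>, it has more of
    some T_{t j}. Since the sums with the X-exponents agree, X_i T_{t j} divides \<open>u\<close>
    and X_j T_{t i} divides \<open>v\<close>, so that i <= j <= i, which is absurd.\<close>
  have no_less: "\<not> L u (Tvar (t i)) < L v (Tvar (t i))"
    if "standard u" "standard v" "S u = S v" and i: "i \<in> {d..n}"
      and 3: "\<And>i. i \<in> {d..n} \<Longrightarrow> L u (Xvar i) + L u (Tvar (t i)) = L v (Xvar i) + L v (Tvar (t i))" for u v i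
  proof
    assume less: "L u (Tvar (t i)) < L v (Tvar (t i))"
    have "\<exists>j\<in>{d..n}. L v (Tvar (t j)) < L u (Tvar (t j))"
    proof (rule ccontr)
      assume "\<not> ?thesis"
      then have "S u < S v" unfolding S_def using less i by (intro sum_strict_mono_ex1) (auto simp: not_less)
      then show False using that(3) by simp
    qed
    then obtain j where j: "j \<in> {d..n}" "L v (Tvar (t j)) < L u (Tvar (t j))" by blast
    have "i \<le> j" by (rule standardD(3)[OF that(1) i j(1)]) (use j less 3[OF i] in linarith)+
    moreover have "j \<le> i" by (rule standardD(3)[OF that(2) j(1) i]) (use j less 3[OF j(1)] in linarith)+
    ultimately show False using less j(2) by simp
  qed
  have 4: "L u (Tvar (t i)) = L v (Tvar (t i))" if "i \<in> {d..n}" for i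
    using no_less[OF u v 1(2) that 3] no_less[OF v u 1(2)[symmetric] that 3[symmetric]] by simp
  show ?thesis
  proof (rule poly_mapping_eqI)
    fix x
    show "L u x = L v x"
    proof (cases "x \<in> V")
      case True
      then consider i where "x = Xvar i" "i \<in> {1..n}" | i where "x = Tvar i" "i \<in> {1..q}"
        by (auto simp: XTvars_def)
      then show ?thesis
      proof cases
        case 1
        then show ?thesis using 2[of i] 3[of i] 4[of i] by (cases "i < d") auto
      next
        case 2
        have "i = t0 \<or> i \<in> t ` {d..n}" using 2(2) unfolding indices by auto
        then show ?thesis using 2 \<open>L u (Tvar t0) = L v (Tvar t0)\<close> 4 by auto
      qed
    next
      case False
      then have "x \<notin> Poly_Mapping.keys u" "x \<notin> Poly_Mapping.keys v" using uV vV by (auto simp: monomials_def)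
      then show ?thesis by (simp add: in_keys_iff)
    qed
  qed
qed

lemma X_in [simp]: "i \<in> {1..n} \<Longrightarrow> Xvar i \<in> V" and T_in [simp]: "i \<in> {1..q} \<Longrightarrow> Tvar i \<in> V"
  by (auto simp: XTvars_def)

section \<open>Reduction to standard monomials and linear type\<close>

context
  fixes J :: "'k::field polynomial set"
  assumes J: "J = sym_ideal n q f"
begin

lemma ideal_J: "ideal J (poly_ring V)"
  unfolding J by (rule ideal_sym_ideal)

text \<open>A two-term syzygy X_a f_i = X_b f_j allows X_a T_i to be traded for X_b T_j modulo J
  inside any monomial.\<close>

lemma exchange_relation:
  assumes "i \<in> {1..q}" "j \<in> {1..q}" "i \<noteq> j" "a \<in> {1..n}" "b \<in> {1..n}"
    and "Poly_Mapping.single (Xvar a) 1 + f i = Poly_Mapping.single (Xvar b) 1 + f j"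
    and r: "r \<in> monomials V"
  shows "mono_poly (Poly_Mapping.single (Xvar a) 1 + Poly_Mapping.single (Tvar i) 1 + r)
       - mono_poly (Poly_Mapping.single (Xvar b) 1 + Poly_Mapping.single (Tvar j) 1 + r) \<in> J"
proof -
  define c where "c k = (if k = i then indet_poly (Xvar a) else if k = j then - indet_poly (Xvar b) else (0 :: 'k polynomial))" for k
  have two: "(\<Sum>k=1..q. c k * h k) = indet_poly (Xvar a) * h i - indet_poly (Xvar b) * h j" for h :: "nat \<Rightarrow> 'k polynomial"
  proof -
    have "(\<Sum>k=1..q. c k * h k) = (\<Sum>k\<in>{i, j}. c k * h k)"
      by (rule sum.mono_neutral_right) (use assms in \<open>auto simp: c_def\<close>)
    then show ?thesis using assms(3) by (simp add: c_def)
  qed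
  have "(\<Sum>k=1..q. c k * indet_poly (Tvar k)) \<in> J"
    unfolding J sym_ideal_def
  proof (rule subsetD[OF ring.genideal_self[OF poly_ring_ring]])
    show "{\<Sum>i = 1..q. a i * indet_poly (Tvar i) |a. (\<forall>i\<in>{1..q}. a i \<in> carrier (poly_ring (Xvars n))) \<and> (\<Sum>i = 1..q. a i * mono_poly (f i)) = 0}
        \<subseteq> carrier (poly_ring (XTvars n q) :: 'k polynomial ring)"
      using sym_gens_carrier by blast
    have "c k \<in> carrier (poly_ring (Xvars n))" for k
      using assms by (auto simp: c_def indet_poly_def Xvars_def)
    moreover have "(\<Sum>k=1..q. c k * mono_poly (f k)) = 0"
      unfolding two using assms(6) by (simp add: indet_poly_def mono_poly_add[symmetric])
    ultimately show "(\<Sum>k=1..q. c k * indet_poly (Tvar k))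
      \<in> {\<Sum>i = 1..q. a i * indet_poly (Tvar i) |a. (\<forall>i\<in>{1..q}. a i \<in> carrier (poly_ring (Xvars n))) \<and> (\<Sum>i = 1..q. a i * mono_poly (f i)) = 0}"
      by blast
  qed
  then have "mono_poly r * (\<Sum>k=1..q. c k * indet_poly (Tvar k)) \<in> J"
    using r by (intro ideal_poly_mult[OF ideal_J]) auto
  also have "mono_poly r * (\<Sum>k=1..q. c k * indet_poly (Tvar k))
    = mono_poly (Poly_Mapping.single (Xvar a) 1 + Poly_Mapping.single (Tvar i) 1 + r)
       - mono_poly (Poly_Mapping.single (Xvar b) 1 + Poly_Mapping.single (Tvar j) 1 + r)"
    unfolding two mono_poly_add indet_poly_def by (simp add: algebra_simps)
  finally show ?thesis .
qed

text \<open>The relations \<open>X\<^sub>iT\<^bsub>t j\<^esub> = X\<^sub>jT\<^bsub>t i\<^esub>\<close> for \<open>i > j\<close> and \<open>X\<^bsub>d-1\<^esub>T\<^bsub>t0\<^esub> = X\<^sub>dT\<^bsub>t (d+1)\<^esub>\<close>, read from left to right, decrease this weight.\<close>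

definition wt :: "monomial \<Rightarrow> nat" where
  "wt u = (\<Sum>i=1..n. L u (Xvar i) * (if i = d - 1 then n + 1 else i))"

lemma wt_add: "wt (u + v) = wt u + wt v"
  by (simp add: wt_def lookup_add distrib_right sum.distrib)

lemma wt_X: "i \<in> {1..n} \<Longrightarrow> wt (Poly_Mapping.single (Xvar i) 1) = (if i = d - 1 then n + 1 else i)"
proof -
  assume i: "i \<in> {1..n}"
  have "wt (Poly_Mapping.single (Xvar i) 1) = (\<Sum>k=1..n. if k = i then (if i = d - 1 then n + 1 else i) else 0)"
    unfolding wt_def by (rule sum.cong) (auto simp: lookup_single when_def)
  then show ?thesis using i by simp
qed

lemma wt_T: "wt (Poly_Mapping.single (Tvar i) 1) = 0"
  by (simp add: wt_def lookup_single)

text \<open>A monomial that is not standard contains the left side of a rule, and applying that rule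
  lowers \<open>wt\<close>. The rules preserve the degree, which is what allows the standard
  monomials to be counted degree by degree.\<close>

lemma reduce_to_standard:
  assumes "u \<in> monomials V"
  shows "\<exists>u'. standard u' \<and> mdeg u' = mdeg u \<and> mono_poly u - mono_poly u' \<in> J"
  using assms
proof (induction "wt u" arbitrary: u rule: less_induct)
  case less
  show ?case
  proof (cases "standard u")
    case True
    then show ?thesis by (intro exI[of _ u]) (simp add: ideal_poly_zero[OF ideal_J])
  next
    case False
    have "\<exists>a b i j r. u = Poly_Mapping.single (Xvar a) 1 + Poly_Mapping.single (Tvar i) 1 + r \<and>
        i \<in> {1..q} \<and> j \<in> {1..q} \<and> i \<noteq> j \<and> a \<in> {1..n} \<and> b \<in> {1..n} \<and>
        Poly_Mapping.single (Xvar a) 1 + f i = Poly_Mapping.single (Xvar b) 1 + f j \<and>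
        (if b = d - 1 then n + 1 else b) < (if a = d - 1 then n + 1 else a)"
    proof (cases "L u (Xvar (d - 1)) = 0 \<or> L u (Tvar t0) = 0")
      case True
      with False less.prems obtain i j where ij: "i \<in> {d..n}" "j \<in> {d..n}" "L u (Xvar i) > 0" "L u (Tvar (t j)) > 0" "j < i"
        by (auto simp: standard_def not_le)
      obtain r where r: "u = Poly_Mapping.single (Xvar i) 1 + Poly_Mapping.single (Tvar (t j)) 1 + r"
        by (rule monomial_split_two[OF ij(3,4)]) auto
      \<comment> \<open>Both X_i f_{t j} and X_j f_{t i} equal X_1...X_{d-1}X_iX_j.\<close>
      have "Poly_Mapping.single (Xvar i) 1 + f (t j) = sqfree_monomial (insert i (insert j {1..<d}))"
        using ij by (simp only: f_t) (rule Xvar_add_sqfree_monomial, auto)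
      also have "\<dots> = sqfree_monomial (insert j (insert i {1..<d}))"
        by (simp add: insert_commute)
      also have "\<dots> = Poly_Mapping.single (Xvar j) 1 + f (t i)"
        using ij by (simp only: f_t) (rule Xvar_add_sqfree_monomial[symmetric], auto)
      finally have "Poly_Mapping.single (Xvar i) 1 + f (t j) = Poly_Mapping.single (Xvar j) 1 + f (t i)" .
      moreover have "i \<in> {1..n}" "j \<in> {1..n}" "t j \<noteq> t i"
        "(if j = d - 1 then n + 1 else j) < (if i = d - 1 then n + 1 else i)"
        using ij d t_eq_iff[OF ij(1,2)] by auto
      ultimately show ?thesis using r t_in[OF ij(1)] t_in[OF ij(2)] by blast
    next
      case False
      then obtain r where r: "u = Poly_Mapping.single (Xvar (d - 1)) 1 + Poly_Mapping.single (Tvar t0) 1 + r"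
        using monomial_split_two[of u "Xvar (d - 1)" "Tvar t0"] by auto
      \<comment> \<open>As d < n, there is a generator containing X_{d+1} to exchange with: both
        X_{d-1} f_{t0} and X_d f_{t(d+1)} equal X_1...X_{d+1}.\<close>
      have d1: "d + 1 \<in> {d..n}" using d by auto
      have "Poly_Mapping.single (Xvar (d - 1)) 1 + f t0 = sqfree_monomial (insert (d - 1) ({1..d+1} - {d-1}))"
        unfolding f_t0 by (rule Xvar_add_sqfree_monomial) auto
      also have "insert (d - 1) ({1..d+1} - {d-1}) = insert d (insert (d + 1) {1..<d})" using d by auto
      also have "sqfree_monomial \<dots> = Poly_Mapping.single (Xvar d) 1 + f (t (d + 1))"
        unfolding f_t[OF d1] by (rule Xvar_add_sqfree_monomial[symmetric]) auto
      finally have "Poly_Mapping.single (Xvar (d - 1)) 1 + f t0 = Poly_Mapping.single (Xvar d) 1 + f (t (d + 1))" .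
      \<comment> \<open>The weight n + 1 of X_{d-1} matters here: with its index d - 1 as weight,
        this rule would go up to d.\<close>
      moreover have "d - 1 \<in> {1..n}" "d \<in> {1..n}" "t0 \<noteq> t (d + 1)"
        "(if d = d - 1 then n + 1 else d) < (if d - 1 = d - 1 then n + 1 else d - 1)"
        using d t_neq_t0[OF d1] by auto
      ultimately show ?thesis using r t_in[OF d1] t0_in by blast
    qed
    then obtain a b i j r where u: "u = Poly_Mapping.single (Xvar a) 1 + Poly_Mapping.single (Tvar i) 1 + r"
      and ab: "i \<in> {1..q}" "j \<in> {1..q}" "i \<noteq> j" "a \<in> {1..n}" "b \<in> {1..n}"
        "Poly_Mapping.single (Xvar a) 1 + f i = Poly_Mapping.single (Xvar b) 1 + f j"
        "(if b = d - 1 then n + 1 else b) < (if a = d - 1 then n + 1 else a)"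
      by blast
    define v where "v = Poly_Mapping.single (Xvar b) 1 + Poly_Mapping.single (Tvar j) 1 + r"
    have r: "r \<in> monomials V" using less.prems u by simp
    have v: "v \<in> monomials V" using r ab by (simp add: v_def)
    have "wt v < wt u" using ab(7) by (simp only: u v_def wt_add wt_X[OF ab(4)] wt_X[OF ab(5)] wt_T)
    then obtain u' where u': "standard u'" "mdeg u' = mdeg v" "mono_poly v - mono_poly u' \<in> J"
      using less.hyps[OF _ v] by blast
    have "mono_poly u - mono_poly v \<in> J"
      unfolding u v_def by (rule exchange_relation[OF ab(1-6) r])
    from ideal_poly_add[OF ideal_J this u'(3)] have "mono_poly u - mono_poly u' \<in> J" by simp
    moreover have "mdeg v = mdeg u" by (simp add: u v_def)
    ultimately show ?thesis using u' by auto
  qed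
qed

lemma \<Phi>_eq_if_congruent:
  assumes "mono_poly u - mono_poly v \<in> J"
  shows "\<Phi> u = \<Phi> v"
proof -
  have "(mono_poly u - mono_poly v :: 'k polynomial) \<in> rees_ideal n q f"
    using assms sym_ideal_subset_rees_ideal[where f = f and n = n and q = q, OF f_monomials] J by auto
  then have "Poly_Mapping.single (\<Phi> u) (1::'k) = Poly_Mapping.single (\<Phi> v) 1"
    by (simp add: rees_ideal_def lin_ext_diff lin_ext_mono_poly)
  then show ?thesis by (metis lookup_single_eq lookup_single_not_eq zero_neq_one)
qed

lemma sym_ideal_eq_rees_ideal: "J = rees_ideal n q f"
proof
  show "J \<subseteq> rees_ideal n q f" unfolding J by (rule sym_ideal_subset_rees_ideal[where f = f and n = n and q = q, OF f_monomials])
  show "rees_ideal n q f \<subseteq> J"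
  proof (rule rees_ideal_subset[OF ideal_J])
    fix u v assume uv: "u \<in> monomials V" "v \<in> monomials V" "\<Phi> u = \<Phi> v"
    obtain u' where u': "standard u'" "mono_poly u - mono_poly u' \<in> J" using reduce_to_standard[OF uv(1)] by blast
    obtain v' where v': "standard v'" "mono_poly v - mono_poly v' \<in> J" using reduce_to_standard[OF uv(2)] by blast
    have "u' = v'"
      using \<Phi>_eq_if_congruent u' v' uv(3) by (intro \<Phi>_inj_on_standard) auto
    then show "mono_poly u - mono_poly v \<in> J"
      using ideal_poly_diff[OF ideal_J u'(2) v'(2)] by simp
  qed
qed

text \<open>In each degree the standard monomials meet every fibre of the Rees map exactly once:
  reduction stays inside the fibre and ends at a standard monomial, and standard monomials have
  distinct images.\<close>

lemma hilbert_fun_eq_card_standard: "hilbert_fun V J s = card {u. standard u \<and> mdeg u = s}"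
proof -
  have "hilbert_fun V J s = card (\<Phi> ` {u \<in> monomials V. mdeg u = s})"
    by (rule hilbert_fun_monomial_kernel[OF _ monomial_subst_add monomial_subst_0])
       (simp_all add: sym_ideal_eq_rees_ideal rees_ideal_def)
  also have "\<Phi> ` {u \<in> monomials V. mdeg u = s} = \<Phi> ` {u. standard u \<and> mdeg u = s}"
  proof (intro equalityI subsetI)
    fix w assume "w \<in> \<Phi> ` {u \<in> monomials V. mdeg u = s}"
    then obtain u where u: "u \<in> monomials V" "mdeg u = s" "w = \<Phi> u" by auto
    obtain u' where "standard u'" "mdeg u' = mdeg u" "mono_poly u - mono_poly u' \<in> J" using reduce_to_standard[OF u(1)] by blast
    then show "w \<in> \<Phi> ` {u. standard u \<and> mdeg u = s}"
      using u \<Phi>_eq_if_congruent by auto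
  qed (auto simp: standard_def)
  also have "card \<dots> = card {u. standard u \<and> mdeg u = s}"
    by (rule card_image) (auto simp: inj_on_def intro: \<Phi>_inj_on_standard)
  finally show ?thesis .
qed

end

text \<open>Stanley decomposition: the standard monomials are the disjoint union of the translates by \<open>shift p\<close> of the
  monomials in the \<open>n + 1\<close> variables \<open>free_vars p\<close>. Here \<open>p = (k, b)\<close>, where \<open>k\<close> is the largest \<open>i > d\<close> such that
  \<open>X\<^sub>i\<close> occurs (or \<open>d\<close>, if there is none), and \<open>b\<close> tells whether \<open>T\<^bsub>t0\<^esub>\<close> occurs.\<close>

fun free_vars :: "nat \<times> bool \<Rightarrow> indet set" where
  "free_vars (k, b) = Xvar ` {1..<d - 1} \<union> {if b then Tvar t0 else Xvar (d - 1)} \<union> Xvar ` {d..k} \<union> (Tvar \<circ> t) ` {k..n}"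

fun shift :: "nat \<times> bool \<Rightarrow> monomial" where
  "shift (k, b) = (if d < k then Poly_Mapping.single (Xvar k) 1 else 0) + (if b then Poly_Mapping.single (Tvar t0) 1 else 0)"

definition pieces :: "(nat \<times> bool) set" where
  "pieces = {d..n} \<times> UNIV"

text \<open>Raising k by one adds X_{k+1} and removes T_{t k}, so the size does not depend on the
  piece. It is (d - 2) + 1 + (k + 1 - d) + (n + 1 - k) = n + 1.\<close>

lemma card_free_vars:
  assumes "p \<in> pieces"
  shows "finite (free_vars p)" "card (free_vars p) = n + 1"
proof -
  obtain k b where p: "p = (k, b)" "k \<in> {d..n}" using assms by (auto simp: pieces_def)
  have inj: "inj_on (Tvar \<circ> t) {k..n}"
    using p(2) t_inj by (auto simp: inj_on_def)
  have disj: "Tvar t0 \<notin> (Tvar \<circ> t) ` {k..n}" using t0 p(2) by auto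
  let ?A = "Xvar ` {1..<d - 1}" and ?B = "{if b then Tvar t0 else Xvar (d - 1)}" and ?C = "Xvar ` {d..k}" and ?D = "(Tvar \<circ> t) ` {k..n}"
  have "card (?A \<union> ?B \<union> ?C \<union> ?D) = card (?A \<union> ?B \<union> ?C) + card ?D"
    by (rule card_Un_disjoint) (use disj in auto)
  also have "card (?A \<union> ?B \<union> ?C) = card (?A \<union> ?B) + card ?C"
    by (rule card_Un_disjoint) (use d in auto)
  also have "card (?A \<union> ?B) = card ?A + card ?B"
    by (rule card_Un_disjoint) auto
  also have "card ?D = n + 1 - k" using card_image[OF inj] by simp
  also have "card ?A = d - 2" by (subst card_image) (auto simp: inj_on_def)
  also have "card ?C = k + 1 - d" by (subst card_image) (auto simp: inj_on_def)
  finally show "card (free_vars p) = n + 1" using d p by simp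
  show "finite (free_vars p)" by (simp add: p)
qed

text \<open>If k is the largest index with X_k present, the order condition admits exactly the T_{t
  j} with j >= k. Whether T_{t0} is present decides which of X_{d-1} and T_{t0} may occur.\<close>

lemma standard_iff_piece:
  "standard u \<longleftrightarrow> (\<exists>p\<in>pieces. \<exists>m\<in>monomials (free_vars p). u = shift p + m)"
proof
  assume u: "standard u"
  \<comment> \<open>The default d covers two cases, that no X_i with i >= d occurs and that X_d is
    the last one: X_d restricts no T_{t j}. For this reason \<open>shift\<close> contains X_k only
    when d < k.\<close>
  define k where "k = Max (insert d {i \<in> {d..n}. L u (Xvar i) > 0})"
  define b where "b \<longleftrightarrow> L u (Tvar t0) > 0"
  have fin: "finite (insert d {i \<in> {d..n}. L u (Xvar i) > 0})" by simp
  have k_in: "k \<in> insert d {i \<in> {d..n}. L u (Xvar i) > 0}" unfolding k_def by (rule Max_in[OF fin]) simp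
  have k_ge: "i \<le> k" if "i \<in> {d..n}" "L u (Xvar i) > 0" for i unfolding k_def by (rule Max_ge[OF fin]) (use that in simp)
  have p: "(k, b) \<in> pieces" using k_in d by (auto simp: pieces_def)
  have keys_u: "Poly_Mapping.keys u \<subseteq> free_vars (k, b)"
  proof
    fix x assume x: "x \<in> Poly_Mapping.keys u"
    then have pos: "L u x > 0" by (simp add: in_keys_iff)
    have "x \<in> V" using x standardD(1)[OF u] by (auto simp: monomials_def)
    then consider i where "x = Xvar i" "i \<in> {1..<d - 1}" | "x = Xvar (d - 1)" | i where "x = Xvar i" "i \<in> {d..n}"
      | "x = Tvar t0" | j where "x = Tvar (t j)" "j \<in> {d..n}"
    proof -
      assume a: "\<And>i. x = Xvar i \<Longrightarrow> i \<in> {1..<d - 1} \<Longrightarrow> thesis" "x = Xvar (d - 1) \<Longrightarrow> thesis"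
        "\<And>i. x = Xvar i \<Longrightarrow> i \<in> {d..n} \<Longrightarrow> thesis" "x = Tvar t0 \<Longrightarrow> thesis" "\<And>j. x = Tvar (t j) \<Longrightarrow> j \<in> {d..n} \<Longrightarrow> thesis"
      show thesis
      proof (cases x)
        case (Xvar i)
        then have "i \<in> {1..n}" using \<open>x \<in> V\<close> by (auto simp: XTvars_def)
        then have "i \<in> {1..<d - 1} \<or> i = d - 1 \<or> i \<in> {d..n}" by auto
        then show thesis using a(1-3) Xvar by auto
      next
        case (Tvar i)
        then have "i \<in> {1..q}" using \<open>x \<in> V\<close> by (auto simp: XTvars_def)
        then have "i \<in> insert t0 (t ` {d..n})" unfolding indices .
        then show thesis using a(4,5) Tvar by auto
      qed
    qed
    then show "x \<in> free_vars (k, b)"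
    proof cases
      case 2
      then show ?thesis using standardD(2)[OF u] pos by (auto simp: b_def)
    next
      case (3 i)
      then show ?thesis using k_ge[of i] pos by auto
    next
      case (5 j)
      have "k \<le> j"
        using k_in 5 pos standardD(3)[OF u, of k j] by auto
      then show ?thesis using 5 by auto
    qed (use pos in \<open>auto simp: b_def\<close>)
  qed
  have "u = shift (k, b) + (u - shift (k, b))"
    using k_in by (intro poly_mapping_eqI) (auto simp: lookup_add lookup_minus lookup_single when_def b_def)
  moreover have "u - shift (k, b) \<in> monomials (free_vars (k, b))"
  proof -
    have "Poly_Mapping.keys (u - shift (k, b)) \<subseteq> Poly_Mapping.keys u"
      by (auto simp: in_keys_iff lookup_minus)
    then show ?thesis using keys_u unfolding monomials_def by blast
  qed
  ultimately show "\<exists>p\<in>pieces. \<exists>m\<in>monomials (free_vars p). u = shift p + m" using p by blast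
next
  assume "\<exists>p\<in>pieces. \<exists>m\<in>monomials (free_vars p). u = shift p + m"
  then obtain k b m where k: "k \<in> {d..n}" and m: "m \<in> monomials (free_vars (k, b))" and u: "u = shift (k, b) + m"
    by (auto simp: pieces_def)
  have "shift (k, b) \<in> monomials (free_vars (k, b))" using k by auto
  then have keys: "Poly_Mapping.keys u \<subseteq> free_vars (k, b)" using m u by (auto simp: monomials_def keys_add_nat)
  have pos: "x \<in> free_vars (k, b)" if "L u x > 0" for x
    using subsetD[OF keys, of x] that by (simp only: in_keys_iff)
  have "free_vars (k, b) \<subseteq> V"
  proof -
    have "Xvar ` {1..<d - 1} \<subseteq> V" "Xvar ` {d..k} \<subseteq> V" "Xvar (d - 1) \<in> V"
      using k d by (auto intro!: X_in)
    moreover have "(Tvar \<circ> t) ` {k..n} \<subseteq> V" "Tvar t0 \<in> V"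
      using k t_in t0_in by auto
    ultimately show ?thesis by auto
  qed
  then have "u \<in> monomials V" using keys unfolding monomials_def by blast
  moreover have "L u (Xvar (d - 1)) = 0 \<or> L u (Tvar t0) = 0"
  proof (rule ccontr)
    assume "\<not> ?thesis"
    then have "Xvar (d - 1) \<in> free_vars (k, b)" "Tvar t0 \<in> free_vars (k, b)" using pos by auto
    then show False using k d t0 by (cases b) auto
  qed
  moreover have "\<forall>i\<in>{d..n}. \<forall>j\<in>{d..n}. L u (Xvar i) > 0 \<longrightarrow> L u (Tvar (t j)) > 0 \<longrightarrow> i \<le> j"
  proof (intro ballI impI)
    fix i j assume ij: "i \<in> {d..n}" "j \<in> {d..n}" "L u (Xvar i) > 0" "L u (Tvar (t j)) > 0"
    have "Xvar i \<in> free_vars (k, b)" "Tvar (t j) \<in> free_vars (k, b)" using pos ij by auto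
    then have "i \<le> k" and "t j \<in> t ` {k..n}"
      using ij d t_neq_t0[OF ij(2)] by (auto split: if_splits)
    then obtain x where "x \<in> {k..n}" "t j = t x" by blast
    then have "k \<le> j" using t_eq_iff[OF ij(2), of x] k by auto
    with \<open>i \<le> k\<close> show "i \<le> j" by simp
  qed
  ultimately show "standard u" unfolding standard_def by (intro conjI)
qed

text \<open>The label can be recovered from the monomial. T_{t0} divides it exactly if
  \<open>b\<close> holds; and if k > d, then X_k divides it, so the label k' of any other
  decomposition satisfies k <= k'.\<close>

lemma piece_unique:
  assumes "p \<in> pieces" "p' \<in> pieces" "m \<in> monomials (free_vars p)" "m' \<in> monomials (free_vars p')" "shift p + m = shift p' + m'"
  shows "p = p'"
proof -
  have b: "L (shift (k, b) + m) (Tvar t0) > 0 \<longleftrightarrow> b" if "(k, b) \<in> pieces" "m \<in> monomials (free_vars (k, b))" for k b m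
  proof -
    have "Tvar t0 \<notin> free_vars (k, b)" if "\<not> b" using that t0 \<open>(k, b) \<in> pieces\<close> by (auto simp: pieces_def)
    then have "L m (Tvar t0) = 0" if "\<not> b"
      using monomials_lookup_pos[OF \<open>m \<in> monomials (free_vars (k, b))\<close>, of "Tvar t0"] that by blast
    then show ?thesis by (auto simp: lookup_add lookup_single when_def)
  qed
  have k: "k \<le> k'" if "(k, b) \<in> pieces" "(k', b') \<in> pieces" "m' \<in> monomials (free_vars (k', b'))"
    "shift (k, b) + m = shift (k', b') + m'" for k b k' b' m m'
  proof (rule ccontr)
    assume less: "\<not> k \<le> k'"
    then have "d < k" using that(2) by (auto simp: pieces_def)
    then have "L (shift (k, b) + m) (Xvar k) > 0" by (simp add: lookup_add)
    then have "L m' (Xvar k) > 0"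
      using less unfolding that(4) by (auto simp: lookup_add lookup_single when_def split: if_splits)
    then have "Xvar k \<in> free_vars (k', b')" by (rule monomials_lookup_pos[OF that(3)])
    then show False using less \<open>d < k\<close> by (auto split: if_splits)
  qed
  obtain k b k' b' where p: "p = (k, b)" "p' = (k', b')" by (cases p, cases p') auto
  have "b = b'" using b[of k b m] b[of k' b' m'] assms p by simp
  moreover have "k = k'" using k[of k b k' b' m' m] k[of k' b' k b m m'] assms p by simp
  ultimately show ?thesis using p by simp
qed

lemma card_standard:
  assumes "s \<ge> 2"
  shows "card {u. standard u \<and> mdeg u = s} = (\<Sum>p\<in>pieces. (n + s - mdeg (shift p)) choose n)"
proof -
  let ?M = "\<lambda>p. {m \<in> monomials (free_vars p). mdeg m = s - mdeg (shift p)}"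
  \<comment> \<open>With s >= 2 no subtraction of degrees is truncated.\<close>
  have deg: "mdeg (shift p) \<le> 2" for p by (cases p) auto
  have "card {u. standard u \<and> mdeg u = s} = card (\<Union>p\<in>pieces. (+) (shift p) ` ?M p)"
  proof (rule arg_cong[where f = card], intro equalityI subsetI)
    fix u assume u: "u \<in> {u. standard u \<and> mdeg u = s}"
    then obtain p m where p: "p \<in> pieces" "m \<in> monomials (free_vars p)" "u = shift p + m"
      unfolding standard_iff_piece by blast
    then have "m \<in> ?M p" using u by auto
    then show "u \<in> (\<Union>p\<in>pieces. (+) (shift p) ` ?M p)" using p by blast
  next
    fix u assume "u \<in> (\<Union>p\<in>pieces. (+) (shift p) ` ?M p)"
    then obtain p m where p: "p \<in> pieces" "m \<in> ?M p" "u = shift p + m" by blast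
    then have "mdeg u = s" using deg[of p] assms by simp
    then show "u \<in> {u. standard u \<and> mdeg u = s}" unfolding standard_iff_piece using p by blast
  qed
  also have "\<dots> = (\<Sum>p\<in>pieces. card ((+) (shift p) ` ?M p))"
  proof (rule card_UN_disjoint)
    show "finite pieces" by (simp add: pieces_def)
    show "\<forall>p\<in>pieces. finite ((+) (shift p) ` ?M p)"
      using monomials_of_degree(1) card_free_vars(1) by blast
    show "\<forall>p\<in>pieces. \<forall>p'\<in>pieces. p \<noteq> p' \<longrightarrow> (+) (shift p) ` ?M p \<inter> (+) (shift p') ` ?M p' = {}"
    proof (intro ballI impI)
      fix p p' assume p: "p \<in> pieces" "p' \<in> pieces" "p \<noteq> p'"
      show "(+) (shift p) ` ?M p \<inter> (+) (shift p') ` ?M p' = {}"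
      proof (rule ccontr)
        assume "\<not> ?thesis"
        then obtain m m' where "m \<in> ?M p" "m' \<in> ?M p'" "shift p + m = shift p' + m'" by blast
        then show False using piece_unique[OF p(1,2)] p(3) by auto
      qed
    qed
  qed
  also have "\<dots> = (\<Sum>p\<in>pieces. (n + s - mdeg (shift p)) choose n)"
  proof (rule sum.cong[OF refl])
    fix p assume p: "p \<in> pieces"
    have "card ((+) (shift p) ` ?M p) = card (?M p)" by (rule card_image) simp
    also have "\<dots> = (n + (s - mdeg (shift p))) choose (s - mdeg (shift p))"
      using monomials_of_degree(2)[OF card_free_vars(1)[OF p]] card_free_vars(2)[OF p] by simp
    also have "\<dots> = (n + (s - mdeg (shift p))) choose n"
      by (subst binomial_symmetric) auto
    finally show "card ((+) (shift p) ` ?M p) = (n + s - mdeg (shift p)) choose n"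
      using deg[of p] assms by simp
  qed
  finally show ?thesis .
qed

theorem krull_dim_and_multiplicity:
  shows "krull_dim (poly_ring V Quot (sym_ideal n q f :: 'k::field polynomial set)) = enat (n + 1)"
    and "graded_multiplicity V (sym_ideal n q f :: 'k polynomial set) = 2 * of_nat q - 2"
proof -
  let ?J = "sym_ideal n q f :: 'k polynomial set"
  show dim: "krull_dim (poly_ring V Quot ?J) = enat (n + 1)"
    by (rule krull_dim_sym_algebra[where f = f and n = n and q = q, OF f_monomials sym_ideal_eq_rees_ideal[OF refl]]) (simp_all add: q_eq)
  have "poly.coeff (hilbert_poly V ?J) n = of_nat (card pieces) / fact n"
  proof (rule coeff_hilbert_poly[where s = "\<lambda>p. mdeg (shift p)" and N = 2])
    show "finite pieces" by (simp add: pieces_def)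
    fix s :: nat assume "2 \<le> s"
    then show "hilbert_fun V ?J s = (\<Sum>p\<in>pieces. (n + s - mdeg (shift p)) choose n)"
      by (simp only: hilbert_fun_eq_card_standard[OF refl] card_standard)
  qed
  \<comment> \<open>There are n - d + 1 = q - 1 values of k and two values of b.\<close>
  moreover have "card pieces = 2 * (q - 1)"
    using d by (simp add: pieces_def q_eq card_cartesian_product)
  ultimately show "graded_multiplicity V ?J = 2 * of_nat q - 2"
    unfolding graded_multiplicity_def dim Let_def by (simp add: q_eq)
qed

end

section \<open>Generators of an AUSLI\<close>

text \<open>The polynomials supported on multiples of \<open>M\<close> form an ideal containing
  \<open>M\<close>; conversely, each term of such a polynomial is a multiple of an element of
  \<open>M\<close>.\<close>

lemma mono_ideal_iff:
  assumes "M \<subseteq> monomials (Xvars n)"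
  shows "p \<in> (mono_ideal n M :: 'k::field polynomial set) \<longleftrightarrow>
    Poly_Mapping.keys p \<subseteq> {v \<in> monomials (Xvars n). \<exists>u\<in>M. \<exists>w. v = u + w}"
proof -
  interpret cring "poly_ring (Xvars n) :: 'k polynomial ring" by (rule poly_ring_cring)
  let ?D = "{v \<in> monomials (Xvars n). \<exists>u\<in>M. \<exists>w. v = u + w}"
  let ?I = "{p :: 'k polynomial. Poly_Mapping.keys p \<subseteq> ?D}"
  have D_mult: "Poly_Mapping.keys (r * p) \<subseteq> ?D" if "p \<in> ?I" "Poly_Mapping.keys r \<subseteq> monomials (Xvars n)" for p r :: "'k polynomial"
  proof
    fix v assume "v \<in> Poly_Mapping.keys (r * p)"
    then obtain a b where ab: "a \<in> Poly_Mapping.keys r" "b \<in> Poly_Mapping.keys p" "v = a + b"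
      using keys_mult[of r p] by blast
    then have "b \<in> ?D" using that(1) by blast
    then obtain u w where "u \<in> M" "b = u + w" "b \<in> monomials (Xvars n)" by blast
    then show "v \<in> ?D" using ab that(2) by (auto intro!: bexI[of _ u] exI[of _ "a + w"] simp: ac_simps)
  qed
  have "ideal ?I (poly_ring (Xvars n))"
  proof (rule idealI)
    show "subgroup ?I (add_monoid (poly_ring (Xvars n)))"
    proof (rule add.subgroupI)
      fix a b assume "a \<in> ?I" "b \<in> ?I"
      then show "a \<oplus>\<^bsub>poly_ring (Xvars n)\<^esub> b \<in> ?I" using keys_add[of a b] by auto
    next
      fix a assume a: "a \<in> ?I"
      then have "Poly_Mapping.keys a \<subseteq> monomials (Xvars n)" by auto
      then show "\<ominus>\<^bsub>poly_ring (Xvars n)\<^esub> a \<in> ?I" using a D_mult[of a "- 1"] by (simp add: poly_ring_a_inv)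
    qed (auto intro: exI[of _ 0])
  qed (use D_mult in \<open>auto simp: poly_ring_ring mult.commute\<close>)
  moreover have "mono_poly ` M \<subseteq> ?I"
  proof -
    have "u \<in> ?D" if "u \<in> M" for u using that assms by (auto intro!: bexI[OF _ that] exI[of _ 0])
    then show ?thesis by auto
  qed
  ultimately have "mono_ideal n M \<subseteq> ?I"
    unfolding mono_ideal_def by (rule genideal_minimal)
  moreover have "?I \<subseteq> (mono_ideal n M :: 'k polynomial set)"
  proof
    fix p assume p: "p \<in> ?I"
    have carr: "mono_poly ` M \<subseteq> carrier (poly_ring (Xvars n) :: 'k polynomial ring)" using assms by auto
    have id: "ideal (mono_ideal n M :: 'k polynomial set) (poly_ring (Xvars n))"
      unfolding mono_ideal_def by (rule genideal_ideal[OF carr])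
    have "Poly_Mapping.single v (Poly_Mapping.lookup p v) \<in> mono_ideal n M" if "v \<in> Poly_Mapping.keys p" for v
    proof -
      have "v \<in> ?D" using p that by blast
      then obtain u w where u: "u \<in> M" "v = u + w" "v \<in> monomials (Xvars n)" by blast
      have "mono_poly u \<in> (mono_ideal n M :: 'k polynomial set)"
        unfolding mono_ideal_def using genideal_self[OF carr] u(1) by blast
      then have "Poly_Mapping.single w (Poly_Mapping.lookup p v) * mono_poly u \<in> mono_ideal n M"
        by (rule ideal_poly_mult[OF id]) (use u in auto)
      then show ?thesis using u(2) by (simp add: mono_poly_def mult_single add.commute)
    qed
    then have "(\<Sum>v\<in>Poly_Mapping.keys p. Poly_Mapping.single v (Poly_Mapping.lookup p v)) \<in> mono_ideal n M"
      by (rule ideal_poly_sum[OF id])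
    then show "p \<in> mono_ideal n M"
      using poly_mapping_sum_single[of "Poly_Mapping.keys p" p] by simp
  qed
  ultimately show ?thesis by blast
qed

lemma mono_poly_in_mono_ideal_iff:
  assumes "M \<subseteq> monomials (Xvars n)"
  shows "mono_poly v \<in> (mono_ideal n M :: 'k::field polynomial set) \<longleftrightarrow> v \<in> monomials (Xvars n) \<and> (\<exists>u\<in>M. \<exists>w. v = u + w)"
  using mono_ideal_iff[OF assms, of "mono_poly v :: 'k polynomial"] by simp

lemma mono_poly_in_mono_ideal:
  assumes "M \<subseteq> monomials (Xvars n)" "u \<in> M"
  shows "mono_poly u \<in> (mono_ideal n M :: 'k::field polynomial set)"
  unfolding mono_poly_in_mono_ideal_iff[OF assms(1)] using assms by (auto intro!: bexI[OF _ assms(2)] exI[of _ 0])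

lemma monomials_Xvars_mono: "n \<le> N \<Longrightarrow> monomials (Xvars n) \<subseteq> monomials (Xvars N)"
  by (rule monomials_mono) (auto simp: Xvars_def)

text \<open>The condition for an USLI thus concerns one and the same set of monomials in larger and
  larger rings.\<close>

lemma extend_mono_ideal:
  assumes M: "M \<subseteq> monomials (Xvars n)"
  shows "Idl\<^bsub>poly_ring (Xvars (n + m))\<^esub> (mono_ideal n M) = (mono_ideal (n + m) M :: 'k::field polynomial set)"
proof -
  interpret cring "poly_ring (Xvars (n + m)) :: 'k polynomial ring" by (rule poly_ring_cring)
  have mm: "monomials (Xvars n) \<subseteq> monomials (Xvars (n + m))" by (rule monomials_Xvars_mono) simp
  have M': "M \<subseteq> monomials (Xvars (n + m))" using M mm by blast
  have carr: "mono_poly ` M \<subseteq> carrier (poly_ring (Xvars (n + m)) :: 'k polynomial ring)" using M' by auto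
  have sub: "(mono_ideal n M :: 'k polynomial set) \<subseteq> mono_ideal (n + m) M"
    unfolding subset_iff mono_ideal_iff[OF M] mono_ideal_iff[OF M'] using mm by blast
  have sub2: "mono_poly ` M \<subseteq> (mono_ideal n M :: 'k polynomial set)"
    using mono_poly_in_mono_ideal[OF M] by blast
  have carr2: "(mono_ideal n M :: 'k polynomial set) \<subseteq> carrier (poly_ring (Xvars (n + m)))"
    unfolding subset_iff mono_ideal_iff[OF M] using mm by auto
  show ?thesis
  proof
    show "Idl\<^bsub>poly_ring (Xvars (n + m))\<^esub> (mono_ideal n M) \<subseteq> (mono_ideal (n + m) M :: 'k polynomial set)"
      using genideal_minimal[OF _ sub] genideal_ideal[OF carr] by (simp add: mono_ideal_def)
    show "(mono_ideal (n + m) M :: 'k polynomial set) \<subseteq> Idl\<^bsub>poly_ring (Xvars (n + m))\<^esub> (mono_ideal n M)"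
      unfolding mono_ideal_def[of "n + m"]
      using genideal_minimal[OF genideal_ideal[OF carr2]] sub2 genideal_self[OF carr2] by blast
  qed
qed

lemma add_eq_0_monomial: "u + v = (0 :: monomial) \<Longrightarrow> v = 0"
  by (metis add_eq_0_iff_both_eq_0 lookup_add lookup_zero poly_mapping_eqI)

text \<open>A minimal subset exists because \<open>M\<close> is finite. For uniqueness, an element u
  of one minimal set is a multiple of some u' in the other, which in turn is a multiple of some u''
  in the first; if u'' differed from u, then u could be dropped, so u'' = u = u'.\<close>

lemma min_gens:
  fixes I :: "'k::field polynomial set"
  assumes "M \<subseteq> monomials (Xvars n)" "finite M" "I = mono_ideal n M"
  shows "min_gens n I \<subseteq> monomials (Xvars n)" "mono_ideal n (min_gens n I) = I"
proof -
  let ?P = "\<lambda>G. G \<subseteq> monomials (Xvars n) \<and> mono_ideal n G = I \<and> (\<forall>H. H \<subset> G \<longrightarrow> mono_ideal n H \<noteq> I)"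
  have "\<exists>G. ?P G"
  proof -
    let ?S = "{G. G \<subseteq> M \<and> mono_ideal n G = I}"
    have "finite ?S" using assms(2) by simp
    moreover have "M \<in> ?S" using assms(3) by simp
    ultimately obtain G where G: "G \<in> ?S" "\<forall>H\<in>?S. H \<subseteq> G \<longrightarrow> G = H"
      using finite_has_minimal[of ?S] by blast
    then have "?P G" using assms(1) by blast
    then show ?thesis by blast
  qed
  moreover have sub: "G \<subseteq> G'" if G: "?P G" and G': "?P G'" for G G'
  proof
    fix u assume u: "u \<in> G"
    have GM: "G \<subseteq> monomials (Xvars n)" and GM': "G' \<subseteq> monomials (Xvars n)" using G G' by auto
    have "mono_poly u \<in> I" using G mono_poly_in_mono_ideal[OF GM u, where 'k = 'k] by simp
    then obtain u' w' where u': "u' \<in> G'" "u = u' + w'"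
      using G' mono_poly_in_mono_ideal_iff[OF GM', of u, where 'k = 'k] by auto
    have "mono_poly u' \<in> I" using G' mono_poly_in_mono_ideal[OF GM' u'(1), where 'k = 'k] by simp
    then obtain u'' w'' where u'': "u'' \<in> G" "u' = u'' + w''"
      using G mono_poly_in_mono_ideal_iff[OF GM, of u', where 'k = 'k] by auto
    have "u'' = u"
    proof (rule ccontr)
      assume neq: "u'' \<noteq> u"
      have HM: "G - {u} \<subseteq> monomials (Xvars n)" using GM by auto
      have "(\<exists>x\<in>G - {u}. \<exists>w. v = x + w) \<longleftrightarrow> (\<exists>x\<in>G. \<exists>w. v = x + w)" for v
      proof
        assume "\<exists>x\<in>G. \<exists>w. v = x + w"
        then obtain x w where x: "x \<in> G" "v = x + w" by blast
        show "\<exists>x\<in>G - {u}. \<exists>w. v = x + w"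
        proof (cases "x = u")
          case True
          then have "v = u'' + (w'' + w' + w)" using x u' u'' by (simp add: add.assoc)
          then show ?thesis using u'' neq by blast
        qed (use x in blast)
      qed blast
      then have "(mono_ideal n (G - {u}) :: 'k polynomial set) = mono_ideal n G"
        by (intro Set.set_eqI) (simp add: mono_ideal_iff[OF HM] mono_ideal_iff[OF GM])
      then show False using G u by blast
    qed
    then have "u + (w'' + w') = u + 0" using u' u'' by (simp add: add.assoc)
    then have "w'' + w' = 0" by (simp only: add_left_cancel)
    then have "w' = 0" by (rule add_eq_0_monomial)
    then show "u \<in> G'" using u' by simp
  qed
  ultimately have "\<exists>!G. ?P G" by (intro ex_ex1I) (auto intro!: equalityI)
  then have "?P (min_gens n I)" unfolding min_gens_def by (rule theI')
  then show "min_gens n I \<subseteq> monomials (Xvars n)" "mono_ideal n (min_gens n I) = I" by auto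
qed

section \<open>Squarefree monomials as index sets\<close>

lemma sqfree_monomials_eq: "sqfree_monomials n = sqfree_monomial ` Pow {1..n}"
proof (intro equalityI subsetI)
  fix u assume u: "u \<in> sqfree_monomials n"
  let ?A = "{i. Xvar i \<in> Poly_Mapping.keys u}"
  have A: "?A \<subseteq> {1..n}" using u by (auto simp: sqfree_monomials_def monomials_def Xvars_def)
  then have fin: "finite ?A" using finite_subset by blast
  have "u = sqfree_monomial ?A"
  proof (rule poly_mapping_eqI)
    fix x
    have "Poly_Mapping.lookup u x \<le> 1" using u by (auto simp: sqfree_monomials_def)
    moreover have "Poly_Mapping.lookup u (Tvar i) = 0" for i
      using u by (auto simp: sqfree_monomials_def monomials_def Xvars_def in_keys_iff)
    moreover have "Poly_Mapping.lookup (sqfree_monomial ?A) (Xvar i) = (if Poly_Mapping.lookup u (Xvar i) = 0 then 0 else 1)" for i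
      using lookup_sqfree_monomial(1)[OF fin, of i] not_in_keys_iff_lookup_eq_zero[of "Xvar i" u] by auto
    moreover note lookup_sqfree_monomial(2)[OF fin]
    ultimately show "Poly_Mapping.lookup u x = Poly_Mapping.lookup (sqfree_monomial ?A) x"
      by (cases x) auto
  qed
  then show "u \<in> sqfree_monomial ` Pow {1..n}" using A by blast
next
  fix u assume "u \<in> sqfree_monomial ` Pow {1..n}"
  then obtain A where A: "A \<subseteq> {1..n}" "u = sqfree_monomial A" by auto
  then have fin: "finite A" using finite_subset by blast
  have "Poly_Mapping.lookup u x \<le> 1" for x
    by (cases x) (auto simp: A(2) lookup_sqfree_monomial[OF fin])
  then show "u \<in> sqfree_monomials n"
    using A by (auto simp: sqfree_monomials_def monomials_def keys_sqfree_monomial[OF fin] Xvars_def)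
qed

lemma mdeg_sqfree_monomial: "finite A \<Longrightarrow> mdeg (sqfree_monomial A) = card A"
  by (simp add: mdeg_def keys_sqfree_monomial sum.reindex inj_on_def lookup_sqfree_monomial)

lemma index_list_sqfree_monomial: "finite A \<Longrightarrow> index_list (sqfree_monomial A) = sorted_list_of_set A"
  by (simp add: index_list_def keys_sqfree_monomial image_iff)

lemma sqfree_monomial_dvd_iff:
  assumes "finite A" "finite B"
  shows "(\<exists>w. sqfree_monomial B = sqfree_monomial A + w) \<longleftrightarrow> A \<subseteq> B"
proof
  assume "\<exists>w. sqfree_monomial B = sqfree_monomial A + w"
  then obtain w where "sqfree_monomial B = sqfree_monomial A + w" by blast
  then have "Poly_Mapping.keys (sqfree_monomial A) \<subseteq> Poly_Mapping.keys (sqfree_monomial B)"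
    by (simp add: keys_add_nat)
  then show "A \<subseteq> B" by (auto simp: keys_sqfree_monomial assms)
next
  assume "A \<subseteq> B"
  then have "sqfree_monomial B = sqfree_monomial A + sqfree_monomial (B - A)"
    unfolding sqfree_monomial_def using assms by (metis add.commute sum.subset_diff)
  then show "\<exists>w. sqfree_monomial B = sqfree_monomial A + w" by blast
qed

lemma sqfree_monomial_inject:
  assumes "finite A" "finite B"
  shows "sqfree_monomial A = sqfree_monomial B \<longleftrightarrow> A = B"
  using sqfree_monomial_dvd_iff[OF assms] sqfree_monomial_dvd_iff[OF assms(2,1)]
  by (metis add.right_neutral subset_antisym)

text \<open>The first position at which the sorted lists differ corresponds to the least element of
  the symmetric difference, and the larger monomial is the one whose set contains that
  element.\<close>

lemma slex_gt_sqfree_monomial_iff: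
  assumes fin: "finite A" "finite B"
  shows "slex_gt (sqfree_monomial A) (sqfree_monomial B) \<longleftrightarrow>
    card A = card B \<and> (\<exists>x\<in>A - B. \<forall>y<x. y \<in> A \<longleftrightarrow> y \<in> B)"
proof -
  define xs ys where "xs = sorted_list_of_set A" and "ys = sorted_list_of_set B"
  have set: "set xs = A" "set ys = B" and len: "length xs = card A" "length ys = card B"
    using fin by (auto simp: xs_def ys_def)
  have xs_less: "xs ! i < xs ! j \<longleftrightarrow> i < j" if "i < length xs" "j < length xs" for i j
    using strict_sorted_list_of_set[of A] that unfolding xs_def[symmetric]
    by (metis linorder_neqE_nat order.asym order.irrefl sorted_wrt_nth_less)
  have ys_less: "ys ! i < ys ! j \<longleftrightarrow> i < j" if "i < length ys" "j < length ys" for i j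
    using strict_sorted_list_of_set[of B] that unfolding ys_def[symmetric]
    by (metis linorder_neqE_nat order.asym order.irrefl sorted_wrt_nth_less)
  have "(\<exists>s<card A. (\<forall>r<s. xs ! r = ys ! r) \<and> xs ! s < ys ! s) \<longleftrightarrow> (\<exists>x\<in>A - B. \<forall>y<x. y \<in> A \<longleftrightarrow> y \<in> B)"
    if card: "card A = card B"
  proof
    assume "\<exists>s<card A. (\<forall>r<s. xs ! r = ys ! r) \<and> xs ! s < ys ! s"
    then obtain s where s: "s < card A" "\<And>r. r < s \<Longrightarrow> xs ! r = ys ! r" "xs ! s < ys ! s" by blast
    have "xs ! s \<in> A" using s(1) len set by (metis nth_mem)
    moreover have "xs ! s \<notin> B"
    proof
      assume "xs ! s \<in> B"
      then obtain r where r: "r < length ys" "ys ! r = xs ! s" unfolding set(2)[symmetric] in_set_conv_nth by blast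
      then have "r < s" using ys_less[of r s] s card len by auto
      then show False using s(2)[of r] r xs_less[of r s] s(1) len by auto
    qed
    moreover have "y \<in> A \<longleftrightarrow> y \<in> B" if y: "y < xs ! s" for y
    proof
      assume "y \<in> A"
      then obtain r where r: "r < length xs" "xs ! r = y" unfolding set(1)[symmetric] in_set_conv_nth by blast
      then have "r < s" using xs_less[of r s] s(1) len y by auto
      then show "y \<in> B" using s(2)[of r] r set(2) len card by (metis nth_mem)
    next
      assume "y \<in> B"
      then obtain r where r: "r < length ys" "ys ! r = y" unfolding set(2)[symmetric] in_set_conv_nth by blast
      then have "r < s" using ys_less[of r s] s len card y by auto
      then show "y \<in> A" using s(2)[of r] r set(1) len card by (metis nth_mem)
    qed
    ultimately show "\<exists>x\<in>A - B. \<forall>y<x. y \<in> A \<longleftrightarrow> y \<in> B" by blast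
  next
    assume "\<exists>x\<in>A - B. \<forall>y<x. y \<in> A \<longleftrightarrow> y \<in> B"
    then obtain x where x: "x \<in> A" "x \<notin> B" "\<And>y. y < x \<Longrightarrow> y \<in> A \<longleftrightarrow> y \<in> B" by blast
    \<comment> \<open>The common part below the first difference. Both sorted lists begin with it,
      so they part at position \<open>card P\<close>.\<close>
    define P where "P = {y \<in> A. y < x}"
    have P: "P = {y \<in> B. y < x}" "finite P" "P \<subseteq> A" "P \<subseteq> B" using x fin by (auto simp: P_def)
    have split: "sorted_list_of_set C = sorted_list_of_set P @ sorted_list_of_set (C - P)"
      if "finite C" "P = {y \<in> C. y < x}" for C
      by (rule sorted_list_of_set_unique[THEN iffD1])
         (use that P(2) in \<open>auto simp: sorted_wrt_append strict_sorted_list_of_set card_Diff_subset card_mono\<close>)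
    have "Min (A - P) = x" using x fin by (intro Min_eqI) (auto simp: P_def)
    then have xs: "xs ! card P = x"
      unfolding xs_def split[OF fin(1) P_def]
      using x(1) fin by (subst sorted_list_of_set_nonempty[of "A - P"]) (auto simp: nth_append P_def)
    have "card P < card A" using x(1) fin by (intro psubset_card_mono) (auto simp: P_def)
    then have "B - P \<noteq> {}" using P card fin by (metis Diff_eq_empty_iff card_mono leD)
    then have "ys ! card P = Min (B - P)"
      unfolding ys_def split[OF fin(2) P(1)]
      using fin by (subst sorted_list_of_set_nonempty[of "B - P"]) (auto simp: nth_append)
    moreover have "Min (B - P) \<in> B - P" using \<open>B - P \<noteq> {}\<close> fin by (intro Min_in) auto
    moreover have "x < y" if "y \<in> B - P" for y
      using that x(2) P(1) by (metis (mono_tags, lifting) DiffD1 DiffD2 linorder_neqE_nat mem_Collect_eq)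
    ultimately have "xs ! card P < ys ! card P" using xs by simp
    moreover have "xs ! r = ys ! r" if "r < card P" for r
      unfolding xs_def ys_def split[OF fin(1) P_def] split[OF fin(2) P(1)] using that by (simp add: nth_append)
    ultimately show "\<exists>s<card A. (\<forall>r<s. xs ! r = ys ! r) \<and> xs ! s < ys ! s"
      using \<open>card P < card A\<close> by blast
  qed
  then show ?thesis
    unfolding slex_gt_def mdeg_sqfree_monomial[OF fin(1)] mdeg_sqfree_monomial[OF fin(2)]
      index_list_sqfree_monomial[OF fin(1)] index_list_sqfree_monomial[OF fin(2)] xs_def[symmetric] ys_def[symmetric]
    by blast
qed

lemma mono_poly_sqfree_in_mono_ideal_iff:
  assumes "\<And>A. A \<in> \<A> \<Longrightarrow> A \<subseteq> {1..n}" "finite B"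
  shows "mono_poly (sqfree_monomial B) \<in> (mono_ideal n (sqfree_monomial ` \<A>) :: 'k::field polynomial set)
    \<longleftrightarrow> B \<subseteq> {1..n} \<and> (\<exists>A\<in>\<A>. A \<subseteq> B)"
proof -
  have fin: "finite A" if "A \<in> \<A>" for A using assms(1)[OF that] finite_subset by blast
  have mon: "sqfree_monomial C \<in> monomials (Xvars n) \<longleftrightarrow> C \<subseteq> {1..n}" if "finite C" for C
    by (auto simp: monomials_def keys_sqfree_monomial[OF that] Xvars_def)
  have "sqfree_monomial ` \<A> \<subseteq> monomials (Xvars n)" using assms(1) mon fin by blast
  then show ?thesis
    using sqfree_monomial_dvd_iff[OF fin assms(2)] mon[OF assms(2)]
    by (simp add: mono_poly_in_mono_ideal_iff)
qed

text \<open>The lexsegment condition in terms of index sets. Properness becomes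
  \<open>{} \<notin> \<A>\<close>, since the empty set stands for the monomial 1.\<close>

lemma sqfree_lex_ideal_iff:
  assumes \<A>: "\<And>A. A \<in> \<A> \<Longrightarrow> A \<subseteq> {1..n}"
  shows "sqfree_lex_ideal n (mono_ideal n (sqfree_monomial ` \<A>) :: 'k::field polynomial set) \<longleftrightarrow>
    {} \<notin> \<A> \<and> (\<forall>B C. B \<subseteq> {1..n} \<longrightarrow> C \<subseteq> {1..n} \<longrightarrow> slex_gt (sqfree_monomial C) (sqfree_monomial B) \<longrightarrow>
       (\<exists>A\<in>\<A>. A \<subseteq> B) \<longrightarrow> (\<exists>A\<in>\<A>. A \<subseteq> C))" (is "?L \<longleftrightarrow> ?R")
proof -
  let ?I = "mono_ideal n (sqfree_monomial ` \<A>) :: 'k polynomial set"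
  have fin: "finite C" if "C \<subseteq> {1..n}" for C :: "nat set" using that finite_subset by blast
  note mem = mono_poly_sqfree_in_mono_ideal_iff[OF \<A>, where 'k = 'k]
  have M: "sqfree_monomial ` \<A> \<subseteq> sqfree_monomials n" unfolding sqfree_monomials_eq using \<A> by blast
  then have mon: "sqfree_monomial ` \<A> \<subseteq> monomials (Xvars n)" by (auto simp: sqfree_monomials_def)
  interpret I: ideal ?I "poly_ring (Xvars n)"
    unfolding mono_ideal_def by (rule ring.genideal_ideal[OF poly_ring_ring]) (use mon in auto)
  have one: "?I = carrier (poly_ring (Xvars n)) \<longleftrightarrow> {} \<in> \<A>"
  proof -
    have "?I = carrier (poly_ring (Xvars n)) \<longleftrightarrow> (1 :: 'k polynomial) \<in> ?I"
      using I.one_imp_carrier by auto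
    also have "(1 :: 'k polynomial) = mono_poly (sqfree_monomial {})" by (simp add: sqfree_monomial_def)
    finally show ?thesis by (simp add: mem)
  qed
  have deg: "mdeg u = mdeg v" if "slex_gt v u" for u v using that by (simp add: slex_gt_def)
  have "?L \<longleftrightarrow> {} \<notin> \<A> \<and> (\<forall>B\<in>Pow {1..n}. \<forall>C\<in>Pow {1..n}. mono_poly (sqfree_monomial B) \<in> ?I \<longrightarrow>
      slex_gt (sqfree_monomial C) (sqfree_monomial B) \<longrightarrow> mono_poly (sqfree_monomial C) \<in> ?I)"
    unfolding sqfree_lex_ideal_def one using M deg by (simp only: sqfree_monomials_eq) blast
  also have "\<dots> \<longleftrightarrow> ?R"
  proof -
    have "mono_poly (sqfree_monomial B) \<in> ?I \<longleftrightarrow> (\<exists>A\<in>\<A>. A \<subseteq> B)" if "B \<in> Pow {1..n}" for B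
      using mem[OF _ fin[of B]] that by simp
    then show ?thesis by (simp cong: ball_cong_simp) blast
  qed
  finally show ?thesis .
qed

section \<open>Determination of the generators of an AUSLI\<close>

text \<open>In terms of index sets, all generators but the last contain {1..d-1}. The last one
  cannot, or the whole ideal would be an USLI. Being a lexsegment, the set of generators then
  contains every {1..d-1,j}, and the last generator must be the slex-largest d-set that does not
  contain {1..d-1}.\<close>

lemma ausli_min_gens:
  fixes I :: "'k::field polynomial set"
  assumes "ausli n d I"
  shows "2 \<le> d" "d < n"
    and "min_gens n I = insert (sqfree_monomial ({1..d+1} - {d-1})) ((\<lambda>j. sqfree_monomial (insert j {1..<d})) ` {d..n})"
proof -
  define G where "G = min_gens n I"
  from assms have lex: "sqfree_lex_ideal n I" and not_usli: "\<not> usli n I" and d1: "d \<ge> 1"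
    and deg: "\<And>u. u \<in> G \<Longrightarrow> mdeg u = d"
    by (auto simp: ausli_def generated_in_degree_def G_def)
  from assms obtain us u where us: "G = set (us @ [u])" "sorted_wrt slex_gt (us @ [u])"
    "usli n (mono_ideal n (set us) :: 'k polynomial set)"
    by (auto simp: ausli_def G_def)
  from lex obtain M where M: "M \<subseteq> sqfree_monomials n" "I = mono_ideal n M" by (auto simp: sqfree_lex_ideal_def)
  have M_mon: "M \<subseteq> monomials (Xvars n)" using M(1) by (auto simp: sqfree_monomials_def)
  have "finite M" using M(1) by (rule finite_subset) (simp add: sqfree_monomials_eq)
  note G_mon = min_gens(1)[OF M_mon this M(2), folded G_def] and G_gen = min_gens(2)[OF M_mon this M(2), folded G_def]
  have mdeg_0: "x = 0" if "mdeg x = 0" for x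
    using that by (intro poly_mapping_eqI) (auto simp: mdeg_def in_keys_iff)
  \<comment> \<open>A minimal generator is a multiple of an element of \<open>M\<close>, which is a
    multiple of a minimal generator; both minimal generators have degree d, so all three coincide.
    Hence the minimal generators are squarefree.\<close>
  have "G \<subseteq> M"
  proof
    fix v assume v: "v \<in> G"
    have "mono_poly v \<in> (mono_ideal n G :: 'k polynomial set)"
      by (rule mono_poly_in_mono_ideal[OF G_mon v])
    then obtain w x where w: "w \<in> M" "v = w + x"
      using mono_poly_in_mono_ideal_iff[OF M_mon, of v, where 'k = 'k] G_gen M(2) by auto
    have "mono_poly w \<in> (mono_ideal n M :: 'k polynomial set)"
      by (rule mono_poly_in_mono_ideal[OF M_mon w(1)])
    then obtain v' y where v': "v' \<in> G" "w = v' + y"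
      using mono_poly_in_mono_ideal_iff[OF G_mon, of w, where 'k = 'k] G_gen M(2) by auto
    have "mdeg x = 0" using deg[OF v] deg[OF v'(1)] w v' by simp
    then show "v \<in> M" using w mdeg_0[of x] by simp
  qed
  then have "G \<subseteq> sqfree_monomial ` Pow {1..n}" using M(1) sqfree_monomials_eq by blast
  define \<G> where "\<G> = {A. A \<subseteq> {1..n} \<and> sqfree_monomial A \<in> G}"
  have G_eq: "G = sqfree_monomial ` \<G>" using \<open>G \<subseteq> sqfree_monomial ` Pow {1..n}\<close> by (auto simp: \<G>_def)
  have fin: "finite A" if "A \<subseteq> {1..N}" for A :: "nat set" and N using that finite_subset by blast
  have \<G>: "A \<subseteq> {1..n}" "finite A" "card A = d" if "A \<in> \<G>" for A
    using that deg[of "sqfree_monomial A"] mdeg_sqfree_monomial[of A] fin by (auto simp: \<G>_def)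
  have lex_\<G>: "sqfree_lex_ideal n (mono_ideal n (sqfree_monomial ` \<G>) :: 'k polynomial set)"
    using lex G_gen G_eq by simp
  \<comment> \<open>Among sets of size d, containing a generator means being one, so the lexsegment
    condition makes the generators an initial segment.\<close>
  have initial: "B \<in> \<G>" if prems: "A \<in> \<G>" "B \<subseteq> {1..n}" "card B = d" "x \<in> B - A" "\<And>y. y < x \<Longrightarrow> y \<in> B \<longleftrightarrow> y \<in> A" for A B x
  proof -
    have "slex_gt (sqfree_monomial B) (sqfree_monomial A)"
      using slex_gt_sqfree_monomial_iff[OF fin[OF prems(2)] \<G>(2)[OF prems(1)]] prems \<G>(3) by auto
    then obtain A' where "A' \<in> \<G>" "A' \<subseteq> B"
      using iffD1[OF sqfree_lex_ideal_iff[where \<A> = \<G> and n = n, OF \<G>(1)] lex_\<G>] prems(1,2) \<G>(1)[OF prems(1)]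
      by blast
    moreover have "A' = B" using calculation \<G>(3) prems(3) fin[OF prems(2)] by (metis card_subset_eq)
    ultimately show ?thesis by simp
  qed
  obtain C where C: "C \<in> \<G>" "u = sqfree_monomial C" using us(1) G_eq by auto
  define \<U> where "\<U> = \<G> - {C}"
  have "u \<notin> set us"
  proof
    assume "u \<in> set us"
    then have "slex_gt u u" using us(2) by (auto simp: sorted_wrt_append)
    then show False by (auto simp: slex_gt_def)
  qed
  have inj: "sqfree_monomial A = sqfree_monomial B \<longleftrightarrow> A = B" if "A \<in> \<G>" "B \<in> \<G>" for A B
    using sqfree_monomial_inject \<G>(2) that by blast
  have U_eq: "set us = sqfree_monomial ` \<U>"
  proof -
    have "set us = G - {u}" using us(1) \<open>u \<notin> set us\<close> by auto
    then show ?thesis using inj C by (auto simp: \<U>_def G_eq)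
  qed
  have U_mon: "set us \<subseteq> monomials (Xvars n)" using us(1) G_mon by auto
  \<comment> \<open>The same for the generators other than the last, with \<open>m\<close>
    additional variables allowed.\<close>
  have initial_\<U>: "B \<in> \<U>" if prems: "A \<in> \<U>" "m \<ge> 1" "B \<subseteq> {1..n + m}" "card B = d" "x \<in> B - A" "\<And>y. y < x \<Longrightarrow> y \<in> B \<longleftrightarrow> y \<in> A" for A B x m
  proof -
    have A: "A \<in> \<G>" using prems by (simp add: \<U>_def)
    have sub: "A' \<subseteq> {1..n + m}" if "A' \<in> \<U>" for A' using \<G>(1)[of A'] that by (fastforce simp: \<U>_def)
    have "sqfree_lex_ideal (n + m) (mono_ideal (n + m) (sqfree_monomial ` \<U>) :: 'k polynomial set)"
    proof -
      have "sqfree_lex_ideal (n + m) (Idl\<^bsub>poly_ring (Xvars (n + m))\<^esub> (mono_ideal n (set us) :: 'k polynomial set))"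
        using us(3) prems(2) unfolding usli_def by blast
      then show ?thesis by (simp only: extend_mono_ideal[OF U_mon[unfolded U_eq]] U_eq)
    qed
    moreover have "slex_gt (sqfree_monomial B) (sqfree_monomial A)"
      using slex_gt_sqfree_monomial_iff[OF fin[OF prems(3)] \<G>(2)[OF A]] prems \<G>(3)[OF A] by auto
    ultimately obtain A' where "A' \<in> \<U>" "A' \<subseteq> B"
      using sqfree_lex_ideal_iff[where \<A> = \<U> and n = "n + m" and 'k = 'k, OF sub] prems(1,3) sub[OF prems(1)] by blast
    moreover have "A' = B" using calculation \<G>(3)[of A'] prems(4) fin[OF prems(3)] by (metis DiffD1 \<U>_def card_subset_eq)
    ultimately show ?thesis by simp
  qed
  have d_le: "d \<le> n" using \<G>(1,3)[OF C(1)] by (metis card_atLeastAtMost card_mono diff_Suc_1 finite_atLeastAtMost)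
  have least: "\<exists>x\<in>{1..<d} - A. \<forall>y\<in>{1..<x}. y \<in> A" if "\<not> {1..<d} \<subseteq> A" for A
  proof -
    define x where "x = (LEAST x. x \<in> {1..<d} - A)"
    have "\<exists>x. x \<in> {1..<d} - A" using that by blast
    then have x: "x \<in> {1..<d} - A" unfolding x_def by (rule LeastI_ex)
    moreover have "y \<in> A" if "y \<in> {1..<x}" for y
      using not_less_Least[of y "\<lambda>x. x \<in> {1..<d} - A"] that x by (auto simp: x_def)
    ultimately show ?thesis by blast
  qed
  have U_sub: "{1..<d} \<subseteq> A" if A: "A \<in> \<U>" for A
  proof (rule ccontr)
    assume "\<not> ?thesis"
    then obtain x where x: "x \<in> {1..<d} - A" "\<forall>y\<in>{1..<x}. y \<in> A" using least by blast
    have "A \<subseteq> {1..n}" using A \<G>(1) by (simp add: \<U>_def)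
    \<comment> \<open>One new variable is enough: at the first index below d missing from
      \<open>A\<close>, this set is slex-larger than \<open>A\<close>, yet it leaves {1..n}.\<close>
    have "insert (n + 1) {1..<d} \<in> \<U>"
    proof (rule initial_\<U>[OF A, of 1 _ x])
      show "card (insert (n + 1) {1..<d}) = d" using d_le d1 by simp
      fix y assume "y < x"
      then show "y \<in> insert (n + 1) {1..<d} \<longleftrightarrow> y \<in> A"
        using x d_le \<open>A \<subseteq> {1..n}\<close> by fastforce
    qed (use x d_le in auto)
    then show False using \<G>(1)[of "insert (n + 1) {1..<d}"] by (auto simp: \<U>_def)
  qed
  have shape: "\<exists>j\<in>{d..n}. A = insert j {1..<d}" if A: "A \<in> \<G>" "{1..<d} \<subseteq> A" for A
  proof -
    have "card (A - {1..<d}) = 1" using \<G>(3)[OF A(1)] A(2) d1 by (simp add: card_Diff_subset)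
    then obtain j where j: "A - {1..<d} = {j}" by (auto simp: card_1_singleton_iff)
    then have "A = insert j {1..<d}" using A(2) by blast
    moreover have "j \<in> {d..n}" using j \<G>(1)[OF A(1)] by fastforce
    ultimately show ?thesis by blast
  qed
  \<comment> \<open>Otherwise every generator is some {1..d-1,j}, and the values of j form an
    initial segment of {d..n}. This makes the ideal a lexsegment ideal in every larger ring, so that
    \<open>I\<close> would be an USLI.\<close>
  have C_not: "\<not> {1..<d} \<subseteq> C"
  proof
    assume "{1..<d} \<subseteq> C"
    then have all: "{1..<d} \<subseteq> A" if "A \<in> \<G>" for A using that U_sub by (cases "A = C") (auto simp: \<U>_def)
    have "sqfree_lex_ideal (n + m) (Idl\<^bsub>poly_ring (Xvars (n + m))\<^esub> I)" for m
    proof -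
      have sub: "A \<subseteq> {1..n + m}" if "A \<in> \<G>" for A using \<G>(1)[OF that] by fastforce
      have "sqfree_lex_ideal (n + m) (mono_ideal (n + m) (sqfree_monomial ` \<G>) :: 'k polynomial set)"
      proof (rule iffD2[OF sqfree_lex_ideal_iff], rule sub, assumption, intro conjI allI impI)
        show "{} \<notin> \<G>" using \<G>(3)[of "{}"] d1 by auto
        fix B C' assume B: "B \<subseteq> {1..n + m}" and C': "C' \<subseteq> {1..n + m}"
          and gt: "slex_gt (sqfree_monomial C') (sqfree_monomial B)" and "\<exists>A\<in>\<G>. A \<subseteq> B"
        then obtain A where A: "A \<in> \<G>" "A \<subseteq> B" by blast
        obtain x where x: "x \<in> C'" "x \<notin> B" "\<And>y. y < x \<Longrightarrow> y \<in> C' \<longleftrightarrow> y \<in> B"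
          using gt slex_gt_sqfree_monomial_iff[OF fin[OF C'] fin[OF B]] by auto
        obtain j where j: "j \<in> {d..n}" "A = insert j {1..<d}" using shape[OF A(1) all[OF A(1)]] by blast
        have "1 \<le> x" using x(1) C' by auto
        then have "d \<le> x" using x(2) j A(2) by (meson atLeastLessThan_iff insertI2 not_less subsetD)
        then have sub_C: "{1..<d} \<subseteq> C'" using x(3) A(2) j by auto
        \<comment> \<open>The first difference x is at least d, as B contains {1..d-1}. If j < x,
          the generator inside B also lies in C'; if x < j, the generator {1..d-1,x} comes earlier
          and lies in C'.\<close>
        show "\<exists>A'\<in>\<G>. A' \<subseteq> C'"
        proof (cases "j < x")
          case True
          then have "j \<in> C'" using x(3) A(2) j by auto
          then show ?thesis using sub_C A(1) j by blast
        next
          case False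
          then have "x < j" using x(2) A(2) j by (cases "x = j") auto
          have "insert x {1..<d} \<in> \<G>"
            by (rule initial[OF A(1), of _ x]) (use \<open>d \<le> x\<close> \<open>x < j\<close> j d1 in auto)
          then show ?thesis using sub_C x(1) by blast
        qed
      qed
      then show ?thesis
        by (simp only: extend_mono_ideal[OF G_mon[unfolded G_eq]] G_gen[unfolded G_eq, symmetric])
    qed
    then show False using not_usli lex by (simp add: usli_def)
  qed
  obtain x where x: "x \<in> {1..<d} - C" "\<forall>y\<in>{1..<x}. y \<in> C" using least[OF C_not] by blast
  have C_sub: "C \<subseteq> {1..n}" using \<G>(1) C(1) .
  \<comment> \<open>All these sets are slex-larger than \<open>C\<close>, since they contain the
    least index below d that \<open>C\<close> omits.\<close>
  have e_in: "insert j {1..<d} \<in> \<U>" if j: "j \<in> {d..n}" for j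
  proof -
    have "insert j {1..<d} \<in> \<G>"
    proof (rule initial[OF C(1), of _ x])
      fix y assume "y < x"
      then show "y \<in> insert j {1..<d} \<longleftrightarrow> y \<in> C" using x j C_sub by fastforce
    qed (use x j d1 d_le in auto)
    then show ?thesis using C_not by (auto simp: \<U>_def)
  qed
  have \<U>_eq: "\<U> = (\<lambda>j. insert j {1..<d}) ` {d..n}"
  proof
    show "\<U> \<subseteq> (\<lambda>j. insert j {1..<d}) ` {d..n}"
    proof
      fix A assume A: "A \<in> \<U>"
      then have "A \<in> \<G>" by (simp add: \<U>_def)
      from shape[OF this U_sub[OF A]] show "A \<in> (\<lambda>j. insert j {1..<d}) ` {d..n}" by blast
    qed
  qed (use e_in in blast)
  show d2: "2 \<le> d" using C_not d1 by (cases "d = 1") auto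
  \<comment> \<open>For d = n the only index set of size d is {1..n}, which contains
    {1..d-1}.\<close>
  show dn: "d < n"
  proof (rule ccontr)
    assume "\<not> d < n"
    then have "C = {1..n}" using C_sub \<G>(3)[OF C(1)] d_le by (intro card_subset_eq) auto
    then show False using C_not d_le by auto
  qed
  \<comment> \<open>The slex-largest set of size d that does not contain {1..d-1}: the latest
    possible element is omitted and the next two follow.\<close>
  let ?w = "{1..d+1} - {d-1}"
  have "card ?w = card {1..d+1} - 1" by (rule card_Diff_singleton) (use d2 in auto)
  then have w: "?w \<subseteq> {1..n}" "card ?w = d" using d2 dn by auto
  have "?w = C"
  proof (rule ccontr)
    assume "?w \<noteq> C"
    then have "\<not> ?w \<subseteq> C" using card_subset_eq[of C ?w] w \<G>(2,3)[OF C(1)] by auto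
    then have "\<exists>x. x \<in> ?w - C" by blast
    \<comment> \<open>The first difference between this set and \<open>C\<close>. Below it,
      \<open>C\<close> cannot contain d - 1, because it would then contain all of {1..d-1}. So the
      set is slex-larger than \<open>C\<close>, hence among the other generators, and these all
      contain {1..d-1}.\<close>
    define z where "z = (LEAST x. x \<in> ?w - C)"
    have z: "z \<in> ?w - C" unfolding z_def by (rule LeastI_ex) fact
    have z_least: "y \<in> C" if "y < z" "y \<in> ?w" for y
      using not_less_Least[of y "\<lambda>x. x \<in> ?w - C"] that by (auto simp: z_def)
    have "?w \<in> \<G>"
    proof (rule initial[OF C(1) w z])
      fix y assume y: "y < z"
      show "y \<in> ?w \<longleftrightarrow> y \<in> C"
      proof
        assume yC: "y \<in> C"
        have "y \<noteq> d - 1"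
        proof
          assume "y = d - 1"
          have "{1..<d} \<subseteq> C"
          proof (intro subsetI)
            fix i assume "i \<in> {1..<d}"
            then show "i \<in> C" using yC \<open>y = d - 1\<close> y z_least[of i] by (cases "i = d - 1") auto
          qed
          then show False using C_not by blast
        qed
        then show "y \<in> ?w" using yC C_sub y z by auto
      qed (use z_least y in blast)
    qed
    then have "?w \<in> \<U>" using \<open>?w \<noteq> C\<close> by (simp add: \<U>_def)
    then have "{1..<d} \<subseteq> ?w" by (rule U_sub)
    moreover have "d - 1 \<in> {1..<d}" using d2 by auto
    ultimately show False by blast
  qed
  have "\<G> = insert ?w \<U>" using C(1) \<open>?w = C\<close> by (auto simp: \<U>_def)
  then show "min_gens n I = insert (sqfree_monomial ?w) ((\<lambda>j. sqfree_monomial (insert j {1..<d})) ` {d..n})"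
    using G_eq \<U>_eq by (simp add: G_def image_image)
qed

theorem theorem3p11:
  fixes n d q :: nat
    and I :: "'k::field polynomial set"
    and f :: "nat \<Rightarrow> monomial"
  assumes "ausli n d I"
    and "bij_betw f {1..q} (min_gens n I)"
  shows "krull_dim (poly_ring (XTvars n q) Quot (sym_ideal n q f :: 'k polynomial set)) = enat (n + 1) \<and>
         graded_multiplicity (XTvars n q) (sym_ideal n q f :: 'k polynomial set)
           = 2 * of_nat (card (min_gens n I)) - 2"
proof -
  note G = ausli_min_gens[OF assms(1)]
  let ?e = "\<lambda>j. sqfree_monomial (insert j {1..<d})" and ?w = "sqfree_monomial ({1..d+1} - {d-1})"
  \<comment> \<open>The enumeration of the generators is arbitrary; its inverse tells which
    T-variable belongs to a given generator.\<close>
  define g where "g = inv_into {1..q} f"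
  have g: "bij_betw g (min_gens n I) {1..q}" unfolding g_def by (rule bij_betw_inv_into[OF assms(2)])
  have fg: "f (g u) = u" if "u \<in> min_gens n I" for u
    unfolding g_def by (rule bij_betw_inv_into_right[OF assms(2) that])
  have e_inj: "inj_on ?e {d..n}"
  proof (rule inj_onI)
    fix i j assume "i \<in> {d..n}" "j \<in> {d..n}" "?e i = ?e j"
    then have "insert i {1..<d} = insert j {1..<d}" by (simp add: sqfree_monomial_inject)
    then show "i = j" using \<open>i \<in> {d..n}\<close> \<open>j \<in> {d..n}\<close> by auto
  qed
  have w: "?w \<notin> ?e ` {d..n}"
  proof
    assume "?w \<in> ?e ` {d..n}"
    then obtain j where "j \<in> {d..n}" "{1..d+1} - {d-1} = insert j {1..<d}" by (auto simp: sqfree_monomial_inject)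
    moreover have "d - 1 \<in> {1..<d}" using G(1) by auto
    ultimately show False by blast
  qed
  have g_inj: "inj_on g (min_gens n I)" using g by (rule bij_betw_imp_inj_on)
  interpret ausli_generators n d q f "\<lambda>j. g (?e j)" "g ?w"
  proof
    show "2 \<le> d" "d < n" by (fact G)+
    show "f (g (?e j)) = ?e j" if "j \<in> {d..n}" for j using fg that by (simp add: G(3))
    show "f (g ?w) = ?w" using fg by (simp add: G(3))
    show "inj_on (\<lambda>j. g (?e j)) {d..n}"
      using comp_inj_on[OF e_inj inj_on_subset[OF g_inj]] by (simp add: G(3) comp_def subset_insertI)
    show "g ?w \<notin> (\<lambda>j. g (?e j)) ` {d..n}"
      using w g_inj inj_onD[OF g_inj, of ?w] by (auto simp: G(3))
    show "{1..q} = insert (g ?w) ((\<lambda>j. g (?e j)) ` {d..n})"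
      using bij_betw_imp_surj_on[OF g] by (simp add: G(3) image_image)
  qed
  have "card (min_gens n I) = q" using bij_betw_same_card[OF assms(2)] by simp
  then show ?thesis using krull_dim_and_multiplicity[where 'k = 'k] by simp
qed

end
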